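(* Let $(R,B)$ be a multiplicity free unital based ring. Let $\mathbf F,\mathbf F'\in X(R,B)$ and let $\rho\in Aut(R,B)$ be such that $\rho\cdot (F')^{-1}(0)=F^{-1}(0)$. Let $\mathcal B$ be a finite set of $G$-invariant rational monomials such that every $\mathbf F''\in X(R,B)$ with $(F'')^{-1}(0)=F^{-1}(0)$ has non-zero (defined) evaluations on $\mathcal B$, and the evaluations of such $\mathbf F''$ on all $G$-invariant rational monomials are completely determined by its evaluations on $\mathcal B$. Then $\mathcal C(\mathbf F)$ and $\mathcal C(\mathbf F')$ are monoidally equivalent if and only if $$F(m)=F'(\rho\cdot m)\qquad\text{for all } m\in\mathcal B.$$
   Context: $k$ is an algebraically closed field of characteristic $0$. Based rings. A unital based ring $(R,B)$ is a ring $R$, free as a $\mathbb Z$-module on a finite basis $B$ containing $1=1_R$, with $XY=\sum_{Z\in B}N_{XY}^Z Z$ for non-negative integers $N_{XY}^Z$, and a bijection $*:B\to B$ with $1^*=1$ that extends to an anti-involution of $R$ and satisfies $N_{XY}^1=1$ if $Y=X^*$ and $0$ otherwise. It is multiplicity free if all $N_{XY}^Z\in\{0,1\}$. $\Gamma=\{\gamma_{ab}^c:=(a,b,c)\in B^3: N_{ab}^c\ne0\}$. $Aut(R,B)$ is the group of bijections $\rho:B\to B$ with $N_{\rho(X)\rho(Y)}^{\rho(Z)}=N_{XY}^Z$ for all $X,Y,Z$. $X(R,B)$ in the multiplicity free case. For $a,b,c,d,e,f\in B$ with $N_{ab}^eN_{ec}^d\ne0$ and $N_{bc}^fN_{af}^d\neq0$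 let $\Phi_{abc}^{d;ef}$ be an indeterminate; $\Phi$ is the (finite) set of these, and $\Phi_{abc}^d$ is the square matrix $(\Phi_{abc}^{d;ef})_{e,f}$. A point $\mathbf F\in X(R,B)$ is a map $F:\Phi\to k$, with values written $F_{abc}^{d;ef}$, such that: (1) $F_{a1b}^{c;ab}=1$ whenever $N_{ab}^c\ne0$; (2) $F_{aa^*a}^{a;11}\ne0$ for all $a$; (3) whenever $N_{ab}^fN_{fc}^iN_{id}^e\ne0$ and $N_{cd}^hN_{bh}^jN_{aj}^e\ne0$, $F_{fcd}^{e;ih}F_{abh}^{e;fj}=\sum_gF_{abc}^{i;fg}F_{agd}^{e;ij}F_{bcd}^{j;gh}$, the sum over $g\in B$ with $N_{bc}^gN_{ag}^iN_{gd}^j\ne0$, the left side being read as $0$ if $N_{fh}^e=0$; (4) each matrix $F_{abc}^d$ is invertible. $F^{-1}(0)=\{\phi\in\Phi: F(\phi)=0\}$. To $\mathbf F$ is associated a fusion category (finite semisimple rigid $k$-linear monoidal category) $\mathcal C(\mathbf F)$ by the standard construction: simple objects indexed by $B$, $\mathrm{Hom}(a\otimes b,c)$ of dimension $N_{ab}^c$ with a chosen basis, and $F_{abc}^d$ expressing the left-parenthesized basis (via $e$) of $\mathrm{Hom}(a\otimes b\otimes c,d)$ in terms of the right-parenthesized basis (via $f$). Invariant monomials. The gauge group $G$ is the group of all functions $g:\Gamma\to k^\times$, $g_{ab}^c=g(\gamma_{ab}^c)$, acting by $(g\cdot F)_{abc}^{d;ef}=g_{ab}^eg_{ec}^d(g_{bc}^fg_{af}^d)^{-1}F_{abc}^{d;ef}$.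 For a set $S$, $A(S)$ is the free abelian group on $S$, written multiplicatively. $t_A:A(\Phi)\to A(\Gamma)$ is the homomorphism with $t_A(\Phi_{abc}^{d;ef})=\gamma_{ab}^e\gamma_{ec}^d(\gamma_{bc}^f\gamma_{af}^d)^{-1}$. A rational monomial is an element of $A(\Phi)$; it is $G$-invariant if it lies in $\ker t_A$. For $m=\prod_i\phi_i^{k_i}$ (distinct $\phi_i$, $k_i\neq0$), $F(m)=\prod_iF(\phi_i)^{k_i}$, undefined if $F(\phi_i)=0$ for some $i$ with $k_i<0$. $Aut(R,B)$ acts on $\Phi$ by $\rho\cdot\Phi_{abc}^{d;ef}=\Phi_{\rho(a)\rho(b)\rho(c)}^{\rho(d);\rho(e)\rho(f)}$, extended to subsets of $\Phi$ elementwise and to monomials multiplicatively.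
   Formalization: For fixed ρ the iff is false (nontrivial 3-cocycle on Z/5, ρ = times 2). Proved: equivalence sending each a to ρ(a) iff F(m)=F'(ρ·m); plain equivalence iff this holds for some σ in Aut(R,B) with σ·F⁻¹(0)=(F')⁻¹(0). The zero-set condition on ρ is likewise reversed to ρ·F⁻¹(0)=(F')⁻¹(0). *)

theory Defs
  imports "HOL-Algebra.Free_Abelian_Groups" "HOL-Computational_Algebra.Polynomial"
begin

section \<open>Based rings\<close>

text \<open>The ring \<open>R\<close> is the whole type \<open>'r\<close>; the basis \<open>B\<close> is a set of its elements.\<close>

definition is_coords :: "'r::ring_1 set \<Rightarrow> 'r \<Rightarrow> ('r \<Rightarrow> int) \<Rightarrow> bool" where
  "is_coords B x c \<longleftrightarrow> (\<forall>b. b \<notin> B \<longrightarrow> c b = 0) \<and> x = (\<Sum>b\<in>B. of_int (c b) * b)"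

definition finite_int_basis :: "'r::ring_1 set \<Rightarrow> bool" where
  "finite_int_basis B \<longleftrightarrow> finite B \<and> (\<forall>x. \<exists>!c. is_coords B x c)"

definition Nst :: "'r::ring_1 set \<Rightarrow> 'r \<Rightarrow> 'r \<Rightarrow> 'r \<Rightarrow> int" where
  "Nst B x y z = (THE c. is_coords B (x * y) c) z"

definition anti_involution :: "('r::ring_1 \<Rightarrow> 'r) \<Rightarrow> bool" where
  "anti_involution \<tau> \<longleftrightarrow>
     (\<forall>x y. \<tau> (x + y) = \<tau> x + \<tau> y) \<and> (\<forall>x y. \<tau> (x * y) = \<tau> y * \<tau> x) \<and> (\<forall>x. \<tau> (\<tau> x) = x)"

definition unital_based_ring :: "'r::ring_1 set \<Rightarrow> ('r \<Rightarrow> 'r) \<Rightarrow> bool" where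
  "unital_based_ring B star \<longleftrightarrow>
     finite_int_basis B \<and> 1 \<in> B \<and>
     (\<forall>x\<in>B. \<forall>y\<in>B. \<forall>z\<in>B. 0 \<le> Nst B x y z) \<and>
     bij_betw star B B \<and> star 1 = 1 \<and>
     (\<exists>\<tau>. anti_involution \<tau> \<and> (\<forall>x\<in>B. \<tau> x = star x)) \<and>
     (\<forall>x\<in>B. \<forall>y\<in>B. Nst B x y 1 = (if y = star x then 1 else 0))"

definition multiplicity_free :: "'r::ring_1 set \<Rightarrow> bool" where
  "multiplicity_free B \<longleftrightarrow> (\<forall>x\<in>B. \<forall>y\<in>B. \<forall>z\<in>B. Nst B x y z \<in> {0, 1})"

definition based_aut :: "'r::ring_1 set \<Rightarrow> ('r \<Rightarrow> 'r) set" where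
  "based_aut B = {\<rho>. bij_betw \<rho> B B \<and>
     (\<forall>x\<in>B. \<forall>y\<in>B. \<forall>z\<in>B. Nst B (\<rho> x) (\<rho> y) (\<rho> z) = Nst B x y z)}"


section \<open>The variety \<open>X(R,B)\<close>\<close>

text \<open>The tuple \<open>(a, b, c, d, e, f)\<close> stands for the indeterminate
  \<open>\<Phi>\<close> with lower indices \<open>a b c\<close> and upper indices \<open>d ; e f\<close>.\<close>

type_synonym 'b phi = "'b \<times> 'b \<times> 'b \<times> 'b \<times> 'b \<times> 'b"

definition Gamma :: "'r::ring_1 set \<Rightarrow> ('r \<times> 'r \<times> 'r) set" where
  "Gamma B = {(a, b, c). a \<in> B \<and> b \<in> B \<and> c \<in> B \<and> Nst B a b c \<noteq> 0}"

definition lpaths :: "'r::ring_1 set \<Rightarrow> 'r \<Rightarrow> 'r \<Rightarrow> 'r \<Rightarrow> 'r \<Rightarrow> 'r set" where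
  "lpaths B a b c d = {e \<in> B. Nst B a b e \<noteq> 0 \<and> Nst B e c d \<noteq> 0}"

definition rpaths :: "'r::ring_1 set \<Rightarrow> 'r \<Rightarrow> 'r \<Rightarrow> 'r \<Rightarrow> 'r \<Rightarrow> 'r set" where
  "rpaths B a b c d = {f \<in> B. Nst B b c f \<noteq> 0 \<and> Nst B a f d \<noteq> 0}"

definition Phi :: "'r::ring_1 set \<Rightarrow> 'r phi set" where
  "Phi B = {(a, b, c, d, e, f). a \<in> B \<and> b \<in> B \<and> c \<in> B \<and> d \<in> B \<and>
      e \<in> lpaths B a b c d \<and> f \<in> rpaths B a b c d}"

text \<open>Rows and columns are indexed by different sets, so invertibility is stated
  as the existence of a two-sided inverse.\<close>

definition invertible_matrix :: "'i set \<Rightarrow> 'j set \<Rightarrow> ('i \<Rightarrow> 'j \<Rightarrow> 'k::field) \<Rightarrow> bool" where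
  "invertible_matrix I J M \<longleftrightarrow> (\<exists>M'.
     (\<forall>i\<in>I. \<forall>i'\<in>I. (\<Sum>j\<in>J. M i j * M' j i') = (if i = i' then 1 else 0)) \<and>
     (\<forall>j\<in>J. \<forall>j'\<in>J. (\<Sum>i\<in>I. M' j i * M i j') = (if j = j' then 1 else 0)))"

definition pentagon_eqs :: "'r::ring_1 set \<Rightarrow> ('r phi \<Rightarrow> 'k::field) \<Rightarrow> bool" where
  "pentagon_eqs B F \<longleftrightarrow>
     (\<forall>a\<in>B. \<forall>b\<in>B. \<forall>c\<in>B. \<forall>d\<in>B. \<forall>e\<in>B. \<forall>f\<in>B. \<forall>i\<in>B. \<forall>h\<in>B. \<forall>j\<in>B.
        Nst B a b f \<noteq> 0 \<and> Nst B f c i \<noteq> 0 \<and> Nst B i d e \<noteq> 0 \<and>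
        Nst B c d h \<noteq> 0 \<and> Nst B b h j \<noteq> 0 \<and> Nst B a j e \<noteq> 0 \<longrightarrow>
        (if Nst B f h e = 0 then 0 else F (f, c, d, e, i, h) * F (a, b, h, e, f, j)) =
        (\<Sum>g | g \<in> B \<and> Nst B b c g \<noteq> 0 \<and> Nst B a g i \<noteq> 0 \<and> Nst B g d j \<noteq> 0.
            F (a, b, c, i, f, g) * F (a, g, d, e, i, j) * F (b, c, d, j, g, h)))"

definition Xvar :: "'r::ring_1 set \<Rightarrow> ('r \<Rightarrow> 'r) \<Rightarrow> ('r phi \<Rightarrow> 'k::field) set" where
  "Xvar B star = {F \<in> Phi B \<rightarrow>\<^sub>E UNIV.
     (\<forall>a\<in>B. \<forall>b\<in>B. \<forall>c\<in>B. Nst B a b c \<noteq> 0 \<longrightarrow> F (a, 1, b, c, a, b) = 1) \<and>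
     (\<forall>a\<in>B. F (a, star a, a, a, 1, 1) \<noteq> 0) \<and>
     pentagon_eqs B F \<and>
     (\<forall>a\<in>B. \<forall>b\<in>B. \<forall>c\<in>B. \<forall>d\<in>B.
        invertible_matrix (lpaths B a b c d) (rpaths B a b c d) (\<lambda>e f. F (a, b, c, d, e, f)))}"

definition zeros :: "'r::ring_1 set \<Rightarrow> ('r phi \<Rightarrow> 'k::field) \<Rightarrow> 'r phi set" where
  "zeros B F = {\<phi> \<in> Phi B. F \<phi> = 0}"


section \<open>Invariant rational monomials\<close>

text \<open>The free abelian groups \<open>A(\<Phi>)\<close> and \<open>A(\<Gamma>)\<close> are the
  library groups of finitely supported integer functions, written additively:
  the coefficient of \<open>\<phi>\<close> is its exponent in the monomial.\<close>

fun tA_gen :: "'b phi \<Rightarrow> ('b \<times> 'b \<times> 'b) \<Rightarrow>\<^sub>0 int" where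
  "tA_gen (a, b, c, d, e, f) =
     frag_of (a, b, e) + frag_of (e, c, d) - frag_of (b, c, f) - frag_of (a, f, d)"

definition tA :: "('b phi \<Rightarrow>\<^sub>0 int) \<Rightarrow> ('b \<times> 'b \<times> 'b) \<Rightarrow>\<^sub>0 int" where
  "tA = frag_extend tA_gen"

definition inv_monomials :: "'r::ring_1 set \<Rightarrow> ('r phi \<Rightarrow>\<^sub>0 int) set" where
  "inv_monomials B = kernel (free_Abelian_group (Phi B)) (free_Abelian_group (Gamma B)) tA"

text \<open>\<open>None\<close> is the undefined evaluation.\<close>

definition eval_monomial :: "('b phi \<Rightarrow> 'k::field) \<Rightarrow> ('b phi \<Rightarrow>\<^sub>0 int) \<Rightarrow> 'k option" where
  "eval_monomial F m =
     (if \<exists>\<phi>\<in>Poly_Mapping.keys m. F \<phi> = 0 \<and> Poly_Mapping.lookup m \<phi> < 0 then None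
      else Some (\<Prod>\<phi>\<in>Poly_Mapping.keys m. F \<phi> powi Poly_Mapping.lookup m \<phi>))"

fun act_phi :: "('b \<Rightarrow> 'b) \<Rightarrow> 'b phi \<Rightarrow> 'b phi" where
  "act_phi \<rho> (a, b, c, d, e, f) = (\<rho> a, \<rho> b, \<rho> c, \<rho> d, \<rho> e, \<rho> f)"

definition act_monomial :: "('b \<Rightarrow> 'b) \<Rightarrow> ('b phi \<Rightarrow>\<^sub>0 int) \<Rightarrow> ('b phi \<Rightarrow>\<^sub>0 int)" where
  "act_monomial \<rho> = frag_extend (\<lambda>\<phi>. frag_of (act_phi \<rho> \<phi>))"


section \<open>Linear monoidal categories and their equivalences\<close>

text \<open>Hom sets need not be disjoint, so functors on morphisms take source and target as
  arguments. The associativity isomorphism goes from \<open>x \<otimes> (y \<otimes> z)\<close> to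
  \<open>(x \<otimes> y) \<otimes> z\<close>. Monoidal functors and equivalences between linear categories are
  linear. The constant \<open>monoidal_structure\<close> describes a strong monoidal structure
  \<open>T x \<otimes> T y \<rightarrow> T (x \<otimes> y)\<close>, \<open>1 \<rightarrow> T 1\<close>.\<close>

record ('o, 'm, 'k) lin_moncat =
  Obj :: "'o set"
  Hom :: "'o \<Rightarrow> 'o \<Rightarrow> 'm set"
  Idm :: "'o \<Rightarrow> 'm"
  Cmp :: "'m \<Rightarrow> 'm \<Rightarrow> 'm"
  Add :: "'m \<Rightarrow> 'm \<Rightarrow> 'm"
  Scl :: "'k \<Rightarrow> 'm \<Rightarrow> 'm"
  Unit :: "'o"
  TenO :: "'o \<Rightarrow> 'o \<Rightarrow> 'o"
  TenM :: "'m \<Rightarrow> 'm \<Rightarrow> 'm"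
  Asc :: "'o \<Rightarrow> 'o \<Rightarrow> 'o \<Rightarrow> 'm"
  LUn :: "'o \<Rightarrow> 'm"
  RUn :: "'o \<Rightarrow> 'm"

definition is_iso :: "('o, 'm, 'k) lin_moncat \<Rightarrow> 'o \<Rightarrow> 'o \<Rightarrow> 'm \<Rightarrow> bool" where
  "is_iso C x y u \<longleftrightarrow> u \<in> Hom C x y \<and>
     (\<exists>v \<in> Hom C y x. Cmp C v u = Idm C x \<and> Cmp C u v = Idm C y)"

definition linear_functor ::
  "('o, 'm, 'k) lin_moncat \<Rightarrow> ('p, 'n, 'k) lin_moncat \<Rightarrow> ('o \<Rightarrow> 'p) \<Rightarrow> ('o \<Rightarrow> 'o \<Rightarrow> 'm \<Rightarrow> 'n) \<Rightarrow> bool" where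
  "linear_functor C D T TM \<longleftrightarrow>
     (\<forall>x\<in>Obj C. T x \<in> Obj D \<and> TM x x (Idm C x) = Idm D (T x)) \<and>
     (\<forall>x\<in>Obj C. \<forall>y\<in>Obj C. \<forall>u\<in>Hom C x y. TM x y u \<in> Hom D (T x) (T y)) \<and>
     (\<forall>x\<in>Obj C. \<forall>y\<in>Obj C. \<forall>z\<in>Obj C. \<forall>u\<in>Hom C x y. \<forall>v\<in>Hom C y z.
        TM x z (Cmp C v u) = Cmp D (TM y z v) (TM x y u)) \<and>
     (\<forall>x\<in>Obj C. \<forall>y\<in>Obj C. \<forall>u\<in>Hom C x y. \<forall>v\<in>Hom C x y.
        TM x y (Add C u v) = Add D (TM x y u) (TM x y v)) \<and>
     (\<forall>x\<in>Obj C. \<forall>y\<in>Obj C. \<forall>u\<in>Hom C x y. \<forall>s.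
        TM x y (Scl C s u) = Scl D s (TM x y u))"

definition natural_iso ::
  "('o, 'm, 'k) lin_moncat \<Rightarrow> ('p, 'n, 'k) lin_moncat \<Rightarrow> ('o \<Rightarrow> 'p) \<Rightarrow> ('o \<Rightarrow> 'o \<Rightarrow> 'm \<Rightarrow> 'n) \<Rightarrow>
     ('o \<Rightarrow> 'p) \<Rightarrow> ('o \<Rightarrow> 'o \<Rightarrow> 'm \<Rightarrow> 'n) \<Rightarrow> ('o \<Rightarrow> 'n) \<Rightarrow> bool" where
  "natural_iso C D S SM T TM \<eta> \<longleftrightarrow>
     (\<forall>x\<in>Obj C. is_iso D (S x) (T x) (\<eta> x)) \<and>
     (\<forall>x\<in>Obj C. \<forall>y\<in>Obj C. \<forall>u\<in>Hom C x y.
        Cmp D (\<eta> y) (SM x y u) = Cmp D (TM x y u) (\<eta> x))"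

definition equivalence_functor ::
  "('o, 'm, 'k) lin_moncat \<Rightarrow> ('p, 'n, 'k) lin_moncat \<Rightarrow> ('o \<Rightarrow> 'p) \<Rightarrow> ('o \<Rightarrow> 'o \<Rightarrow> 'm \<Rightarrow> 'n) \<Rightarrow> bool" where
  "equivalence_functor C D T TM \<longleftrightarrow> linear_functor C D T TM \<and>
     (\<exists>S SM \<eta> \<epsilon>. linear_functor D C S SM \<and>
        natural_iso C C (\<lambda>x. x) (\<lambda>x y u. u)
          (\<lambda>x. S (T x)) (\<lambda>x y u. SM (T x) (T y) (TM x y u)) \<eta> \<and>
        natural_iso D D (\<lambda>x. T (S x)) (\<lambda>x y u. TM (S x) (S y) (SM x y u))
          (\<lambda>x. x) (\<lambda>x y u. u) \<epsilon>)"

definition monoidal_structure ::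
  "('o, 'm, 'k) lin_moncat \<Rightarrow> ('p, 'n, 'k) lin_moncat \<Rightarrow> ('o \<Rightarrow> 'p) \<Rightarrow> ('o \<Rightarrow> 'o \<Rightarrow> 'm \<Rightarrow> 'n) \<Rightarrow>
     ('o \<Rightarrow> 'o \<Rightarrow> 'n) \<Rightarrow> 'n \<Rightarrow> bool" where
  "monoidal_structure C D T TM J \<iota> \<longleftrightarrow>
     is_iso D (Unit D) (T (Unit C)) \<iota> \<and>
     (\<forall>x\<in>Obj C. \<forall>y\<in>Obj C. is_iso D (TenO D (T x) (T y)) (T (TenO C x y)) (J x y)) \<and>
     (\<forall>x\<in>Obj C. \<forall>x'\<in>Obj C. \<forall>y\<in>Obj C. \<forall>y'\<in>Obj C. \<forall>u\<in>Hom C x x'. \<forall>v\<in>Hom C y y'.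
        Cmp D (J x' y') (TenM D (TM x x' u) (TM y y' v)) =
        Cmp D (TM (TenO C x y) (TenO C x' y') (TenM C u v)) (J x y)) \<and>
     (\<forall>x\<in>Obj C. \<forall>y\<in>Obj C. \<forall>z\<in>Obj C.
        Cmp D (TM (TenO C x (TenO C y z)) (TenO C (TenO C x y) z) (Asc C x y z))
          (Cmp D (J x (TenO C y z)) (TenM D (Idm D (T x)) (J y z))) =
        Cmp D (J (TenO C x y) z)
          (Cmp D (TenM D (J x y) (Idm D (T z))) (Asc D (T x) (T y) (T z)))) \<and>
     (\<forall>x\<in>Obj C.
        LUn D (T x) = Cmp D (TM (TenO C (Unit C) x) x (LUn C x))
          (Cmp D (J (Unit C) x) (TenM D \<iota> (Idm D (T x)))) \<and>
        RUn D (T x) = Cmp D (TM (TenO C x (Unit C)) x (RUn C x))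
          (Cmp D (J x (Unit C)) (TenM D (Idm D (T x)) \<iota>)))"

definition monoidally_equivalent ::
  "('o, 'm, 'k) lin_moncat \<Rightarrow> ('p, 'n, 'k) lin_moncat \<Rightarrow> bool" where
  "monoidally_equivalent C D \<longleftrightarrow>
     (\<exists>T TM J \<iota>. equivalence_functor C D T TM \<and> monoidal_structure C D T TM J \<iota>)"

text \<open>Equivalences whose effect on isomorphism classes of the objects \<open>s b\<close>,
  \<open>b \<in> B\<close>, is the given relabelling \<open>\<rho>\<close>. A prescribed \<open>\<rho>\<close> need not be
  realized by any equivalence, even if the two categories are equivalent: for a 3-cocycle \<open>F\<close>
  of the cyclic group of order 5 with nontrivial class, \<open>C(F)\<close> is equivalent to itself, but
  not along multiplication by 2, which acts on the third cohomology group as multiplication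
  by 4.\<close>

definition monoidally_equivalent_along ::
  "'b set \<Rightarrow> ('b \<Rightarrow> 'o) \<Rightarrow> ('b \<Rightarrow> 'p) \<Rightarrow> ('b \<Rightarrow> 'b) \<Rightarrow>
     ('o, 'm, 'k) lin_moncat \<Rightarrow> ('p, 'n, 'k) lin_moncat \<Rightarrow> bool" where
  "monoidally_equivalent_along B s t \<rho> C D \<longleftrightarrow>
     (\<exists>T TM J \<iota>. equivalence_functor C D T TM \<and> monoidal_structure C D T TM J \<iota> \<and>
        (\<forall>b\<in>B. \<exists>u. is_iso D (T (s b)) (t (\<rho> b)) u))"


section \<open>The category \<open>C(F)\<close>\<close>

text \<open>An object is a finite direct sum of simple objects, given as a finite set of labels
  (the summands) each of which carries a simple type, its \<open>col\<close>. A morphism is a matrix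
  (target index first) with entries in \<open>k\<close> between summands of equal type. The
  summands of a tensor product are \<open>Node x y c\<close>, one for each pair of summands
  \<open>x\<close>, \<open>y\<close> and each \<open>c\<close> occurring in \<open>col x * col y\<close>; for \<open>X = {x}\<close>
  and \<open>Y = {y}\<close> this label stands for the chosen basis vector of the one-dimensional space
  \<open>Hom(a \<otimes> b, c)\<close>. The labels \<open>Leaf n b\<close> provide arbitrarily many copies of
  \<open>b\<close>.\<close>

datatype 'b tree = Leaf nat 'b | Node "'b tree" "'b tree" 'b

fun col :: "'b tree \<Rightarrow> 'b" where
  "col (Leaf n b) = b"
| "col (Node x y c) = c"

type_synonym ('b, 'k) tmat = "'b tree \<Rightarrow> 'b tree \<Rightarrow> 'k"

definition simple_obj :: "'b \<Rightarrow> 'b tree set" where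
  "simple_obj b = {Leaf 0 b}"

definition ten_obj :: "'r::ring_1 set \<Rightarrow> 'r tree set \<Rightarrow> 'r tree set \<Rightarrow> 'r tree set" where
  "ten_obj B P Q = {Node x y c | x y c. x \<in> P \<and> y \<in> Q \<and> c \<in> B \<and> Nst B (col x) (col y) c \<noteq> 0}"

text \<open>The sum ranges over a finite set because matrices have finite support.\<close>

definition mat_comp :: "('b, 'k::field) tmat \<Rightarrow> ('b, 'k) tmat \<Rightarrow> ('b, 'k) tmat" where
  "mat_comp v u = (\<lambda>z x. \<Sum>y | u y x \<noteq> 0. v z y * u y x)"

fun ten_mor :: "'r::ring_1 set \<Rightarrow> ('r, 'k::field) tmat \<Rightarrow> ('r, 'k) tmat \<Rightarrow> ('r, 'k) tmat" where
  "ten_mor B u v (Node x' y' c') (Node x y c) =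
     (if c' = c \<and> c \<in> B \<and> Nst B (col x) (col y) c \<noteq> 0 then u x' x * v y' y else 0)"
| "ten_mor B u v _ _ = 0"

text \<open>\<open>F\<close> expresses the left-parenthesized basis in terms of the right-parenthesized
  one: composing the left-parenthesized basis vector via \<open>e\<close> with
  \<open>a \<otimes> (b \<otimes> c) \<rightarrow> (a \<otimes> b) \<otimes> c\<close> gives the sum over \<open>f\<close> of
  \<open>F (a, b, c, d, e, f)\<close> times the right-parenthesized basis vector via \<open>f\<close>. So the
  values of \<open>F\<close> are the matrix entries of that morphism, row \<open>e\<close> and column
  \<open>f\<close>, and \<open>pentagon_eqs\<close> is its pentagon axiom.\<close>

fun assoc_entry :: "('b phi \<Rightarrow> 'k::field) \<Rightarrow> ('b, 'k) tmat" where
  "assoc_entry F (Node (Node x y e) z d) (Node x' (Node y' z' f) d') =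
     (if x = x' \<and> y = y' \<and> z = z' \<and> d = d' then F (col x, col y, col z, d, e, f) else 0)"
| "assoc_entry F _ _ = 0"

definition fus_cat ::
  "'r::ring_1 set \<Rightarrow> ('r phi \<Rightarrow> 'k::field) \<Rightarrow> ('r tree set, ('r, 'k) tmat, 'k) lin_moncat" where
  "fus_cat B F = \<lparr>
     Obj = {P. finite P \<and> col ` P \<subseteq> B},
     Hom = (\<lambda>P Q. {u. \<forall>q p. u q p \<noteq> 0 \<longrightarrow> q \<in> Q \<and> p \<in> P \<and> col q = col p}),
     Idm = (\<lambda>P q p. if q = p \<and> p \<in> P then 1 else 0),
     Cmp = mat_comp,
     Add = (\<lambda>u v q p. u q p + v q p),
     Scl = (\<lambda>s u q p. s * u q p),
     Unit = simple_obj 1,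
     TenO = ten_obj B,
     TenM = ten_mor B,
     Asc = (\<lambda>P Q R q p. if q \<in> ten_obj B (ten_obj B P Q) R \<and> p \<in> ten_obj B P (ten_obj B Q R)
        then assoc_entry F q p else 0),
     LUn = (\<lambda>P q p. if q \<in> P \<and> p = Node (Leaf 0 1) q (col q) then 1 else 0),
     RUn = (\<lambda>P q p. if q \<in> P \<and> p = Node q (Leaf 0 1) (col q) then 1 else 0)\<rparr>"

end

theory Submission
  imports Defs
begin

text \<open>
  A monoidal functor sending the simple object \<open>b\<close> to \<open>\<rho> b\<close> sends the chosen
  basis vector of \<open>Hom(c, a \<otimes> b)\<close> to a multiple \<open>g\<close> of the chosen basis vector of
  \<open>Hom(\<rho> c, \<rho> a \<otimes> \<rho> b)\<close>; compatibility with the associativity isomorphisms says that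
  these scalars form a gauge transformation from \<open>F\<close> to the relabelled \<open>F'\<close>.
  Conversely a gauge transformation is the diagonal monoidal structure of a functor that only
  relabels summands. So the question is when two points with the same zeros
  are gauge equivalent. The ratio of their values is a character of the free abelian group on the
  non-zero coordinates; it comes from a gauge transformation iff it factors through \<open>t\<^sub>A\<close>,
  because characters of a subgroup of \<open>A(\<Gamma>)\<close> extend to \<open>A(\<Gamma>)\<close>
  (\<open>k\<^sup>\<times>\<close> is divisible), and it factors iff it is trivial on \<open>ker t\<^sub>A\<close>, that is, iff
  the invariant monomials agree. Finally, every equivalence permutes the simple objects, which
  are the objects with only scalar endomorphisms, and preserves the structure constants because a
  multiplicity is non-zero exactly when there is a split embedding into the tensor product.
\<close>

section \<open>Characters of free abelian groups\<close>

text \<open>The determination hypothesis compares points of \<open>Xvar\<close> only. Hence the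
  relabelled \<open>F'\<close> must itself be shown to satisfy the pentagon, unit and invertibility
  conditions before agreement on the finite set \<open>\<B>\<close> can spread to all invariant
  monomials. Coordinates that vanish carry no ratio, and the image of the remaining ones in the free
  abelian group on \<open>Gamma\<close> is a subgroup that need not be saturated: a multiple of an
  element may lie in it without the element itself. Extending the character across such an element
  means extracting a root in \<open>k\<close>. On the categorical side, a functor sends a simple
  object only to something isomorphic to a simple object, and its tensorator need not be diagonal.
  Images of morphisms become scalars after conjugation with chosen isomorphisms, and the
  associativity axiom has to be rewritten for the conjugated maps. Matrix composition adds an
  obstacle: a sum over an infinite support is 0 by convention, so associativity comes with a
  finiteness condition on columns.\<close>

definition monomial_value :: "('a \<Rightarrow> 'k::field) \<Rightarrow> ('a \<Rightarrow>\<^sub>0 int) \<Rightarrow> 'k" where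
  "monomial_value v m = (\<Prod>a\<in>Poly_Mapping.keys m. v a powi Poly_Mapping.lookup m a)"

text \<open>Exponents can cancel in sums and differences, so products are compared over a common
  finite set containing all supports; the extra factors are zeroth powers.\<close>

lemma monomial_value_superset:
  assumes "finite I" "Poly_Mapping.keys m \<subseteq> I"
  shows "monomial_value v m = (\<Prod>a\<in>I. v a powi Poly_Mapping.lookup m a)"
  unfolding monomial_value_def
  by (rule prod.mono_neutral_left) (use assms in \<open>auto simp: in_keys_iff\<close>)

lemma monomial_value_0 [simp]: "monomial_value v 0 = 1"
  by (simp add: monomial_value_def)

lemma monomial_value_of [simp]: "monomial_value v (frag_of a) = v a"
  by (simp add: monomial_value_def)

lemma monomial_value_diff:
  assumes "\<And>a. v a \<noteq> 0"
  shows "monomial_value v (m - n) = monomial_value v m / monomial_value v n"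
proof -
  let ?I = "Poly_Mapping.keys m \<union> Poly_Mapping.keys n"
  have "Poly_Mapping.keys (m - n) \<subseteq> ?I"
    by (rule keys_diff)
  then show ?thesis
    by (simp add: monomial_value_superset[of ?I] lookup_minus power_int_diff assms prod_dividef)
qed

lemma monomial_value_add:
  assumes "\<And>a. v a \<noteq> 0"
  shows "monomial_value v (m + n) = monomial_value v m * monomial_value v n"
proof -
  let ?I = "Poly_Mapping.keys m \<union> Poly_Mapping.keys n"
  have "Poly_Mapping.keys (m + n) \<subseteq> ?I"
    by (rule Poly_Mapping.keys_add)
  then show ?thesis
    by (simp add: monomial_value_superset[of ?I] lookup_add power_int_add assms prod.distrib)
qed

lemma monomial_value_mult:
  "monomial_value (\<lambda>a. v a * w a) m = monomial_value v m * monomial_value w m"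
  by (simp add: monomial_value_def power_int_mult_distrib prod.distrib)

lemma monomial_value_cong:
  assumes "\<And>a. a \<in> Poly_Mapping.keys m \<Longrightarrow> v a = w a"
  shows "monomial_value v m = monomial_value w m"
  unfolding monomial_value_def by (rule prod.cong) (use assms in auto)

lemma monomial_value_nonzero:
  "(\<And>a. a \<in> Poly_Mapping.keys m \<Longrightarrow> v a \<noteq> 0) \<Longrightarrow> monomial_value v m \<noteq> 0"
  by (auto simp: monomial_value_def)

text \<open>Both sides are homomorphisms in \<open>m\<close> that agree on generators.\<close>

lemma monomial_value_frag_extend:
  assumes v: "\<And>a. v a \<noteq> 0"
  shows "monomial_value v (frag_extend t m) = monomial_value (\<lambda>x. monomial_value v (t x)) m"
proof -
  have "Poly_Mapping.keys m \<subseteq> UNIV" by simp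
  then show ?thesis
    by (induction m rule: frag_induction)
      (auto simp: frag_extend_diff monomial_value_diff monomial_value_nonzero v)
qed

text \<open>The graph of a homomorphism from a subgroup of the free abelian group to the units of
  \<open>k\<close>. Closure under quotients encodes the subgroup and the homomorphism at once, and
  the trivial fibre over 0 makes the relation single-valued. As relations, extensions are simply
  supersets.\<close>

definition partial_character :: "(('a \<Rightarrow>\<^sub>0 int) \<times> 'k::field) set \<Rightarrow> bool" where
  "partial_character W \<longleftrightarrow> (0, 1) \<in> W \<and>
     (\<forall>h y h' y'. (h, y) \<in> W \<longrightarrow> (h', y') \<in> W \<longrightarrow> (h - h', y / y') \<in> W) \<and>
     (\<forall>y. (0, y) \<in> W \<longrightarrow> y = 1) \<and> (\<forall>h y. (h, y) \<in> W \<longrightarrow> y \<noteq> 0)"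

lemma partial_characterD:
  assumes "partial_character W"
  shows "(0, 1) \<in> W"
    and "(h, y) \<in> W \<Longrightarrow> (h', y') \<in> W \<Longrightarrow> (h - h', y / y') \<in> W"
    and "(0, y) \<in> W \<Longrightarrow> y = 1"
    and "(h, y) \<in> W \<Longrightarrow> y \<noteq> 0"
  using assms by (auto simp: partial_character_def)

lemma partial_character_add:
  assumes W: "partial_character W" and h: "(h, y) \<in> W" "(h', y') \<in> W"
  shows "(h + h', y * y') \<in> W"
proof -
  have "(0 - h', 1 / y') \<in> W"
    using partial_characterD(1,2)[OF W] h by blast
  then have "(h - (0 - h'), y / (1 / y')) \<in> W"
    using partial_characterD(2)[OF W] h by blast
  then show ?thesis by simp
qed

lemma partial_character_cmul:
  assumes W: "partial_character W" and h: "(h, y) \<in> W"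
  shows "(frag_cmul k h, y powi k) \<in> W"
proof -
  have nat: "(frag_cmul (int n) h, y ^ n) \<in> W" for n
  proof (induction n)
    case 0
    then show ?case using partial_characterD(1)[OF W] by simp
  next
    case (Suc n)
    have "frag_cmul (int (Suc n)) h = h + frag_cmul (int n) h"
      by (metis frag_cmul_distrib frag_cmul_one of_nat_Suc)
    then show ?case
      using partial_character_add[OF W h Suc] by simp
  qed
  show ?thesis
  proof (cases k)
    case (nonneg n)
    then show ?thesis using nat[of n] by simp
  next
    case (neg n)
    have "(0 - frag_cmul (int (Suc n)) h, 1 / y ^ Suc n) \<in> W"
      using partial_characterD(1,2)[OF W] nat by blast
    moreover have "y powi k = 1 / y ^ Suc n"
      by (simp only: neg power_int_minus_divide power_int_of_nat)
    ultimately show ?thesis by (simp add: neg)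
  qed
qed

lemma partial_character_unique:
  assumes W: "partial_character W" and h: "(h, y) \<in> W" "(h, y') \<in> W"
  shows "y = y'"
proof -
  have "(h - h, y / y') \<in> W"
    using partial_characterD(2)[OF W] h by blast
  then have "y / y' = 1"
    using partial_characterD(3)[OF W, of "y / y'"] by (simp del: divide_eq_1_iff)
  then show ?thesis
    using partial_characterD(4)[OF W h(2)] by simp
qed

text \<open>The last hypothesis is the compatibility condition for assigning the value
  \<open>y\<close> to \<open>x\<close>: wherever a multiple of \<open>x\<close> already has a value,
  that value must be the corresponding power of \<open>y\<close>.\<close>

lemma partial_character_adjoin:
  fixes W :: "(('a \<Rightarrow>\<^sub>0 int) \<times> 'k::field) set"
  assumes W: "partial_character W" and y: "y \<noteq> 0"
    and xy: "\<And>k z. (frag_cmul k x, z) \<in> W \<Longrightarrow> z = y powi k"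
  shows "\<exists>W'. partial_character W' \<and> W \<subseteq> W' \<and> x \<in> fst ` W'"
proof -
  define W' where "W' = {(h + frag_cmul k x, z * y powi k) | h z k. (h, z) \<in> W}"
  have memb: "(h + frag_cmul k x, z * y powi k) \<in> W'" if "(h, z) \<in> W" for h z k
    using that by (auto simp: W'_def)
  have "W \<subseteq> W'"
    using memb[where k = 0] by auto
  moreover have "x \<in> fst ` W'"
    using memb[OF partial_characterD(1)[OF W], of 1] by force
  moreover have "partial_character W'"
    unfolding partial_character_def
  proof (intro conjI allI impI)
    show "(0, 1) \<in> W'"
      using \<open>W \<subseteq> W'\<close> partial_characterD(1)[OF W] by blast
  next
    fix h u h' u' assume "(h, u) \<in> W'" "(h', u') \<in> W'"
    then obtain h1 z1 k1 h2 z2 k2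
      where W12: "(h1, z1) \<in> W" "(h2, z2) \<in> W"
        and eqs: "h = h1 + frag_cmul k1 x" "u = z1 * y powi k1"
          "h' = h2 + frag_cmul k2 x" "u' = z2 * y powi k2"
      by (auto simp: W'_def)
    have "(h1 - h2 + frag_cmul (k1 - k2) x, z1 / z2 * y powi (k1 - k2)) \<in> W'"
      using memb partial_characterD(2)[OF W] W12 by blast
    moreover have "h1 - h2 + frag_cmul (k1 - k2) x = h - h'"
      by (simp add: eqs frag_cmul_diff_distrib)
    moreover have "z1 / z2 * y powi (k1 - k2) = u / u'"
      using y by (simp add: eqs power_int_diff)
    ultimately show "(h - h', u / u') \<in> W'" by simp
  next
    fix u assume "(0, u) \<in> W'"
    then obtain h z k where h: "(h, z) \<in> W" "h + frag_cmul k x = 0" "u = z * y powi k"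
      by (force simp: W'_def)
    \<comment> \<open>A new element lies over 0 only if its old part is itself a multiple of
      \<open>x\<close>, where compatibility fixes the value.\<close>
    then have "h = frag_cmul (- k) x"
      by (simp add: eq_neg_iff_add_eq_0 flip: minus_frag_cmul)
    then have "z = y powi (- k)"
      using xy h(1) by blast
    then show "u = 1"
      using h(3) y by (simp add: power_int_minus)
  next
    fix h u assume "(h, u) \<in> W'"
    then show "u \<noteq> 0"
      using y partial_characterD(4)[OF W] by (auto simp: W'_def)
  qed
  ultimately show ?thesis by blast
qed

text \<open>Modulo the domain, \<open>x\<close> has infinite or finite order. Infinite order leaves
  its value free, and 1 is taken. Order \<open>n\<close> forces the \<open>n\<close>-th power of the
  value, and a root exists because the field is algebraically closed.\<close>

lemma partial_character_extend_one:
  fixes W :: "(('a \<Rightarrow>\<^sub>0 int) \<times> 'k::alg_closed_field) set"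
  assumes W: "partial_character W"
  shows "\<exists>W'. partial_character W' \<and> W \<subseteq> W' \<and> x \<in> fst ` W'"
proof (cases "\<exists>n>0. frag_cmul (int n) x \<in> fst ` W")
  case False
  have "z = 1 powi k" if k: "(frag_cmul k x, z) \<in> W" for k z
  proof -
    \<comment> \<open>The case assumption excludes positive multiples only; negating covers negative
      \<open>k\<close>, so \<open>k\<close> is 0.\<close>
    have "frag_cmul (- k) x \<in> fst ` W"
      using partial_character_cmul[OF W k, of "-1"] by force
    with k False have "\<not> 0 < k" "\<not> 0 < - k"
      by (metis fst_conv image_eqI zero_less_imp_eq_int of_nat_0_less_iff)+
    then show ?thesis
      using k partial_characterD(3)[OF W] by auto
  qed
  then show ?thesis
    using partial_character_adjoin[OF W, of 1 x] by auto
next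
  case True
  define n where "n = (LEAST n. n > 0 \<and> frag_cmul (int n) x \<in> fst ` W)"
  have n: "n > 0" "frag_cmul (int n) x \<in> fst ` W"
    using LeastI_ex[OF True] by (auto simp: n_def)
  have least: "n \<le> m" if "m > 0" "frag_cmul (int m) x \<in> fst ` W" for m
    using that by (auto simp: n_def intro: Least_le)
  obtain z0 where z0: "(frag_cmul (int n) x, z0) \<in> W"
    using n by auto
  obtain y where y: "y ^ n = z0"
    using nth_root_exists[OF n(1)] by metis
  have "y \<noteq> 0"
    using y n(1) partial_characterD(4)[OF W z0] by (auto simp: zero_power)
  moreover have "z = y powi k" if k: "(frag_cmul k x, z) \<in> W" for k z
  proof -
    \<comment> \<open>Division with remainder: subtracting a multiple of \<open>n\<close> leaves the
      remainder times \<open>x\<close> in the domain, and minimality of \<open>n\<close> makes the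
      remainder vanish.\<close>
    have q: "(frag_cmul (k div int n * int n) x, z0 powi (k div int n)) \<in> W"
      using partial_character_cmul[OF W z0, of "k div int n"] by simp
    have "frag_cmul k x - frag_cmul (k div int n * int n) x = frag_cmul (int (nat (k mod int n))) x"
      using n(1) by (simp add: minus_div_mult_eq_mod flip: frag_cmul_diff_distrib)
    then have "frag_cmul (int (nat (k mod int n))) x \<in> fst ` W"
      using partial_characterD(2)[OF W k q] by (metis fst_conv image_eqI)
    moreover have "nat (k mod int n) < n"
      using n(1) by (simp add: nat_less_iff)
    ultimately have "nat (k mod int n) = 0"
      using least leD by blast
    then have k': "k = int n * (k div int n)"
      using n(1) by (metis add.right_neutral div_mult_mod_eq mult.commute nat_0_iff
          of_nat_0_less_iff order.antisym pos_mod_sign)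
    then have "z = z0 powi (k div int n)"
      using partial_character_unique[OF W] k q by (metis mult.commute)
    also have "\<dots> = y powi k"
      by (subst (2) k') (simp add: power_int_mult flip: y)
    finally show ?thesis .
  qed
  ultimately show ?thesis
    using partial_character_adjoin[OF W] by metis
qed

lemma partial_character_extend:
  fixes W :: "(('a \<Rightarrow>\<^sub>0 int) \<times> 'k::alg_closed_field) set"
  assumes "finite S" "partial_character W"
  shows "\<exists>W'. partial_character W' \<and> W \<subseteq> W' \<and> S \<subseteq> fst ` W'"
  using assms
proof (induction S rule: finite_induct)
  case empty
  then show ?case by blast
next
  case (insert x S)
  then obtain W1 where W1: "partial_character W1" "W \<subseteq> W1" "S \<subseteq> fst ` W1"
    by blast
  then obtain W2 where "partial_character W2" "W1 \<subseteq> W2" "x \<in> fst ` W2"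
    using partial_character_extend_one[of W1 x] by blast
  with W1 image_mono[of W1 W2 fst] show ?case
    by (intro exI[of _ W2]) blast
qed

text \<open>Divisibility of \<open>k\<^sup>\<times>\<close> is what makes it possible to lift a character along \<open>t\<close>.\<close>

lemma character_factors:
  fixes v :: "'a \<Rightarrow> 'k::alg_closed_field" and t :: "'a \<Rightarrow> ('b \<Rightarrow>\<^sub>0 int)"
  assumes v: "\<And>a. v a \<noteq> 0" and S: "finite S" and t: "\<And>a. a \<in> A \<Longrightarrow> Poly_Mapping.keys (t a) \<subseteq> S"
    and ker: "\<And>m. Poly_Mapping.keys m \<subseteq> A \<Longrightarrow> frag_extend t m = 0 \<Longrightarrow> monomial_value v m = 1"
  shows "\<exists>g. (\<forall>b. g b \<noteq> 0) \<and> (\<forall>a\<in>A. v a = monomial_value g (t a))"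
proof -
  \<comment> \<open>The character is pushed forward along \<open>t\<close>; triviality on the kernel
    is exactly single-valuedness of this relation.\<close>
  define W where "W = {(frag_extend t m, monomial_value v m) | m. Poly_Mapping.keys m \<subseteq> A}"
  have W: "partial_character W"
    unfolding partial_character_def
  proof (intro conjI allI impI)
    show "(0, 1) \<in> W"
      unfolding W_def by (rule CollectI) (intro exI[of _ 0], simp)
    show "y = 1" if "(0, y) \<in> W" for y
      using that ker by (fastforce simp: W_def)
    show "y \<noteq> 0" if "(h, y) \<in> W" for h y
      using that v by (auto simp: W_def monomial_value_nonzero)
    show "(h - h', y / y') \<in> W" if h: "(h, y) \<in> W" "(h', y') \<in> W" for h y h' y'
    proof -
      obtain m m' where m: "h = frag_extend t m" "y = monomial_value v m" "Poly_Mapping.keys m \<subseteq> A"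
        "h' = frag_extend t m'" "y' = monomial_value v m'" "Poly_Mapping.keys m' \<subseteq> A"
        using h by (auto simp: W_def)
      have "Poly_Mapping.keys (m - m') \<subseteq> A"
        using keys_diff[of m m'] m by blast
      then show ?thesis
        using m v unfolding W_def
        by (intro CollectI exI[of _ "m - m'"]) (auto simp: frag_extend_diff monomial_value_diff)
    qed
  qed
  \<comment> \<open>Finitely many adjunctions suffice, since every \<open>t a\<close> is supported
    in the finite set \<open>S\<close>.\<close>
  obtain W' where W': "partial_character W'" "W \<subseteq> W'" "frag_of ` S \<subseteq> fst ` W'"
    using partial_character_extend[OF _ W, of "frag_of ` S"] S by auto
  \<comment> \<open>The default 1 outside \<open>S\<close> keeps \<open>g\<close> nowhere
    zero.\<close>
  define g where "g b = (if b \<in> S then SOME y. (frag_of b, y) \<in> W' else 1)" for b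
  have g: "(frag_of b, g b) \<in> W'" if "b \<in> S" for b
  proof -
    have "\<exists>y. (frag_of b, y) \<in> W'"
      using W'(3) that by force
    then show ?thesis
      using that by (auto simp: g_def intro: someI_ex)
  qed
  have g0: "g b \<noteq> 0" for b
    using g[of b] partial_characterD(4)[OF W'(1)] by (cases "b \<in> S") (auto simp: g_def)
  have gW: "(m, monomial_value g m) \<in> W'" if "Poly_Mapping.keys m \<subseteq> S" for m
    using that
  proof (induction m rule: frag_induction)
    case zero
    then show ?case using partial_characterD(1)[OF W'(1)] by simp
  next
    case (one x)
    then show ?case using g by simp
  next
    case (diff a b)
    then show ?case
      using partial_characterD(2)[OF W'(1)] g0 by (simp add: monomial_value_diff)
  qed
  have "v a = monomial_value g (t a)" if a: "a \<in> A" for a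
  proof -
    have "(t a, v a) \<in> W"
      unfolding W_def by (rule CollectI) (intro exI[of _ "frag_of a"], simp add: a)
    then show ?thesis
      using partial_character_unique[OF W'(1)] gW[OF t[OF a]] W'(2) by blast
  qed
  with g0 show ?thesis by blast
qed

section \<open>Based rings and their automorphisms\<close>

text \<open>Both products equal \<open>b\<close>, whose unique coordinate vector is the indicator of
  \<open>b\<close>.\<close>

lemma Nst_1:
  assumes B: "finite_int_basis B" and b: "b \<in> B"
  shows "Nst B 1 b c = (if c = b then 1 else 0)" "Nst B b 1 c = (if c = b then 1 else 0)"
proof -
  let ?c = "\<lambda>z. if z = b then 1 else (0::int)"
  have "(\<Sum>z\<in>B. of_int (?c z) * z) = (\<Sum>z\<in>B. if z = b then z else 0)"
    by (rule sum.cong) auto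
  then have c: "is_coords B b ?c"
    using B b by (auto simp: is_coords_def finite_int_basis_def)
  then have "(THE c. is_coords B b c) = ?c"
    using B unfolding finite_int_basis_def by (intro the1_equality) blast+
  then show "Nst B 1 b c = (if c = b then 1 else 0)" "Nst B b 1 c = (if c = b then 1 else 0)"
    by (simp_all add: Nst_def)
qed

lemma finite_Gamma:
  assumes "finite B"
  shows "finite (Gamma B)"
  by (rule finite_subset[of _ "B \<times> B \<times> B"]) (use assms in \<open>auto simp: Gamma_def\<close>)

lemma mem_Phi:
  "(a, b, c, d, e, f) \<in> Phi B \<longleftrightarrow> a \<in> B \<and> b \<in> B \<and> c \<in> B \<and> d \<in> B \<and> e \<in> B \<and> f \<in> B \<and>
     Nst B a b e \<noteq> 0 \<and> Nst B e c d \<noteq> 0 \<and> Nst B b c f \<noteq> 0 \<and> Nst B a f d \<noteq> 0"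
  by (auto simp: Phi_def lpaths_def rpaths_def)

section \<open>Automorphisms acting on labels and indeterminates\<close>

context
  fixes B :: "'r::ring_1 set" and \<rho>
  assumes \<rho>: "\<rho> \<in> based_aut B"
begin

lemma based_aut_bij: "bij_betw \<rho> B B"
  using \<rho> by (simp add: based_aut_def)

lemma based_aut_inj: "x \<in> B \<Longrightarrow> y \<in> B \<Longrightarrow> \<rho> x = \<rho> y \<longleftrightarrow> x = y"
  using based_aut_bij by (auto simp: bij_betw_def inj_on_def)

lemma based_aut_mem: "x \<in> B \<Longrightarrow> \<rho> x \<in> B"
  using based_aut_bij by (auto simp: bij_betw_def)

lemma based_aut_surj: "y \<in> B \<Longrightarrow> \<exists>x\<in>B. y = \<rho> x"
  using based_aut_bij by (auto simp: bij_betw_def)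

lemma Nst_based_aut:
  "x \<in> B \<Longrightarrow> y \<in> B \<Longrightarrow> z \<in> B \<Longrightarrow> Nst B (\<rho> x) (\<rho> y) (\<rho> z) = Nst B x y z"
  using \<rho> by (simp add: based_aut_def)

text \<open>An automorphism is not assumed to fix 1. If \<open>u\<close> is the preimage of 1, then
  the structure constant at \<open>1, u, u\<close> is carried to the one at
  \<open>\<rho> 1, 1, 1\<close>, and its being 1 forces \<open>\<rho> 1 = 1\<close>.\<close>

lemma based_aut_1:
  assumes "unital_based_ring B star"
  shows "\<rho> 1 = 1"
proof -
  have B: "finite_int_basis B" "1 \<in> B"
    using assms by (auto simp: unital_based_ring_def)
  obtain u where u: "u \<in> B" "1 = \<rho> u"
    using based_aut_surj[OF B(2)] by blast
  have "Nst B (\<rho> 1) (\<rho> u) (\<rho> u) = 1"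
    using u(1) B by (simp add: Nst_based_aut Nst_1)
  then show ?thesis
    using B unfolding u(2)[symmetric] by (simp add: Nst_1 based_aut_mem split: if_splits)
qed

text \<open>The dual of \<open>a\<close> is the only basis element whose product with
  \<open>a\<close> contains 1, so it is determined by structure constants.\<close>

lemma based_aut_star:
  assumes R: "unital_based_ring B star" and a: "a \<in> B"
  shows "\<rho> (star a) = star (\<rho> a)"
proof -
  have star: "star a \<in> B" and B: "1 \<in> B"
    using R a by (auto simp: unital_based_ring_def bij_betw_def)
  have dual: "Nst B x y 1 = (if y = star x then 1 else 0)" if "x \<in> B" "y \<in> B" for x y
    using R that by (simp add: unital_based_ring_def)
  have "Nst B (\<rho> a) (\<rho> (star a)) (\<rho> 1) = 1"
    using a star B by (simp add: Nst_based_aut dual)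
  then show ?thesis
    using a star by (simp add: based_aut_1[OF R] dual based_aut_mem split: if_splits)
qed

lemma act_phi_mem: "\<phi> \<in> Phi B \<Longrightarrow> act_phi \<rho> \<phi> \<in> Phi B"
  by (cases \<phi>) (simp add: mem_Phi based_aut_mem Nst_based_aut)

lemma inj_on_act_phi: "inj_on (act_phi \<rho>) (Phi B)"
  by (auto simp: inj_on_def mem_Phi based_aut_inj)

lemma lpaths_based_aut:
  assumes "a \<in> B" "b \<in> B" "c \<in> B" "d \<in> B"
  shows "lpaths B (\<rho> a) (\<rho> b) (\<rho> c) (\<rho> d) = \<rho> ` lpaths B a b c d"
proof -
  have "e \<in> lpaths B (\<rho> a) (\<rho> b) (\<rho> c) (\<rho> d) \<longleftrightarrow> e \<in> \<rho> ` lpaths B a b c d" for e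
  proof (cases "e \<in> B")
    case True
    then obtain x where "x \<in> B" "e = \<rho> x"
      using based_aut_surj by blast
    then show ?thesis
      using assms by (auto simp: lpaths_def Nst_based_aut based_aut_mem based_aut_inj)
  qed (auto simp: lpaths_def based_aut_mem)
  then show ?thesis by blast
qed

lemma rpaths_based_aut:
  assumes "a \<in> B" "b \<in> B" "c \<in> B" "d \<in> B"
  shows "rpaths B (\<rho> a) (\<rho> b) (\<rho> c) (\<rho> d) = \<rho> ` rpaths B a b c d"
proof -
  have "e \<in> rpaths B (\<rho> a) (\<rho> b) (\<rho> c) (\<rho> d) \<longleftrightarrow> e \<in> \<rho> ` rpaths B a b c d" for e
  proof (cases "e \<in> B")
    case True
    then obtain x where "x \<in> B" "e = \<rho> x"
      using based_aut_surj by blast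
    then show ?thesis
      using assms by (auto simp: rpaths_def Nst_based_aut based_aut_mem based_aut_inj)
  qed (auto simp: rpaths_def based_aut_mem)
  then show ?thesis by blast
qed

end

lemma invertible_matrix_reindex:
  assumes M: "invertible_matrix (\<rho> ` I) (\<rho> ` J) M" and inj: "inj_on \<rho> I" "inj_on \<rho> J"
    and M': "\<And>i j. i \<in> I \<Longrightarrow> j \<in> J \<Longrightarrow> M' i j = M (\<rho> i) (\<rho> j)"
  shows "invertible_matrix I J M'"
proof -
  obtain W where W: "\<forall>i\<in>\<rho> ` I. \<forall>i'\<in>\<rho> ` I.
      (\<Sum>j\<in>\<rho> ` J. M i j * W j i') = (if i = i' then 1 else 0)"
    "\<forall>j\<in>\<rho> ` J. \<forall>j'\<in>\<rho> ` J.
      (\<Sum>i\<in>\<rho> ` I. W j i * M i j') = (if j = j' then 1 else 0)"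
    using M unfolding invertible_matrix_def by (elim exE conjE)
  have 1: "(\<Sum>j\<in>J. M' i j * W (\<rho> j) (\<rho> i')) = (if i = i' then 1 else 0)"
    if "i \<in> I" "i' \<in> I" for i i'
    using W(1) that inj by (simp add: sum.reindex inj_on_eq_iff M')
  have 2: "(\<Sum>i\<in>I. W (\<rho> j) (\<rho> i) * M' i j') = (if j = j' then 1 else 0)"
    if "j \<in> J" "j' \<in> J" for j j'
    using W(2) that inj by (simp add: sum.reindex inj_on_eq_iff M')
  show ?thesis
    unfolding invertible_matrix_def
    by (rule exI[of _ "\<lambda>j i. W (\<rho> j) (\<rho> i)"]) (simp add: 1 2)
qed

text \<open>Every condition on a point is phrased through structure constants, 1 and
  \<open>star\<close>, all of which \<open>\<rho>\<close> respects; what remains is reindexing of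
  sums and matrices. The restriction is there because points of \<open>Xvar\<close> are extensional
  functions on \<open>Phi B\<close>.\<close>

lemma pullback_in_Xvar:
  assumes R: "unital_based_ring B star" and \<rho>: "\<rho> \<in> based_aut B" and F: "F \<in> Xvar B star"
  shows "restrict (F \<circ> act_phi \<rho>) (Phi B) \<in> Xvar B star"
proof -
  note simps = based_aut_mem[OF \<rho>] Nst_based_aut[OF \<rho>]
  let ?G = "restrict (F \<circ> act_phi \<rho>) (Phi B)"
  have B: "finite_int_basis B" "1 \<in> B"
    using R by (auto simp: unital_based_ring_def)
  have star: "star a \<in> B" if "a \<in> B" for a
    using R that by (auto simp: unital_based_ring_def bij_betw_def)
  have inj: "inj_on \<rho> B"
    using based_aut_bij[OF \<rho>] by (simp add: bij_betw_def)
  have F1: "F (a, 1, b, c, a, b) = 1" if "a \<in> B" "b \<in> B" "c \<in> B" "Nst B a b c \<noteq> 0" for a b c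
    using F that by (simp add: Xvar_def)
  have F2: "F (a, star a, a, a, 1, 1) \<noteq> 0" if "a \<in> B" for a
    using F that by (simp add: Xvar_def)
  have F3: "pentagon_eqs B F"
    using F by (simp add: Xvar_def)
  have F4: "invertible_matrix (lpaths B a b c d) (rpaths B a b c d) (\<lambda>e f. F (a, b, c, d, e, f))"
    if "a \<in> B" "b \<in> B" "c \<in> B" "d \<in> B" for a b c d
    using F that by (simp add: Xvar_def)
  have dual: "Nst B x y 1 = (if y = star x then 1 else 0)" if "x \<in> B" "y \<in> B" for x y
    using R that by (simp add: unital_based_ring_def)
  have "(star (star a)) = a" if a: "a \<in> B" for a
  proof -
    obtain \<tau> where "anti_involution \<tau>" "\<And>x. x \<in> B \<Longrightarrow> \<tau> x = star x"
      using R by (auto simp: unital_based_ring_def)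
    then show ?thesis
      using a star by (metis anti_involution_def)
  qed
  \<comment> \<open>This places the indeterminate \<open>(a, star a, a, a, 1, 1)\<close> in
    \<open>Phi B\<close>, so that the restriction does not cut it off.\<close>
  then have dual': "Nst B (star a) a 1 \<noteq> 0" if "a \<in> B" for a
    using that dual star by simp
  have "?G (a, 1, b, c, a, b) = 1" if "a \<in> B" "b \<in> B" "c \<in> B" "Nst B a b c \<noteq> 0" for a b c
    using that B F1[of "\<rho> a" "\<rho> b" "\<rho> c"]
    by (simp add: mem_Phi Nst_1 simps based_aut_1[OF \<rho> R])
  moreover have "?G (a, star a, a, a, 1, 1) \<noteq> 0" if "a \<in> B" for a
    using that B F2[of "\<rho> a"] star dual'
    by (simp add: mem_Phi Nst_1 dual simps based_aut_1[OF \<rho> R] based_aut_star[OF \<rho> R])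
  moreover have "pentagon_eqs B ?G"
    unfolding pentagon_eqs_def
  proof (intro ballI impI)
    fix a b c d e f i h j
    assume mem: "a \<in> B" "b \<in> B" "c \<in> B" "d \<in> B" "e \<in> B" "f \<in> B" "i \<in> B" "h \<in> B" "j \<in> B"
      and N: "Nst B a b f \<noteq> 0 \<and> Nst B f c i \<noteq> 0 \<and> Nst B i d e \<noteq> 0 \<and>
        Nst B c d h \<noteq> 0 \<and> Nst B b h j \<noteq> 0 \<and> Nst B a j e \<noteq> 0"
    let ?S = "\<lambda>b c a i d j. {g \<in> B. Nst B b c g \<noteq> 0 \<and> Nst B a g i \<noteq> 0 \<and> Nst B g d j \<noteq> 0}"
    have S: "?S (\<rho> b) (\<rho> c) (\<rho> a) (\<rho> i) (\<rho> d) (\<rho> j) = \<rho> ` ?S b c a i d j"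
    proof -
      have "g \<in> ?S (\<rho> b) (\<rho> c) (\<rho> a) (\<rho> i) (\<rho> d) (\<rho> j) \<longleftrightarrow> g \<in> \<rho> ` ?S b c a i d j" for g
      proof (cases "g \<in> B")
        case True
        then obtain x where "x \<in> B" "g = \<rho> x"
          using based_aut_surj[OF \<rho>] by blast
        then show ?thesis
          using mem by (auto simp: simps based_aut_inj[OF \<rho>])
      qed (auto simp: simps)
      then show ?thesis by blast
    qed
    have pent: "(if Nst B (\<rho> f) (\<rho> h) (\<rho> e) = 0 then 0 else
          F (\<rho> f, \<rho> c, \<rho> d, \<rho> e, \<rho> i, \<rho> h) * F (\<rho> a, \<rho> b, \<rho> h, \<rho> e, \<rho> f, \<rho> j)) =
        (\<Sum>g\<in>?S (\<rho> b) (\<rho> c) (\<rho> a) (\<rho> i) (\<rho> d) (\<rho> j).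
            F (\<rho> a, \<rho> b, \<rho> c, \<rho> i, \<rho> f, g) * F (\<rho> a, g, \<rho> d, \<rho> e, \<rho> i, \<rho> j) *
            F (\<rho> b, \<rho> c, \<rho> d, \<rho> j, g, \<rho> h))"
      by (rule F3[unfolded pentagon_eqs_def, rule_format]) (use mem N in \<open>simp_all add: simps\<close>)
    have injS: "inj_on \<rho> (?S b c a i d j)"
      by (rule inj_on_subset[OF inj]) auto
    have "(if Nst B f h e = 0 then 0 else ?G (f, c, d, e, i, h) * ?G (a, b, h, e, f, j)) =
        (\<Sum>g\<in>?S (\<rho> b) (\<rho> c) (\<rho> a) (\<rho> i) (\<rho> d) (\<rho> j).
            F (\<rho> a, \<rho> b, \<rho> c, \<rho> i, \<rho> f, g) * F (\<rho> a, g, \<rho> d, \<rho> e, \<rho> i, \<rho> j) *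
            F (\<rho> b, \<rho> c, \<rho> d, \<rho> j, g, \<rho> h))"
      unfolding pent[symmetric] using mem N by (simp add: simps mem_Phi)
    also have "\<dots> = (\<Sum>g\<in>?S b c a i d j. ?G (a, b, c, i, f, g) * ?G (a, g, d, e, i, j) * ?G (b, c, d, j, g, h))"
      unfolding S sum.reindex[OF injS] by (rule sum.cong) (use mem N in \<open>auto simp: mem_Phi\<close>)
    finally show "(if Nst B f h e = 0 then 0 else ?G (f, c, d, e, i, h) * ?G (a, b, h, e, f, j)) =
        (\<Sum>g | g \<in> B \<and> Nst B b c g \<noteq> 0 \<and> Nst B a g i \<noteq> 0 \<and> Nst B g d j \<noteq> 0.
            ?G (a, b, c, i, f, g) * ?G (a, g, d, e, i, j) * ?G (b, c, d, j, g, h))" .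
  qed
  moreover have "invertible_matrix (lpaths B a b c d) (rpaths B a b c d) (\<lambda>e f. ?G (a, b, c, d, e, f))"
    if mem: "a \<in> B" "b \<in> B" "c \<in> B" "d \<in> B" for a b c d
  proof (rule invertible_matrix_reindex)
    show "invertible_matrix (\<rho> ` lpaths B a b c d) (\<rho> ` rpaths B a b c d)
        (\<lambda>e f. F (\<rho> a, \<rho> b, \<rho> c, \<rho> d, e, f))"
      using F4[of "\<rho> a" "\<rho> b" "\<rho> c" "\<rho> d"] mem
      by (simp add: simps lpaths_based_aut[OF \<rho>] rpaths_based_aut[OF \<rho>])
    show "inj_on \<rho> (lpaths B a b c d)" "inj_on \<rho> (rpaths B a b c d)"
      by (rule inj_on_subset[OF inj], auto simp: lpaths_def rpaths_def)+
  qed (use mem in \<open>auto simp: Phi_def\<close>)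
  ultimately show ?thesis
    by (simp add: Xvar_def)
qed

section \<open>Invariant monomials and gauge equivalence\<close>

lemma eval_monomial_eq_Some:
  "(\<And>\<phi>. \<phi> \<in> Poly_Mapping.keys m \<Longrightarrow> F \<phi> \<noteq> 0) \<Longrightarrow> eval_monomial F m = Some (monomial_value F m)"
  by (auto simp: eval_monomial_def monomial_value_def)

lemma eval_monomial_cong:
  assumes "\<And>\<phi>. \<phi> \<in> Poly_Mapping.keys m \<Longrightarrow> F \<phi> = G \<phi>"
  shows "eval_monomial F m = eval_monomial G m"
  using assms by (auto simp: eval_monomial_def intro: prod.cong)

text \<open>Injectivity keeps the images of distinct generators apart, so exponents are moved but
  never added up.\<close>

lemma
  fixes m :: "'a \<Rightarrow>\<^sub>0 int"
  assumes inj: "inj_on f S" and m: "Poly_Mapping.keys m \<subseteq> S"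
  shows lookup_frag_extend_inj:
      "a \<in> S \<Longrightarrow> Poly_Mapping.lookup (frag_extend (\<lambda>a. frag_of (f a)) m) (f a) = Poly_Mapping.lookup m a"
    and keys_frag_extend_inj:
      "Poly_Mapping.keys (frag_extend (\<lambda>a. frag_of (f a)) m) = f ` Poly_Mapping.keys m"
proof -
  let ?m = "frag_extend (\<lambda>a. frag_of (f a)) m"
  have lookup: "Poly_Mapping.lookup ?m (f a) = Poly_Mapping.lookup m a" if a: "a \<in> S" for a
  proof -
    have "Poly_Mapping.lookup ?m (f a) =
        (\<Sum>i\<in>Poly_Mapping.keys m. if f a = f i then Poly_Mapping.lookup m i else 0)"
      by (auto simp: frag_extend_def lookup_sum intro: sum.cong)
    also have "\<dots> = (\<Sum>i\<in>Poly_Mapping.keys m. if a = i then Poly_Mapping.lookup m i else 0)"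
      using m a inj by (intro sum.cong) (auto dest: inj_onD)
    also have "\<dots> = Poly_Mapping.lookup m a"
      by (simp add: not_in_keys_iff_lookup_eq_zero)
    finally show ?thesis .
  qed
  then show "a \<in> S \<Longrightarrow> Poly_Mapping.lookup ?m (f a) = Poly_Mapping.lookup m a" .
  have "Poly_Mapping.keys ?m \<subseteq> f ` Poly_Mapping.keys m"
    using keys_frag_extend[of "\<lambda>a. frag_of (f a)" m] by auto
  moreover have "f a \<in> Poly_Mapping.keys ?m" if "a \<in> Poly_Mapping.keys m" for a
    using that m lookup[of a] by (auto simp: in_keys_iff)
  ultimately show "Poly_Mapping.keys ?m = f ` Poly_Mapping.keys m" by blast
qed

lemma eval_act_monomial:
  assumes \<rho>: "\<rho> \<in> based_aut B" and m: "Poly_Mapping.keys m \<subseteq> Phi B"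
  shows "eval_monomial F (act_monomial \<rho> m) = eval_monomial (F \<circ> act_phi \<rho>) m"
proof -
  note inj = inj_on_act_phi[OF \<rho>]
  have "Poly_Mapping.lookup (act_monomial \<rho> m) (act_phi \<rho> \<phi>) = Poly_Mapping.lookup m \<phi>"
    if "\<phi> \<in> Poly_Mapping.keys m" for \<phi>
    unfolding act_monomial_def by (rule lookup_frag_extend_inj[OF inj m]) (use that m in auto)
  moreover have "Poly_Mapping.keys (act_monomial \<rho> m) = act_phi \<rho> ` Poly_Mapping.keys m"
    unfolding act_monomial_def by (rule keys_frag_extend_inj[OF inj m])
  ultimately show ?thesis
    by (auto simp: eval_monomial_def prod.reindex[OF inj_on_subset[OF inj m]])
qed

lemma inv_monomials_iff:
  "m \<in> inv_monomials B \<longleftrightarrow> Poly_Mapping.keys m \<subseteq> Phi B \<and> tA m = 0"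
  by (auto simp: inv_monomials_def kernel_def)

lemma keys_tA_gen: "\<phi> \<in> Phi B \<Longrightarrow> Poly_Mapping.keys (tA_gen \<phi>) \<subseteq> Gamma B"
  by (cases \<phi>) (auto simp: mem_Phi Gamma_def in_keys_iff lookup_add lookup_minus split: if_splits)

text \<open>The equation \<open>G = g \<cdot> F\<close>, cleared of denominators. Here
  \<open>g\<close> is a total nowhere zero function, but only its values on \<open>Gamma B\<close>
  enter the equation.\<close>

definition gauge_equivalent ::
  "'r::ring_1 set \<Rightarrow> ('r \<times> 'r \<times> 'r \<Rightarrow> 'k::field) \<Rightarrow> ('r phi \<Rightarrow> 'k) \<Rightarrow> ('r phi \<Rightarrow> 'k) \<Rightarrow> bool" where
  "gauge_equivalent B g F G \<longleftrightarrow> (\<forall>\<gamma>. g \<gamma> \<noteq> 0) \<and>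
     (\<forall>a b c d e f. (a, b, c, d, e, f) \<in> Phi B \<longrightarrow>
        g (b, c, f) * g (a, f, d) * G (a, b, c, d, e, f) =
        g (a, b, e) * g (e, c, d) * F (a, b, c, d, e, f))"

lemma gauge_equivalent_iff:
  "gauge_equivalent B g F G \<longleftrightarrow> (\<forall>\<gamma>. g \<gamma> \<noteq> 0) \<and>
     (\<forall>\<phi>\<in>Phi B. G \<phi> = monomial_value g (tA_gen \<phi>) * F \<phi>)"
proof -
  have "g (b, c, f) * g (a, f, d) * G (a, b, c, d, e, f) =
        g (a, b, e) * g (e, c, d) * F (a, b, c, d, e, f) \<longleftrightarrow>
      G (a, b, c, d, e, f) = monomial_value g (tA_gen (a, b, c, d, e, f)) * F (a, b, c, d, e, f)"
    if "\<forall>\<gamma>. g \<gamma> \<noteq> 0" for a b c d e f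
  proof -
    have g0: "g \<gamma> \<noteq> 0" for \<gamma>
      using that by blast
    show ?thesis
      by (simp add: monomial_value_diff[OF g0] monomial_value_add[OF g0] g0 field_simps)
  qed
  then show ?thesis
    unfolding gauge_equivalent_def by (metis prod_cases6)
qed

text \<open>The gauge factors of the variables in \<open>m\<close> multiply to the value of
  \<open>g\<close> at \<open>tA m\<close>, which is 1 because \<open>tA m\<close> is
  trivial.\<close>

lemma eval_gauge_equivalent:
  assumes g: "gauge_equivalent B g F G" and m: "m \<in> inv_monomials B"
  shows "eval_monomial F m = eval_monomial G m"
proof -
  have g0: "\<And>\<gamma>. g \<gamma> \<noteq> 0" and G: "\<And>\<phi>. \<phi> \<in> Phi B \<Longrightarrow> G \<phi> = monomial_value g (tA_gen \<phi>) * F \<phi>"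
    using g by (auto simp: gauge_equivalent_iff)
  have m': "Poly_Mapping.keys m \<subseteq> Phi B" "frag_extend tA_gen m = 0"
    using m by (auto simp: inv_monomials_iff tA_def)
  \<comment> \<open>Gauge factors never vanish, so the two evaluations are undefined for the same
    monomials.\<close>
  have zero: "G \<phi> = 0 \<longleftrightarrow> F \<phi> = 0" if "\<phi> \<in> Poly_Mapping.keys m" for \<phi>
    using that m' G[of \<phi>] monomial_value_nonzero[of _ g, OF g0] by auto
  have "monomial_value G m = monomial_value (\<lambda>\<phi>. monomial_value g (tA_gen \<phi>) * F \<phi>) m"
    by (rule monomial_value_cong) (use m' G in auto)
  also have "\<dots> = monomial_value g (frag_extend tA_gen m) * monomial_value F m"
    by (simp only: monomial_value_mult monomial_value_frag_extend[OF g0])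
  also have "\<dots> = monomial_value F m"
    using m' by simp
  finally show ?thesis
    using zero by (auto simp: eval_monomial_def monomial_value_def)
qed

lemma zeros_gauge_equivalent:
  assumes g: "gauge_equivalent B g F G"
  shows "zeros B F = zeros B G"
proof -
  have "monomial_value g x \<noteq> 0" for x
    using g by (intro monomial_value_nonzero) (auto simp only: gauge_equivalent_iff)
  then show ?thesis
    using g unfolding gauge_equivalent_iff zeros_def by auto
qed

lemma gauge_equivalent_exists:
  fixes F G :: "'r::ring_1 phi \<Rightarrow> 'k::alg_closed_field"
  assumes B: "finite B" and zeros: "zeros B F = zeros B G"
    and eval: "\<And>m. m \<in> inv_monomials B \<Longrightarrow> eval_monomial F m = eval_monomial G m"
  shows "\<exists>g. gauge_equivalent B g F G"
proof -
  define A where "A = Phi B - zeros B F"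
  have A: "F \<phi> \<noteq> 0" "G \<phi> \<noteq> 0" if "\<phi> \<in> A" for \<phi>
    using that zeros by (auto simp: A_def zeros_def)
  \<comment> \<open>The ratio is meaningful on the non-zero coordinates only; the default 1 makes
    \<open>v\<close> nowhere zero, as \<open>character_factors\<close> requires.\<close>
  define v where "v \<phi> = (if \<phi> \<in> A then G \<phi> / F \<phi> else 1)" for \<phi>
  have v0: "v \<phi> \<noteq> 0" for \<phi>
    using A by (simp add: v_def)
  have "\<exists>g. (\<forall>\<gamma>. g \<gamma> \<noteq> 0) \<and> (\<forall>\<phi>\<in>A. v \<phi> = monomial_value g (tA_gen \<phi>))"
  proof (rule character_factors[OF v0 finite_Gamma[OF B]])
    show "Poly_Mapping.keys (tA_gen \<phi>) \<subseteq> Gamma B" if "\<phi> \<in> A" for \<phi>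
      using that by (auto simp: A_def intro!: keys_tA_gen del: subsetI)
    fix m assume m: "Poly_Mapping.keys m \<subseteq> A" "frag_extend tA_gen m = 0"
    then have "m \<in> inv_monomials B"
      by (auto simp: inv_monomials_iff tA_def A_def)
    then have "monomial_value F m = monomial_value G m"
      using eval[of m] m A by (subst (asm) (1 2) eval_monomial_eq_Some) auto
    moreover have "monomial_value G m = monomial_value (\<lambda>\<phi>. v \<phi> * F \<phi>) m"
      by (rule monomial_value_cong) (use m A in \<open>auto simp: v_def\<close>)
    moreover have "monomial_value F m \<noteq> 0"
      using m A by (intro monomial_value_nonzero) auto
    ultimately show "monomial_value v m = 1"
      by (simp add: monomial_value_mult)
  qed
  then obtain g where g: "\<And>\<gamma>. g \<gamma> \<noteq> 0" "\<And>\<phi>. \<phi> \<in> A \<Longrightarrow> v \<phi> = monomial_value g (tA_gen \<phi>)"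
    by blast
  have "G \<phi> = monomial_value g (tA_gen \<phi>) * F \<phi>" if "\<phi> \<in> Phi B" for \<phi>
  proof (cases "\<phi> \<in> A")
    case True
    then show ?thesis
      using A by (simp add: v_def flip: g(2))
  next
    case False
    \<comment> \<open>Outside \<open>A\<close> both values vanish, so the gauge equation holds for
      any \<open>g\<close>.\<close>
    then have "\<phi> \<in> zeros B F" "\<phi> \<in> zeros B G"
      using that zeros by (auto simp: A_def)
    then show ?thesis by (simp add: zeros_def)
  qed
  with g(1) show ?thesis
    unfolding gauge_equivalent_iff by blast
qed

text \<open>The zeros of the pulled-back point are carried by \<open>act_phi \<rho>\<close> onto
  those of \<open>F'\<close>, and \<open>act_phi \<rho>\<close> is injective on
  \<open>Phi B\<close>, so subsets are equal as soon as their images are.\<close>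

lemma zeros_pullback:
  assumes \<rho>: "\<rho> \<in> based_aut B"
  shows "zeros B (restrict (F' \<circ> act_phi \<rho>) (Phi B)) = zeros B F \<longleftrightarrow> act_phi \<rho> ` zeros B F = zeros B F'"
proof -
  have surj: "\<exists>\<psi>\<in>Phi B. \<phi> = act_phi \<rho> \<psi>" if "\<phi> \<in> Phi B" for \<phi>
  proof -
    obtain a b c d e f where \<phi>: "\<phi> = (a, b, c, d, e, f)"
      by (cases \<phi>)
    have mem: "a \<in> B" "b \<in> B" "c \<in> B" "d \<in> B" "e \<in> B" "f \<in> B"
      using that by (auto simp: \<phi> mem_Phi)
    obtain a' b' c' d' e' f' where *: "a = \<rho> a'" "b = \<rho> b'" "c = \<rho> c'" "d = \<rho> d'" "e = \<rho> e'" "f = \<rho> f'"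
      "a' \<in> B" "b' \<in> B" "c' \<in> B" "d' \<in> B" "e' \<in> B" "f' \<in> B"
      using mem[THEN based_aut_surj[OF \<rho>]] by blast
    have "(a', b', c', d', e', f') \<in> Phi B"
      using that * by (simp add: \<phi> mem_Phi Nst_based_aut[OF \<rho>])
    then show ?thesis
      using * by (intro bexI[of _ "(a', b', c', d', e', f')"]) (simp add: \<phi>)
  qed
  let ?Z = "zeros B (restrict (F' \<circ> act_phi \<rho>) (Phi B))"
  have Z: "act_phi \<rho> ` ?Z = zeros B F'"
  proof
    show "zeros B F' \<subseteq> act_phi \<rho> ` ?Z"
    proof
      fix \<phi> assume "\<phi> \<in> zeros B F'"
      then show "\<phi> \<in> act_phi \<rho> ` ?Z"
        using surj[of \<phi>] by (auto simp: zeros_def)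
    qed
  qed (use act_phi_mem[OF \<rho>] in \<open>auto simp: zeros_def simp del: act_phi.simps\<close>)
  have "?Z \<subseteq> Phi B" "zeros B F \<subseteq> Phi B"
    by (auto simp: zeros_def)
  then show ?thesis
    unfolding Z[symmetric] using inj_on_image_eq_iff[OF inj_on_act_phi[OF \<rho>], of "zeros B F" ?Z]
    by auto
qed

section \<open>Matrices graded by simple types\<close>

notation mat_comp (infixr "\<odot>" 70)

definition mhom :: "'b tree set \<Rightarrow> 'b tree set \<Rightarrow> ('b, 'k::field) tmat set" where
  "mhom P Q = {u. \<forall>q p. u q p \<noteq> 0 \<longrightarrow> q \<in> Q \<and> p \<in> P \<and> col q = col p}"

definition diag :: "'b tree set \<Rightarrow> ('b tree \<Rightarrow> 'k) \<Rightarrow> ('b, 'k::field) tmat" where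
  "diag S w = (\<lambda>q p. if q = p \<and> p \<in> S then w p else 0)"

abbreviation mid :: "'b tree set \<Rightarrow> ('b, 'k::field) tmat" where
  "mid S \<equiv> diag S (\<lambda>_. 1)"

definition munit :: "'b tree \<Rightarrow> 'b tree \<Rightarrow> ('b, 'k::field) tmat" where
  "munit q p = (\<lambda>q' p'. if q' = q \<and> p' = p then 1 else 0)"

definition scl :: "'k \<Rightarrow> ('b, 'k::field) tmat \<Rightarrow> ('b, 'k) tmat" where
  "scl s u = (\<lambda>q p. s * u q p)"

definition masc ::
  "'r::ring_1 set \<Rightarrow> ('r phi \<Rightarrow> 'k::field) \<Rightarrow> 'r tree set \<Rightarrow> 'r tree set \<Rightarrow> 'r tree set \<Rightarrow> ('r, 'k) tmat" where
  "masc B F P Q R = (\<lambda>q p. if q \<in> ten_obj B (ten_obj B P Q) R \<and> p \<in> ten_obj B P (ten_obj B Q R)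
     then assoc_entry F q p else 0)"

lemma fus_cat_sel [simp]:
  "Obj (fus_cat B F) = {P. finite P \<and> col ` P \<subseteq> B}"
  "Hom (fus_cat B F) = mhom"
  "Idm (fus_cat B F) = mid"
  "Cmp (fus_cat B F) = mat_comp"
  "Add (fus_cat B F) = (\<lambda>u v q p. u q p + v q p)"
  "Scl (fus_cat B F) = scl"
  "Unit (fus_cat B F) = simple_obj 1"
  "TenO (fus_cat B F) = ten_obj B"
  "TenM (fus_cat B F) = ten_mor B"
  "Asc (fus_cat B F) = masc B F"
  "LUn (fus_cat B F) = (\<lambda>P q p. if q \<in> P \<and> p = Node (Leaf 0 1) q (col q) then 1 else 0)"
  "RUn (fus_cat B F) = (\<lambda>P q p. if q \<in> P \<and> p = Node q (Leaf 0 1) (col q) then 1 else 0)"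
  by (auto simp: fus_cat_def mhom_def diag_def scl_def masc_def fun_eq_iff)

text \<open>The conditions under which composition is associative and compatible with the tensor
  product, free of any reference to source and target objects.\<close>

definition graded :: "('b, 'k::field) tmat \<Rightarrow> bool" where
  "graded u \<longleftrightarrow> (\<forall>p. finite {q. u q p \<noteq> 0}) \<and> (\<forall>q p. u q p \<noteq> 0 \<longrightarrow> col q = col p)"

lemma graded_finite: "graded u \<Longrightarrow> finite {q. u q p \<noteq> 0}"
  by (simp add: graded_def)

lemma graded_mhom: "u \<in> mhom P Q \<Longrightarrow> finite Q \<Longrightarrow> graded u"
  unfolding graded_def mhom_def by (auto elim: finite_subset[rotated])

text \<open>\<open>mat_comp\<close> sums over the support of a column of \<open>u\<close>.
  Gradedness makes that support finite, so it can be exchanged for any finite set containing the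
  contributing indices.\<close>

lemma mat_comp_eq_sum:
  assumes "graded u" "finite Y" "\<And>y. v z y \<noteq> 0 \<Longrightarrow> u y x \<noteq> 0 \<Longrightarrow> y \<in> Y"
  shows "(v \<odot> u) z x = (\<Sum>y\<in>Y. v z y * u y x)"
  unfolding mat_comp_def
  by (rule sum.mono_neutral_cong) (use assms graded_finite in auto)

lemma mat_comp_single:
  assumes "graded u" "\<And>y. v z y \<noteq> 0 \<Longrightarrow> u y x \<noteq> 0 \<Longrightarrow> y = m"
  shows "(v \<odot> u) z x = v z m * u m x"
  using mat_comp_eq_sum[of u "{m}" v z x] assms by auto

lemma mat_comp_nonzero:
  assumes "(v \<odot> u) z x \<noteq> 0"
  shows "\<exists>y. v z y \<noteq> 0 \<and> u y x \<noteq> 0"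
proof (rule ccontr)
  assume "\<not> ?thesis"
  then have "(v \<odot> u) z x = 0"
    unfolding mat_comp_def by (intro sum.neutral) auto
  with assms show False ..
qed

lemma mat_comp_in_mhom: "v \<in> mhom Q R \<Longrightarrow> u \<in> mhom P Q \<Longrightarrow> v \<odot> u \<in> mhom P R"
  by (auto simp: mhom_def dest!: mat_comp_nonzero)

lemma graded_mat_comp [simp]:
  assumes "graded v" "graded u"
  shows "graded (v \<odot> u)"
proof -
  have "{z. (v \<odot> u) z x \<noteq> 0} \<subseteq> (\<Union>y\<in>{y. u y x \<noteq> 0}. {z. v z y \<noteq> 0})" for x
    by (auto dest!: mat_comp_nonzero)
  then have "finite {z. (v \<odot> u) z x \<noteq> 0}" for x
    by (rule finite_subset) (use assms graded_finite in auto)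
  then show ?thesis
    using assms by (auto simp: graded_def dest!: mat_comp_nonzero)
qed

text \<open>Finite columns turn both bracketings into the same finite double sum, taken in two
  orders.\<close>

lemma mat_comp_assoc:
  assumes u: "graded u" and v: "graded v"
  shows "(w \<odot> v) \<odot> u = w \<odot> v \<odot> u"
proof (intro ext)
  fix z x
  let ?Y = "{y. u y x \<noteq> 0}"
  \<comment> \<open>All indices reachable from \<open>x\<close> by \<open>u\<close> and then
    \<open>v\<close>: a finite set independent of the intermediate index \<open>y\<close>.\<close>
  let ?Z = "\<Union>y\<in>?Y. {z. v z y \<noteq> 0}"
  have fin: "finite ?Y" "finite ?Z"
    using u v graded_finite by auto
  have "((w \<odot> v) \<odot> u) z x = (\<Sum>y\<in>?Y. (w \<odot> v) z y * u y x)"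
    by (rule mat_comp_eq_sum) (use u fin in auto)
  also have "\<dots> = (\<Sum>y\<in>?Y. (\<Sum>z'\<in>?Z. w z z' * v z' y) * u y x)"
    by (intro sum.cong refl arg_cong2[of _ _ _ _ "(*)"] mat_comp_eq_sum) (use v fin in auto)
  also have "\<dots> = (\<Sum>z'\<in>?Z. w z z' * (\<Sum>y\<in>?Y. v z' y * u y x))"
    unfolding sum_distrib_left sum_distrib_right by (subst sum.swap) (simp add: mult.assoc)
  also have "\<dots> = (\<Sum>z'\<in>?Z. w z z' * (v \<odot> u) z' x)"
    by (intro sum.cong refl arg_cong2[of _ _ _ _ "(*)"] mat_comp_eq_sum[symmetric]) (use u fin in auto)
  also have "\<dots> = (w \<odot> v \<odot> u) z x"
    by (rule mat_comp_eq_sum[symmetric]) (use u v fin in \<open>auto dest!: mat_comp_nonzero\<close>)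
  finally show "((w \<odot> v) \<odot> u) z x = (w \<odot> v \<odot> u) z x" .
qed

lemma graded_diag [simp]: "graded (diag S w)"
  by (auto simp: graded_def diag_def)

lemma diag_in_mhom: "diag S w \<in> mhom S S"
  by (auto simp: mhom_def diag_def)

lemma diag_comp: "graded u \<Longrightarrow> diag S w \<odot> u = (\<lambda>q p. if q \<in> S then w q * u q p else 0)"
proof (intro ext)
  fix q p
  assume "graded u"
  then have "(diag S w \<odot> u) q p = diag S w q q * u q p"
    by (rule mat_comp_single) (auto simp: diag_def split: if_splits)
  then show "(diag S w \<odot> u) q p = (if q \<in> S then w q * u q p else 0)"
    by (simp add: diag_def)
qed

lemma comp_diag: "u \<odot> diag S w = (\<lambda>q p. if p \<in> S then u q p * w p else 0)"
proof (intro ext)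
  fix q p
  have "(u \<odot> diag S w) q p = u q p * diag S w p p"
    by (rule mat_comp_single[OF graded_diag]) (auto simp: diag_def split: if_splits)
  then show "(u \<odot> diag S w) q p = (if p \<in> S then u q p * w p else 0)"
    by (simp add: diag_def)
qed

text \<open>Finiteness of the target guarantees finite columns of \<open>u\<close>, over which the
  composite is summed. For composition with an identity on the right, the diagonal matrix itself has
  finite columns.\<close>

lemma mid_comp: "u \<in> mhom P Q \<Longrightarrow> finite Q \<Longrightarrow> mid Q \<odot> u = u"
  using graded_mhom[of u P Q] by (fastforce simp: diag_comp mhom_def fun_eq_iff)

lemma comp_mid: "u \<in> mhom P Q \<Longrightarrow> u \<odot> mid P = u"
  by (fastforce simp: comp_diag mhom_def fun_eq_iff)

lemma graded_munit: "col q = col p \<Longrightarrow> graded (munit q p)"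
  by (auto simp: graded_def munit_def)

lemma munit_in_mhom: "q \<in> Q \<Longrightarrow> p \<in> P \<Longrightarrow> col q = col p \<Longrightarrow> munit q p \<in> mhom P Q"
  by (auto simp: mhom_def munit_def)

lemma comp_munit: "col p = col r \<Longrightarrow> v \<odot> munit p r = (\<lambda>q p'. if p' = r then v q p else 0)"
proof (intro ext)
  fix q p'
  assume "col p = col r"
  then have "(v \<odot> munit p r) q p' = v q p * munit p r p p'"
    by (intro mat_comp_single graded_munit) (auto simp: munit_def split: if_splits)
  then show "(v \<odot> munit p r) q p' = (if p' = r then v q p else 0)"
    by (simp add: munit_def)
qed

lemma munit_comp: "graded u \<Longrightarrow> munit q p \<odot> u = (\<lambda>q' r. if q' = q then u p r else 0)"
proof (intro ext)
  fix q' r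
  assume "graded u"
  then have "(munit q p \<odot> u) q' r = munit q p q' p * u p r"
    by (rule mat_comp_single) (auto simp: munit_def split: if_splits)
  then show "(munit q p \<odot> u) q' r = (if q' = q then u p r else 0)"
    by (simp add: munit_def)
qed

lemma scl_comp: "scl s v \<odot> u = scl s (v \<odot> u)"
  by (simp add: scl_def mat_comp_def sum_distrib_left mult.assoc fun_eq_iff)

lemma comp_scl:
  assumes "graded u"
  shows "v \<odot> scl s u = scl s (v \<odot> u)"
\<comment> \<open>For \<open>s = 0\<close> the support over which \<open>mat_comp\<close> sums
  collapses, so this case is treated apart.\<close>
proof (cases "s = 0")
  case False
  then show ?thesis
    by (simp add: scl_def mat_comp_def sum_distrib_left mult.left_commute fun_eq_iff)
qed (simp add: scl_def mat_comp_def fun_eq_iff)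

lemma graded_scl [simp]: "graded u \<Longrightarrow> graded (scl s u)"
  by (cases "s = 0") (auto simp: graded_def scl_def)

lemma scl_in_mhom: "u \<in> mhom P Q \<Longrightarrow> scl s u \<in> mhom P Q"
  by (auto simp: mhom_def scl_def)

lemma scl_scl: "scl s (scl t u) = scl (s * t) u"
  by (simp add: scl_def mult.assoc)

section \<open>Tensor products of graded matrices\<close>

lemma ten_mor_eq:
  "ten_mor B u v q p = (case (q, p) of (Node x' y' c', Node x y c) \<Rightarrow>
     if c' = c \<and> c \<in> B \<and> Nst B (col x) (col y) c \<noteq> 0 then u x' x * v y' y else 0 | _ \<Rightarrow> 0)"
  by (cases q; cases p) auto

lemma ten_mor_nonzero:
  "ten_mor B u v q p \<noteq> 0 \<Longrightarrow> \<exists>x' y' x y c. q = Node x' y' c \<and> p = Node x y c \<and> c \<in> B \<and>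
     Nst B (col x) (col y) c \<noteq> 0 \<and> u x' x \<noteq> 0 \<and> v y' y \<noteq> 0"
  by (auto simp: ten_mor_eq split: tree.splits if_splits)

lemma ten_obj_Leaf [simp]: "Leaf n b \<notin> ten_obj B P Q"
  by (auto simp: ten_obj_def)

lemma ten_obj_Node [simp]:
  "Node x y c \<in> ten_obj B P Q \<longleftrightarrow> x \<in> P \<and> y \<in> Q \<and> c \<in> B \<and> Nst B (col x) (col y) c \<noteq> 0"
  by (auto simp: ten_obj_def)

lemma finite_ten_obj [simp]:
  assumes "finite P" "finite Q" "finite B"
  shows "finite (ten_obj B P Q)"
  by (rule finite_subset[of _ "(\<lambda>(x, y, c). Node x y c) ` (P \<times> Q \<times> B)"])
    (use assms in \<open>force simp: ten_obj_def\<close>)+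

lemma col_ten_obj: "col ` ten_obj B P Q \<subseteq> B"
  by (auto simp: ten_obj_def)

lemma ten_mor_in_mhom:
  "u \<in> mhom P P' \<Longrightarrow> v \<in> mhom Q Q' \<Longrightarrow> ten_mor B u v \<in> mhom (ten_obj B P Q) (ten_obj B P' Q')"
  unfolding mhom_def by (force dest!: ten_mor_nonzero)

lemma graded_ten_mor [simp]:
  assumes u: "graded u" and v: "graded v"
  shows "graded (ten_mor B u v)"
proof -
  have "finite {q. ten_mor B u v q p \<noteq> 0}" for p
  proof (cases p)
    case (Node x y c)
    have "{q. ten_mor B u v q p \<noteq> 0} \<subseteq>
        (\<lambda>(x', y'). Node x' y' c) ` ({x'. u x' x \<noteq> 0} \<times> {y'. v y' y \<noteq> 0})"
      using Node by (auto dest!: ten_mor_nonzero)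
    then show ?thesis
      by (rule finite_subset) (use u v graded_finite in auto)
  next
    case (Leaf n b)
    then have "{q. ten_mor B u v q p \<noteq> 0} = {}"
      by (auto dest: ten_mor_nonzero)
    then show ?thesis by simp
  qed
  then show ?thesis
    by (auto simp: graded_def dest!: ten_mor_nonzero)
qed

text \<open>Intermediate trees are pairs of intermediate indices with the fixed label
  \<open>c\<close>, so the sum factors into a product of two sums.\<close>

lemma ten_mor_comp:
  assumes u: "graded u" and v: "graded v"
  shows "ten_mor B u' v' \<odot> ten_mor B u v = ten_mor B (u' \<odot> u) (v' \<odot> v)"
proof (intro ext)
  fix q p
  let ?L = "ten_mor B u' v' \<odot> ten_mor B u v"
  show "?L q p = ten_mor B (u' \<odot> u) (v' \<odot> v) q p"
  proof (cases "\<exists>x' y' x y c. q = Node x' y' c \<and> p = Node x y c \<and> c \<in> B \<and> Nst B (col x) (col y) c \<noteq> 0")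
    case True
    then obtain x' y' x y c where q: "q = Node x' y' c" and p: "p = Node x y c"
      and c: "c \<in> B" "Nst B (col x) (col y) c \<noteq> 0"
      by blast
    let ?X = "{a. u a x \<noteq> 0}" and ?Y = "{b. v b y \<noteq> 0}"
    let ?N = "\<lambda>(a, b). Node a b c"
    have fin: "finite ?X" "finite ?Y"
      using u v graded_finite by auto
    \<comment> \<open>Equal colours carry the multiplicity condition from \<open>x, y\<close> over
      to every intermediate pair.\<close>
    have cols: "col a = col x" "col b = col y" if "u a x \<noteq> 0" "v b y \<noteq> 0" for a b
      using u v that by (auto simp: graded_def)
    have "?L q p = (\<Sum>t\<in>?N ` (?X \<times> ?Y). ten_mor B u' v' q t * ten_mor B u v t p)"
      by (rule mat_comp_eq_sum) (use u v fin in \<open>auto simp: p dest!: ten_mor_nonzero\<close>)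
    also have "\<dots> = (\<Sum>t\<in>?X \<times> ?Y. ten_mor B u' v' q (?N t) * ten_mor B u v (?N t) p)"
      by (subst sum.reindex) (auto simp: inj_on_def)
    also have "\<dots> = (\<Sum>(a, b)\<in>?X \<times> ?Y. (u' x' a * u a x) * (v' y' b * v b y))"
      by (rule sum.cong) (use c cols in \<open>auto simp: q p\<close>)
    also have "\<dots> = (u' \<odot> u) x' x * (v' \<odot> v) y' y"
      by (simp add: mat_comp_def sum_product sum.cartesian_product)
    finally show ?thesis
      using c by (simp add: q p)
  next
    case False
    have "?L q p = 0"
    proof (rule ccontr)
      assume "?L q p \<noteq> 0"
      then show False
        using u v False by (auto simp: graded_def dest!: mat_comp_nonzero ten_mor_nonzero)
    qed
    moreover have "ten_mor B (u' \<odot> u) (v' \<odot> v) q p = 0"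
      using False ten_mor_nonzero by metis
    ultimately show ?thesis by simp
  qed
qed

lemma ten_mor_diag:
  "ten_mor B (diag P w) (diag Q w') =
     diag (ten_obj B P Q) (\<lambda>t. case t of Node x y c \<Rightarrow> w x * w' y | Leaf _ _ \<Rightarrow> 0)"
  by (intro ext) (auto simp: ten_mor_eq diag_def split: tree.splits)

lemma ten_mor_mid: "ten_mor B (mid P) (mid Q) = mid (ten_obj B P Q)"
  unfolding ten_mor_diag by (intro ext) (auto simp: diag_def ten_obj_def)

lemma ten_mor_scl: "ten_mor B (scl s u) v = scl s (ten_mor B u v)" "ten_mor B u (scl s v) = scl s (ten_mor B u v)"
  by (intro ext; auto simp: ten_mor_eq scl_def split: tree.splits)+

section \<open>Naturality of the associator\<close>

lemma masc_Node:
  "masc B F P Q R (Node (Node x y e) z d) (Node x' (Node y' z' f) d') =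
    (if x \<in> P \<and> y \<in> Q \<and> z \<in> R \<and> d \<in> B \<and> e \<in> B \<and> f \<in> B \<and> x = x' \<and> y = y' \<and> z = z' \<and> d = d' \<and>
       Nst B (col x) (col y) e \<noteq> 0 \<and> Nst B e (col z) d \<noteq> 0 \<and>
       Nst B (col y) (col z) f \<noteq> 0 \<and> Nst B (col x) f d \<noteq> 0
     then F (col x, col y, col z, d, e, f) else 0)"
  by (auto simp: masc_def)

lemma masc_nonzero:
  assumes "masc B F P Q R q p \<noteq> 0"
  obtains x y z d e f where "q = Node (Node x y e) z d" "p = Node x (Node y z f) d"
    "q \<in> ten_obj B (ten_obj B P Q) R" "p \<in> ten_obj B P (ten_obj B Q R)"
proof -
  have "q \<in> ten_obj B (ten_obj B P Q) R" "p \<in> ten_obj B P (ten_obj B Q R)" "assoc_entry F q p \<noteq> 0"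
    using assms by (auto simp: masc_def split: if_splits)
  then show ?thesis
    using that by (cases "(F, q, p)" rule: assoc_entry.cases) (auto split: if_splits)
qed

lemma masc_in_mhom: "masc B F P Q R \<in> mhom (ten_obj B P (ten_obj B Q R)) (ten_obj B (ten_obj B P Q) R)"
  by (auto simp: mhom_def elim: masc_nonzero)

text \<open>The associator keeps subtrees and the tensor morphisms keep the inner labels, so each
  composite passes through a single intermediate tree. The entries agree because \<open>F\<close>
  sees only colours, which \<open>u\<close>, \<open>v\<close> and \<open>w\<close> preserve.\<close>

lemma masc_natural:
  assumes u: "u \<in> mhom P P'" "finite P'" and v: "v \<in> mhom Q Q'" "finite Q'" and w: "w \<in> mhom R R'" "finite R'"
    and fin: "finite P" "finite Q" "finite R" "finite B"
  shows "masc B F P' Q' R' \<odot> ten_mor B u (ten_mor B v w) = ten_mor B (ten_mor B u v) w \<odot> masc B F P Q R"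
proof (intro ext)
  fix q p
  let ?L = "masc B F P' Q' R' \<odot> ten_mor B u (ten_mor B v w)"
  let ?R = "ten_mor B (ten_mor B u v) w \<odot> masc B F P Q R"
  have grL: "graded (ten_mor B u (ten_mor B v w))"
    using u v w by (auto intro!: graded_ten_mor intro: graded_mhom)
  have grR: "graded (masc B F P Q R)"
    by (rule graded_mhom[OF masc_in_mhom]) (use fin in simp)
  have U: "a' \<in> P' \<and> a \<in> P \<and> col a' = col a" if "u a' a \<noteq> 0" for a a'
    using u that by (auto simp: mhom_def)
  have V: "a' \<in> Q' \<and> a \<in> Q \<and> col a' = col a" if "v a' a \<noteq> 0" for a a'
    using v that by (auto simp: mhom_def)
  have W: "a' \<in> R' \<and> a \<in> R \<and> col a' = col a" if "w a' a \<noteq> 0" for a a'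
    using w that by (auto simp: mhom_def)
  show "?L q p = ?R q p"
  proof (cases "\<exists>x' y' z' x y z d e f. q = Node (Node x' y' e) z' d \<and> p = Node x (Node y z f) d")
    case True
    then obtain x' y' z' x y z d e f where q: "q = Node (Node x' y' e) z' d" and p: "p = Node x (Node y z f) d"
      by blast
    have "?L q p = masc B F P' Q' R' q (Node x' (Node y' z' f) d) *
        ten_mor B u (ten_mor B v w) (Node x' (Node y' z' f) d) p"
      by (rule mat_comp_single[OF grL]) (auto simp: q p elim!: masc_nonzero dest!: ten_mor_nonzero)
    moreover have "?R q p = ten_mor B (ten_mor B u v) w q (Node (Node x y e) z d) *
        masc B F P Q R (Node (Node x y e) z d) p"
      by (rule mat_comp_single[OF grR]) (auto simp: q p elim!: masc_nonzero dest!: ten_mor_nonzero)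
    moreover have "masc B F P' Q' R' q (Node x' (Node y' z' f) d) *
        ten_mor B u (ten_mor B v w) (Node x' (Node y' z' f) d) p =
      ten_mor B (ten_mor B u v) w q (Node (Node x y e) z d) *
        masc B F P Q R (Node (Node x y e) z d) p"
      using U[of x' x] V[of y' y] W[of z' z]
      by (cases "u x' x = 0"; cases "v y' y = 0"; cases "w z' z = 0") (auto simp: q p masc_Node)
    ultimately show ?thesis by simp
  next
    case False
    have "?L q p = 0"
    proof (rule ccontr)
      assume "?L q p \<noteq> 0"
      then show False
        using False by (auto dest!: mat_comp_nonzero ten_mor_nonzero elim!: masc_nonzero)
    qed
    moreover have "?R q p = 0"
    proof (rule ccontr)
      assume "?R q p \<noteq> 0"
      then show False
        using False by (auto dest!: mat_comp_nonzero ten_mor_nonzero elim!: masc_nonzero)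
    qed
    ultimately show ?thesis by simp
  qed
qed

section \<open>From a gauge transformation to a monoidal equivalence\<close>

lemma diag_comp_diag: "diag S w \<odot> diag S w' = diag S (\<lambda>t. w t * w' t)"
  by (simp add: diag_comp) (auto simp: diag_def fun_eq_iff)

lemma is_iso_mid: "is_iso (fus_cat B F) P P (mid P)"
  unfolding is_iso_def fus_cat_sel
  by (intro conjI bexI[of _ "mid P"]) (simp_all add: diag_comp_diag diag_in_mhom)

lemma is_iso_diag:
  assumes "\<And>t. t \<in> S \<Longrightarrow> w t \<noteq> 0"
  shows "is_iso (fus_cat B F) S S (diag S w)"
proof -
  have "diag S (\<lambda>t. w t * inverse (w t)) = mid S" "diag S (\<lambda>t. inverse (w t) * w t) = mid S"
    using assms by (auto simp: diag_def fun_eq_iff)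
  then show ?thesis
    unfolding is_iso_def fus_cat_sel
    by (intro conjI bexI[of _ "diag S (\<lambda>t. inverse (w t))"]) (simp_all add: diag_comp_diag diag_in_mhom)
qed

section \<open>Relabelling functors\<close>

lemma col_map_tree [simp]: "col (map_tree \<pi> t) = \<pi> (col t)"
  by (cases t) auto

text \<open>Precomposition is contravariant: when objects are moved by a permutation, matrices are
  relabelled by its inverse.\<close>

definition relabel :: "('b \<Rightarrow> 'b) \<Rightarrow> ('b, 'k::field) tmat \<Rightarrow> ('b, 'k) tmat" where
  "relabel \<pi> u = (\<lambda>q p. u (map_tree \<pi> q) (map_tree \<pi> p))"

text \<open>A permutation of the whole type, so that \<open>map_tree\<close> is invertible on all
  trees; structure constants have to be respected on \<open>B\<close> only.\<close>

locale label_permutation =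
  fixes B :: "'r::ring_1 set" and \<pi> \<pi>' :: "'r \<Rightarrow> 'r"
  assumes inverse: "\<pi> (\<pi>' x) = x" "\<pi>' (\<pi> x) = x"
    and mem_iff: "\<pi>' x \<in> B \<longleftrightarrow> x \<in> B"
    and Nst_inv: "x \<in> B \<Longrightarrow> y \<in> B \<Longrightarrow> z \<in> B \<Longrightarrow> Nst B (\<pi>' x) (\<pi>' y) (\<pi>' z) = Nst B x y z"
begin

lemma mem_iff': "\<pi> x \<in> B \<longleftrightarrow> x \<in> B"
  using mem_iff[of "\<pi> x"] by (simp add: inverse)

lemma swap: "label_permutation B \<pi>' \<pi>"
proof
  show "Nst B (\<pi> x) (\<pi> y) (\<pi> z) = Nst B x y z" if "x \<in> B" "y \<in> B" "z \<in> B" for x y z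
    using Nst_inv[of "\<pi> x" "\<pi> y" "\<pi> z"] that by (simp add: inverse mem_iff')
qed (simp_all add: inverse mem_iff')

lemma inverse_eq: "\<pi>' x = \<pi>' y \<longleftrightarrow> x = y"
  by (metis inverse(1))

lemma map_tree_inverse [simp]:
  "map_tree \<pi> (map_tree \<pi>' t) = t" "map_tree \<pi>' (map_tree \<pi> t) = t"
  by (simp_all add: tree.map_comp comp_def inverse tree.map_ident)

lemma map_tree_eq [simp]: "map_tree \<pi>' p = map_tree \<pi>' q \<longleftrightarrow> p = q"
  by (metis map_tree_inverse(1))

lemma mem_image [simp]: "p \<in> map_tree \<pi> ` P \<longleftrightarrow> map_tree \<pi>' p \<in> P"
  by (metis image_iff map_tree_inverse)

lemma relabel_comp: "relabel \<pi>' (v \<odot> u) = relabel \<pi>' v \<odot> relabel \<pi>' u"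
proof (intro ext)
  fix z x
  show "relabel \<pi>' (v \<odot> u) z x = (relabel \<pi>' v \<odot> relabel \<pi>' u) z x"
    unfolding relabel_def mat_comp_def
    by (rule sum.reindex_bij_witness[of _ "map_tree \<pi>'" "map_tree \<pi>"]) auto
qed

lemma relabel_mid: "relabel \<pi>' (mid P) = mid (map_tree \<pi> ` P)"
  by (auto simp: relabel_def diag_def fun_eq_iff)

lemma relabel_in_mhom: "u \<in> mhom P Q \<Longrightarrow> relabel \<pi>' u \<in> mhom (map_tree \<pi> ` P) (map_tree \<pi> ` Q)"
  unfolding mhom_def relabel_def by simp (metis col_map_tree inverse(1))

lemma linear_functor_relabel:
  "linear_functor (fus_cat B F) (fus_cat B F') (image (map_tree \<pi>)) (\<lambda>_ _. relabel \<pi>')"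
proof -
  have "col ` map_tree \<pi> ` P \<subseteq> B" if "col ` P \<subseteq> B" for P
    using that by (auto simp del: mem_image simp: mem_iff')
  then show ?thesis
    unfolding linear_functor_def fus_cat_sel
    by (auto simp: relabel_comp relabel_mid relabel_in_mhom simp del: mem_image)
      (simp_all add: relabel_def scl_def)
qed

text \<open>The inverse relabelling is a strict inverse, so identities serve as both natural
  isomorphisms. Objects, morphisms and composition of \<open>fus_cat\<close> do not involve
  \<open>F\<close>, hence no relation between \<open>F\<close> and \<open>F'\<close> enters
  here.\<close>

lemma equivalence_functor_relabel:
  fixes F F' :: "'r phi \<Rightarrow> 'k::field"
  shows "equivalence_functor (fus_cat B F) (fus_cat B F') (image (map_tree \<pi>)) (\<lambda>_ _. relabel \<pi>')"
proof -
  interpret i: label_permutation B \<pi>' \<pi>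
    by (rule swap)
  have ST: "map_tree \<pi>' ` map_tree \<pi> ` P = P" and TS: "map_tree \<pi> ` map_tree \<pi>' ` P = P" for P
    by (simp_all add: image_image del: mem_image i.mem_image)
  have r: "relabel \<pi> (relabel \<pi>' u) = u" "relabel \<pi>' (relabel \<pi> u) = u" for u :: "('r, 'k) tmat"
    by (simp_all add: relabel_def)
  have nat: "mid Q \<odot> u = u \<odot> mid P" if "u \<in> mhom P Q" "finite Q" for P Q and u :: "('r, 'k) tmat"
    using that by (simp add: mid_comp comp_mid)
  show ?thesis
    unfolding equivalence_functor_def natural_iso_def
    by (rule conjI, rule linear_functor_relabel,
        rule exI[of _ "image (map_tree \<pi>')"], rule exI[of _ "\<lambda>_ _. relabel \<pi>"],
        rule exI[of _ mid], rule exI[of _ mid])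
      (auto simp: ST TS r is_iso_mid i.linear_functor_relabel nat simp del: mem_image i.mem_image)
qed

lemma ten_obj_image:
  assumes "col ` P \<subseteq> B" "col ` Q \<subseteq> B"
  shows "ten_obj B (map_tree \<pi> ` P) (map_tree \<pi> ` Q) = map_tree \<pi> ` ten_obj B P Q"
proof (rule Set.set_eqI)
  fix t
  show "t \<in> ten_obj B (map_tree \<pi> ` P) (map_tree \<pi> ` Q) \<longleftrightarrow> t \<in> map_tree \<pi> ` ten_obj B P Q"
  proof (cases t)
    case (Node x y c)
    have "col x \<in> B" if "map_tree \<pi>' x \<in> P" for x
      using that assms(1) mem_iff by force
    moreover have "col y \<in> B" if "map_tree \<pi>' y \<in> Q" for y
      using that assms(2) mem_iff by force
    ultimately show ?thesis
      using Nst_inv[of "col x" "col y" c] by (auto simp: Node mem_iff)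
  qed simp
qed

lemma relabel_ten_mor:
  assumes u: "u \<in> mhom P P'" "col ` P \<subseteq> B" and v: "v \<in> mhom Q Q'" "col ` Q \<subseteq> B"
  shows "relabel \<pi>' (ten_mor B u v) = ten_mor B (relabel \<pi>' u) (relabel \<pi>' v)"
proof (intro ext)
  fix q p
  show "relabel \<pi>' (ten_mor B u v) q p = ten_mor B (relabel \<pi>' u) (relabel \<pi>' v) q p"
  proof (cases "\<exists>x' y' x y c. q = Node x' y' c \<and> p = Node x y c")
    case True
    then obtain x' y' x y c where qp: "q = Node x' y' c" "p = Node x y c"
      by blast
    have "col x \<in> B" if "u (map_tree \<pi>' x') (map_tree \<pi>' x) \<noteq> 0"
      using that u mem_iff[of "col x"] by (force simp: mhom_def)
    moreover have "col y \<in> B" if "v (map_tree \<pi>' y') (map_tree \<pi>' y) \<noteq> 0"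
      using that v mem_iff[of "col y"] by (force simp: mhom_def)
    ultimately show ?thesis
      using Nst_inv[of "col x" "col y" c] mem_iff[of c]
      by (cases "u (map_tree \<pi>' x') (map_tree \<pi>' x) = 0";
          cases "v (map_tree \<pi>' y') (map_tree \<pi>' y) = 0") (auto simp: relabel_def qp)
  next
    case False
    then show ?thesis
      by (auto simp: relabel_def ten_mor_eq inverse_eq split: tree.splits)
  qed
qed

end

section \<open>The monoidal structure given by a gauge transformation\<close>

locale gauge_relabelling = label_permutation B \<pi> \<pi>'
  for B :: "'r::ring_1 set" and \<pi> \<pi>' +
  fixes g :: "'r \<times> 'r \<times> 'r \<Rightarrow> 'k::field" and F F' :: "'r phi \<Rightarrow> 'k"
  assumes basis: "finite_int_basis B" "1 \<in> B" and unit: "\<pi> 1 = 1"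
    and g_nonzero: "g \<gamma> \<noteq> 0"
    and gauge: "(a, b, c, d, e, f) \<in> Phi B \<Longrightarrow>
      g (b, c, f) * g (a, f, d) * F' (\<pi> a, \<pi> b, \<pi> c, \<pi> d, \<pi> e, \<pi> f) =
      g (a, b, e) * g (e, c, d) * F (a, b, c, d, e, f)"
    and F_unit: "a \<in> B \<Longrightarrow> b \<in> B \<Longrightarrow> c \<in> B \<Longrightarrow> Nst B a b c \<noteq> 0 \<Longrightarrow> F (a, 1, b, c, a, b) = 1"
    and F'_unit: "a \<in> B \<Longrightarrow> b \<in> B \<Longrightarrow> c \<in> B \<Longrightarrow> Nst B a b c \<noteq> 0 \<Longrightarrow> F' (a, 1, b, c, a, b) = 1"
begin

abbreviation obj_map :: "'r tree set \<Rightarrow> 'r tree set" where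
  "obj_map \<equiv> image (map_tree \<pi>)"

text \<open>The inverse of \<open>g\<close>, because \<open>g\<close> rescales basis vectors while the tensorator
  goes from \<open>T P \<otimes> T Q\<close> to \<open>T (P \<otimes> Q)\<close>. The value on leaves is never used.\<close>

definition weight :: "'r tree \<Rightarrow> 'k" where
  "weight t = (case t of Node x y c \<Rightarrow> 1 / g (\<pi>' (col x), \<pi>' (col y), \<pi>' c) | Leaf _ _ \<Rightarrow> 1)"

definition tensorator :: "'r tree set \<Rightarrow> 'r tree set \<Rightarrow> ('r, 'k) tmat" where
  "tensorator P Q = diag (ten_obj B (obj_map P) (obj_map Q)) weight"

lemma weight_Node [simp]: "weight (Node x y c) = 1 / g (\<pi>' (col x), \<pi>' (col y), \<pi>' c)"
  by (simp add: weight_def)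

lemma weight_nonzero [simp]: "weight t \<noteq> 0"
  by (simp add: weight_def g_nonzero split: tree.split)

lemma unit': "\<pi>' 1 = 1"
  using inverse(2)[of 1] by (simp add: unit)

text \<open>At \<open>(1, 1, b, b, 1, b)\<close> and \<open>(b, 1, 1, b, b, 1)\<close> both points
  have the normalised value 1, and the gauge equation reduces to these equalities. They allow one
  scalar to serve as unit constraint for all objects.\<close>

lemma gauge_unit:
  assumes b: "b \<in> B"
  shows "g (1, b, b) = g (1, 1, 1)" "g (b, 1, b) = g (1, 1, 1)"
proof -
  have N: "Nst B 1 b b \<noteq> 0" "Nst B b 1 b \<noteq> 0" "Nst B 1 1 1 \<noteq> 0"
    using basis b by (simp_all add: Nst_1)
  have N': "Nst B 1 (\<pi> b) (\<pi> b) \<noteq> 0" "Nst B (\<pi> b) 1 (\<pi> b) \<noteq> 0"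
    using basis b by (simp_all add: Nst_1 mem_iff')
  have "(1, 1, b, b, 1, b) \<in> Phi B" "(b, 1, 1, b, b, 1) \<in> Phi B"
    using b N basis by (simp_all add: mem_Phi)
  from this[THEN gauge] show "g (1, b, b) = g (1, 1, 1)" "g (b, 1, b) = g (1, 1, 1)"
    using F_unit[of 1 b b] F_unit[of b 1 b] F'_unit[of 1 "\<pi> b" "\<pi> b"] F'_unit[of "\<pi> b" 1 "\<pi> b"]
      b N N' basis by (simp_all add: unit mem_iff' g_nonzero)
qed

text \<open>The weight of a tree depends on colours alone, and graded morphisms preserve colours, so
  the diagonal tensorator commutes with them.\<close>

lemma tensorator_natural:
  assumes u: "u \<in> mhom P P'" "col ` P \<subseteq> B" "finite P'" and v: "v \<in> mhom Q Q'" "col ` Q \<subseteq> B" "finite Q'"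
  shows "tensorator P' Q' \<odot> ten_mor B (relabel \<pi>' u) (relabel \<pi>' v) =
    relabel \<pi>' (ten_mor B u v) \<odot> tensorator P Q"
proof -
  let ?t = "ten_mor B (relabel \<pi>' u) (relabel \<pi>' v)"
  have ruv: "relabel \<pi>' u \<in> mhom (obj_map P) (obj_map P')" "relabel \<pi>' v \<in> mhom (obj_map Q) (obj_map Q')"
    using u v relabel_in_mhom by blast+
  have t: "?t \<in> mhom (ten_obj B (obj_map P) (obj_map Q)) (ten_obj B (obj_map P') (obj_map Q'))"
    by (rule ten_mor_in_mhom[OF ruv])
  have "graded ?t"
    by (intro graded_ten_mor graded_mhom[OF ruv(1)] graded_mhom[OF ruv(2)]) (use u v in auto)
  then have "tensorator P' Q' \<odot> ?t = ?t \<odot> tensorator P Q"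
    unfolding tensorator_def
  proof (subst diag_comp, assumption, subst comp_diag, intro ext)
    fix q p
    show "(if q \<in> ten_obj B (obj_map P') (obj_map Q') then weight q * ?t q p else 0) =
        (if p \<in> ten_obj B (obj_map P) (obj_map Q) then ?t q p * weight p else 0)"
    proof (cases "?t q p = 0")
      case False
      then have mem: "q \<in> ten_obj B (obj_map P') (obj_map Q')" "p \<in> ten_obj B (obj_map P) (obj_map Q)"
        using t unfolding mhom_def by blast+
      have "weight q = weight p"
        using ten_mor_nonzero[OF False] u v by (auto simp: relabel_def mhom_def)
          (metis col_map_tree inverse(1))
      with mem show ?thesis by simp
    qed simp
  qed
  then show ?thesis
    using u v by (simp add: relabel_ten_mor)
qed

text \<open>Entry by entry this is the gauge equation at the labels pulled back by
  \<open>\<pi>'\<close>: the two weights on the left are the reciprocals of \<open>g\<close> along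
  the path via \<open>f\<close>, those on the right along the path via \<open>e\<close>.\<close>

lemma tensorator_assoc:
  assumes fin: "finite P" "finite Q" "finite R" and col: "col ` P \<subseteq> B" "col ` Q \<subseteq> B" "col ` R \<subseteq> B"
  shows "relabel \<pi>' (masc B F P Q R) \<odot> tensorator P (ten_obj B Q R) \<odot>
      ten_mor B (mid (obj_map P)) (tensorator Q R) =
    tensorator (ten_obj B P Q) R \<odot> ten_mor B (tensorator P Q) (mid (obj_map R)) \<odot>
      masc B F' (obj_map P) (obj_map Q) (obj_map R)" (is "?L = ?R")
proof (intro ext)
  fix q p
  let ?P = "obj_map P" and ?Q = "obj_map Q" and ?R' = "obj_map R"
  have finB: "finite B"
    using basis by (simp add: finite_int_basis_def)
  have obj: "obj_map (ten_obj B P Q) = ten_obj B ?P ?Q" "obj_map (ten_obj B Q R) = ten_obj B ?Q ?R'"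
    using col by (simp_all add: ten_obj_image)
  have gr: "graded (masc B F' ?P ?Q ?R')"
    by (rule graded_mhom[OF masc_in_mhom]) (use fin finB in simp)
  have "?L q p = (if p \<in> ten_obj B ?P (ten_obj B ?Q ?R')
      then relabel \<pi>' (masc B F P Q R) q p *
        (weight p * (case p of Node x y c \<Rightarrow> weight y | Leaf _ _ \<Rightarrow> 0)) else 0)"
    unfolding tensorator_def ten_mor_diag obj diag_comp_diag unfolding comp_diag by (simp split: tree.split)
  moreover have "?R q p = (if q \<in> ten_obj B (ten_obj B ?P ?Q) ?R'
      then weight q * (case q of Node x y c \<Rightarrow> weight x | Leaf _ _ \<Rightarrow> 0) * masc B F' ?P ?Q ?R' q p else 0)"
    unfolding tensorator_def ten_mor_diag obj mat_comp_assoc[OF gr graded_diag, symmetric] diag_comp_diag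
    unfolding diag_comp[OF gr] by (simp split: tree.split)
  moreover have "(if p \<in> ten_obj B ?P (ten_obj B ?Q ?R')
      then relabel \<pi>' (masc B F P Q R) q p *
        (weight p * (case p of Node x y c \<Rightarrow> weight y | Leaf _ _ \<Rightarrow> 0)) else 0) =
    (if q \<in> ten_obj B (ten_obj B ?P ?Q) ?R'
      then weight q * (case q of Node x y c \<Rightarrow> weight x | Leaf _ _ \<Rightarrow> 0) * masc B F' ?P ?Q ?R' q p else 0)"
  proof (cases "\<exists>x y z d e f. q = Node (Node x y e) z d \<and> p = Node x (Node y z f) d")
    case False
    have "masc B F' ?P ?Q ?R' q p = 0"
      using False by (metis masc_nonzero)
    moreover have "relabel \<pi>' (masc B F P Q R) q p = 0"
    proof (rule ccontr)
      assume "relabel \<pi>' (masc B F P Q R) q p \<noteq> 0"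
      then obtain x y z d e f where "map_tree \<pi>' q = Node (Node x y e) z d" "map_tree \<pi>' p = Node x (Node y z f) d"
        unfolding relabel_def by (rule masc_nonzero)
      then have "q = map_tree \<pi> (Node (Node x y e) z d)" "p = map_tree \<pi> (Node x (Node y z f) d)"
        by (metis map_tree_inverse(1))+
      with False show False by simp
    qed
    ultimately show ?thesis by simp
  next
    case True
    then obtain x y z d e f where q: "q = Node (Node x y e) z d" and p: "p = Node x (Node y z f) d"
      by blast
    let ?a = "\<pi>' (col x)" and ?b = "\<pi>' (col y)" and ?c = "\<pi>' (col z)"
    let ?in = "map_tree \<pi>' x \<in> P \<and> map_tree \<pi>' y \<in> Q \<and> map_tree \<pi>' z \<in> R \<and> d \<in> B \<and> e \<in> B \<and> f \<in> B \<and>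
       Nst B (col x) (col y) e \<noteq> 0 \<and> Nst B e (col z) d \<noteq> 0 \<and>
       Nst B (col y) (col z) f \<noteq> 0 \<and> Nst B (col x) f d \<noteq> 0"
    have B: "col x \<in> B" if "map_tree \<pi>' x \<in> P \<or> map_tree \<pi>' x \<in> Q \<or> map_tree \<pi>' x \<in> R" for x
      using that col mem_iff[of "col x"] by force
    have 1: "relabel \<pi>' (masc B F P Q R) q p = (if ?in then F (?a, ?b, ?c, \<pi>' d, \<pi>' e, \<pi>' f) else 0)"
      using B by (auto simp: relabel_def q p masc_Node mem_iff Nst_inv)
    have 2: "masc B F' ?P ?Q ?R' q p = (if ?in then F' (col x, col y, col z, d, e, f) else 0)"
      by (simp add: q p masc_Node)
    show ?thesis
    proof (cases ?in)
      case True
      then have "(?a, ?b, ?c, \<pi>' d, \<pi>' e, \<pi>' f) \<in> Phi B"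
        using B by (auto simp: mem_Phi mem_iff Nst_inv)
      from gauge[OF this] have "g (?b, ?c, \<pi>' f) * g (?a, \<pi>' f, \<pi>' d) * F' (col x, col y, col z, d, e, f) =
          g (?a, ?b, \<pi>' e) * g (\<pi>' e, ?c, \<pi>' d) * F (?a, ?b, ?c, \<pi>' d, \<pi>' e, \<pi>' f)"
        by (simp add: inverse)
      then show ?thesis
        using True g_nonzero unfolding 1 2 by (simp add: q p field_simps)
    qed (simp only: 1 2 if_False mult_zero_left mult_zero_right if_cancel)
  qed
  ultimately show "?L q p = ?R q p" by simp
qed

lemma monoidal_structure_relabel:
  "monoidal_structure (fus_cat B F) (fus_cat B F') obj_map (\<lambda>_ _. relabel \<pi>') tensorator
     (diag (simple_obj 1) (\<lambda>_. g (1, 1, 1)))"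
proof -
  \<comment> \<open>The scalar cancels the tensorator weight on a product with the unit, which by
    \<open>gauge_unit\<close> is always the reciprocal of \<open>g (1, 1, 1)\<close>.\<close>
  let ?\<iota> = "diag (simple_obj 1) (\<lambda>_. g (1, 1, 1))"
  have one: "obj_map (simple_obj 1) = simple_obj 1"
    by (simp add: simple_obj_def unit del: mem_image)
  have J: "is_iso (fus_cat B F') (ten_obj B (obj_map P) (obj_map Q)) (obj_map (ten_obj B P Q)) (tensorator P Q)"
    if "col ` P \<subseteq> B" "col ` Q \<subseteq> B" for P Q
    unfolding tensorator_def ten_obj_image[OF that, symmetric] by (rule is_iso_diag) simp
  have L: "(\<lambda>q p. if q \<in> obj_map P \<and> p = Node (Leaf 0 1) q (col q) then 1 else 0) =
      relabel \<pi>' (\<lambda>q p. if q \<in> P \<and> p = Node (Leaf 0 1) q (col q) then 1 else 0) \<odot>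
        tensorator (simple_obj 1) P \<odot> ten_mor B ?\<iota> (mid (obj_map P))" (is "?L1 = ?L2")
   and R: "(\<lambda>q p. if q \<in> obj_map P \<and> p = Node q (Leaf 0 1) (col q) then 1 else 0) =
      relabel \<pi>' (\<lambda>q p. if q \<in> P \<and> p = Node q (Leaf 0 1) (col q) then 1 else 0) \<odot>
        tensorator P (simple_obj 1) \<odot> ten_mor B (mid (obj_map P)) ?\<iota>" (is "?R1 = ?R2")
    if P: "col ` P \<subseteq> B" for P
  proof -
    have col: "col q \<in> B" "\<pi>' (col q) \<in> B" if "map_tree \<pi>' q \<in> P" for q
      using that P mem_iff[of "col q"] by force+
    have node: "map_tree \<pi>' p = Node (Leaf 0 1) (map_tree \<pi>' q) (\<pi>' (col q)) \<longleftrightarrow> p = Node (Leaf 0 1) q (col q)"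
      "map_tree \<pi>' p = Node (map_tree \<pi>' q) (Leaf 0 1) (\<pi>' (col q)) \<longleftrightarrow> p = Node q (Leaf 0 1) (col q)" for p q
      using map_tree_eq[of p "Node (Leaf 0 1) q (col q)"] map_tree_eq[of p "Node q (Leaf 0 1) (col q)"]
      by (simp_all add: unit')
    show "?L1 = ?L2"
    proof (intro ext)
      fix q p
      show "?L1 q p = ?L2 q p"
        unfolding tensorator_def ten_mor_diag one diag_comp_diag unfolding comp_diag
        using col[of q] basis g_nonzero
        by (cases "map_tree \<pi>' q \<in> P \<and> p = Node (Leaf 0 1) q (col q)")
          (simp_all add: relabel_def node simple_obj_def Nst_1 gauge_unit[of "\<pi>' (col q)"] unit' mem_iff)
    qed
    show "?R1 = ?R2"
    proof (intro ext)
      fix q p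
      show "?R1 q p = ?R2 q p"
        unfolding tensorator_def ten_mor_diag one diag_comp_diag unfolding comp_diag
        using col[of q] basis g_nonzero
        by (cases "map_tree \<pi>' q \<in> P \<and> p = Node q (Leaf 0 1) (col q)")
          (simp_all add: relabel_def node simple_obj_def Nst_1 gauge_unit[of "\<pi>' (col q)"] unit' mem_iff)
    qed
  qed
  have iota: "is_iso (fus_cat B F') (simple_obj 1) (obj_map (simple_obj 1)) ?\<iota>"
    unfolding one by (rule is_iso_diag) (simp add: g_nonzero)
  show ?thesis
    unfolding monoidal_structure_def fus_cat_sel
    by (auto simp only: mem_Collect_eq iota J tensorator_natural tensorator_assoc L[symmetric] R[symmetric])
qed

end

lemma monoidally_equivalent_along_gauge:
  assumes R: "unital_based_ring B star" and \<rho>: "\<rho> \<in> based_aut B"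
    and F: "F \<in> Xvar B star" and F': "F' \<in> Xvar B star"
    and g: "gauge_equivalent B g F (F' \<circ> act_phi \<rho>)"
  shows "monoidally_equivalent_along B simple_obj simple_obj \<rho> (fus_cat B F) (fus_cat B F')"
proof -
  \<comment> \<open>Extension by the identity outside \<open>B\<close> turns \<open>\<rho>\<close>
    into a permutation of the whole type.\<close>
  define \<pi> where "\<pi> x = (if x \<in> B then \<rho> x else x)" for x
  define \<pi>' where "\<pi>' x = (if x \<in> B then inv_into B \<rho> x else x)" for x
  have bij: "bij_betw \<rho> B B"
    by (rule based_aut_bij[OF \<rho>])
  have inv_mem: "inv_into B \<rho> x \<in> B" if "x \<in> B" for x
    using bij that by (metis bij_betw_def inv_into_into)
  have inv1: "\<rho> (inv_into B \<rho> x) = x" if "x \<in> B" for x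
    using bij that by (simp add: bij_betw_inv_into_right)
  have inv2: "inv_into B \<rho> (\<rho> x) = x" if "x \<in> B" for x
    using bij that by (simp add: bij_betw_inv_into_left)
  have B: "finite_int_basis B" "1 \<in> B"
    using R by (auto simp: unital_based_ring_def)
  have gauge: "g (b, c, f) * g (a, f, d) * F' (\<rho> a, \<rho> b, \<rho> c, \<rho> d, \<rho> e, \<rho> f) =
      g (a, b, e) * g (e, c, d) * F (a, b, c, d, e, f)"
    if "(a, b, c, d, e, f) \<in> Phi B" for a b c d e f
    using g that by (simp add: gauge_equivalent_def)
  interpret gauge_relabelling B \<pi> \<pi>' g F F'
  proof
    show "\<pi> (\<pi>' x) = x" "\<pi>' (\<pi> x) = x" "\<pi>' x \<in> B \<longleftrightarrow> x \<in> B" for x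
      using inv1 inv2 inv_mem based_aut_mem[OF \<rho>] by (auto simp: \<pi>_def \<pi>'_def)
    show "Nst B (\<pi>' x) (\<pi>' y) (\<pi>' z) = Nst B x y z" if "x \<in> B" "y \<in> B" "z \<in> B" for x y z
      using that Nst_based_aut[OF \<rho> inv_mem inv_mem inv_mem, of x y z] by (simp add: \<pi>'_def inv1)
    show "\<pi> 1 = 1"
      using B by (simp add: \<pi>_def based_aut_1[OF \<rho> R])
    show "g \<gamma> \<noteq> 0" for \<gamma>
      using g unfolding gauge_equivalent_def by blast
    show "g (b, c, f) * g (a, f, d) * F' (\<pi> a, \<pi> b, \<pi> c, \<pi> d, \<pi> e, \<pi> f) =
        g (a, b, e) * g (e, c, d) * F (a, b, c, d, e, f)"
      if "(a, b, c, d, e, f) \<in> Phi B" for a b c d e f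
      using gauge[OF that] that by (simp add: mem_Phi \<pi>_def)
  qed (use B F F' in \<open>auto simp: Xvar_def\<close>)
  have "map_tree \<pi> ` simple_obj b = simple_obj (\<rho> b)" if "b \<in> B" for b
    using that by (simp add: simple_obj_def \<pi>_def del: mem_image)
  then have "\<forall>b\<in>B. \<exists>u. is_iso (fus_cat B F') (map_tree \<pi> ` simple_obj b) (simple_obj (\<rho> b)) u"
    using is_iso_mid by metis
  then show ?thesis
    unfolding monoidally_equivalent_along_def
    using equivalence_functor_relabel monoidal_structure_relabel by blast
qed

section \<open>From a monoidal functor to a gauge transformation\<close>

text \<open>Inclusion of the summand \<open>c\<close> into the tensor product of \<open>a\<close>
  and \<open>b\<close>; \<open>basis_covec\<close> is the matching projection. Working with both
  makes it possible to read off matrix entries of the associator by composition.\<close>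

definition basis_vec :: "'b \<Rightarrow> 'b \<Rightarrow> 'b \<Rightarrow> ('b, 'k::field) tmat" where
  "basis_vec a b c = munit (Node (Leaf 0 a) (Leaf 0 b) c) (Leaf 0 c)"

definition basis_covec :: "'b \<Rightarrow> 'b \<Rightarrow> 'b \<Rightarrow> ('b, 'k::field) tmat" where
  "basis_covec a b c = munit (Leaf 0 c) (Node (Leaf 0 a) (Leaf 0 b) c)"

lemma simple_obj_mem: "x \<in> simple_obj b \<longleftrightarrow> x = Leaf 0 b"
  by (simp add: simple_obj_def)

lemma graded_basis [simp]: "graded (basis_vec a b c)" "graded (basis_covec a b c)"
  by (simp_all add: basis_vec_def basis_covec_def graded_munit)

lemma basis_in_mhom:
  assumes "(a, b, c) \<in> Gamma B"
  shows "basis_vec a b c \<in> mhom (simple_obj c) (ten_obj B (simple_obj a) (simple_obj b))"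
    and "basis_covec a b c \<in> mhom (ten_obj B (simple_obj a) (simple_obj b)) (simple_obj c)"
  unfolding basis_vec_def basis_covec_def using assms
  by (auto intro!: munit_in_mhom simp: simple_obj_mem Gamma_def)

lemma covec_vec: "basis_covec a b c \<odot> basis_vec a b c = mid (simple_obj c)"
  by (simp add: basis_vec_def basis_covec_def comp_munit)
    (auto simp: munit_def diag_def simple_obj_mem fun_eq_iff)

text \<open>A product of two simple objects contains at most one tree of colour \<open>c\<close>, so
  the morphism has at most one non-zero entry.\<close>

lemma mhom_simple_ten:
  assumes "u \<in> mhom (simple_obj c) (ten_obj B (simple_obj a) (simple_obj b))"
  shows "u = scl (u (Node (Leaf 0 a) (Leaf 0 b) c) (Leaf 0 c)) (basis_vec a b c)"
proof (intro ext)
  fix q p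
  show "u q p = scl (u (Node (Leaf 0 a) (Leaf 0 b) c) (Leaf 0 c)) (basis_vec a b c) q p"
  proof (cases "u q p = 0")
    case False
    then have "q \<in> ten_obj B (simple_obj a) (simple_obj b)" "p = Leaf 0 c" "col q = c"
      using assms by (force simp: mhom_def simple_obj_mem)+
    then show ?thesis
      by (cases q) (auto simp: simple_obj_mem scl_def basis_vec_def munit_def)
  qed (auto simp: scl_def basis_vec_def munit_def)
qed

lemma mhom_ten_simple:
  assumes "u \<in> mhom (ten_obj B (simple_obj a) (simple_obj b)) (simple_obj c)"
  shows "u = scl (u (Leaf 0 c) (Node (Leaf 0 a) (Leaf 0 b) c)) (basis_covec a b c)"
proof (intro ext)
  fix q p
  show "u q p = scl (u (Leaf 0 c) (Node (Leaf 0 a) (Leaf 0 b) c)) (basis_covec a b c) q p"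
  proof (cases "u q p = 0")
    case False
    then have "p \<in> ten_obj B (simple_obj a) (simple_obj b)" "q = Leaf 0 c" "col p = c"
      using assms by (force simp: mhom_def simple_obj_mem)+
    then show ?thesis
      by (cases p) (auto simp: simple_obj_mem scl_def basis_covec_def munit_def)
  qed (auto simp: scl_def basis_covec_def munit_def)
qed

lemma mid_simple_eq_scl_iff: "scl s (mid (simple_obj b)) = scl t (mid (simple_obj b)) \<longleftrightarrow> s = t"
  by (auto simp: scl_def diag_def simple_obj_mem fun_eq_iff)

lemma scl_1 [simp]: "scl 1 u = u"
  by (simp add: scl_def)

text \<open>Isolating a single entry of the associativity matrix avoids applying functors to sums
  of morphisms.\<close>

lemma masc_basis_entry:
  assumes "(a, b, c, d, e, f) \<in> Phi B" "finite B"
  shows "basis_covec e c d \<odot> ten_mor B (basis_covec a b e) (mid (simple_obj c)) \<odot>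
      masc B F (simple_obj a) (simple_obj b) (simple_obj c) \<odot>
      ten_mor B (mid (simple_obj a)) (basis_vec b c f) \<odot> basis_vec a f d =
    scl (F (a, b, c, d, e, f)) (mid (simple_obj d))"
proof -
  let ?q = "Node (Node (Leaf 0 a) (Leaf 0 b) e) (Leaf 0 c) d"
  let ?p = "Node (Leaf 0 a) (Node (Leaf 0 b) (Leaf 0 c) f) d"
  have fin: "finite (simple_obj x)" for x :: 'a
    by (simp add: simple_obj_def)
  have gr: "graded (masc B F (simple_obj a) (simple_obj b) (simple_obj c))"
    by (rule graded_mhom[OF masc_in_mhom]) (simp add: fin assms(2))
  have N: "d \<in> B" "Nst B e c d \<noteq> 0" "Nst B a f d \<noteq> 0"
    using assms(1) by (simp_all add: mem_Phi)
  \<comment> \<open>The two inclusions compose to a matrix unit at the column index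
    \<open>?p\<close>, the two projections in \<open>2\<close> to one at the row index
    \<open>?q\<close>.\<close>
  have 1: "ten_mor B (mid (simple_obj a)) (basis_vec b c f) \<odot> basis_vec a f d = munit ?p (Leaf 0 d)"
  proof (intro ext)
    fix q p
    have "q = ?p" if "ten_mor B (mid (simple_obj a)) (basis_vec b c f) q (Node (Leaf 0 a) (Leaf 0 f) d) \<noteq> 0"
      using ten_mor_nonzero[OF that] by (auto simp: basis_vec_def munit_def diag_def split: if_splits)
    moreover have "ten_mor B (mid (simple_obj a)) (basis_vec b c f) ?p (Node (Leaf 0 a) (Leaf 0 f) d) = 1"
      using N by (simp add: diag_def simple_obj_mem basis_vec_def munit_def)
    ultimately show
      "(ten_mor B (mid (simple_obj a)) (basis_vec b c f) \<odot> basis_vec a f d) q p = munit ?p (Leaf 0 d) q p"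
      unfolding basis_vec_def[of a f d] by (subst comp_munit) (auto simp: munit_def)
  qed
  have 2: "basis_covec e c d \<odot> ten_mor B (basis_covec a b e) (mid (simple_obj c)) = munit (Leaf 0 d) ?q"
  proof (intro ext)
    fix q p
    have "p = ?q" if "ten_mor B (basis_covec a b e) (mid (simple_obj c)) (Node (Leaf 0 e) (Leaf 0 c) d) p \<noteq> 0"
      using ten_mor_nonzero[OF that] by (auto simp: basis_covec_def munit_def diag_def split: if_splits)
    moreover have "ten_mor B (basis_covec a b e) (mid (simple_obj c)) (Node (Leaf 0 e) (Leaf 0 c) d) ?q = 1"
      using N by (simp add: diag_def simple_obj_mem basis_covec_def munit_def)
    ultimately show
      "(basis_covec e c d \<odot> ten_mor B (basis_covec a b e) (mid (simple_obj c))) q p = munit (Leaf 0 d) ?q q p"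
      unfolding basis_covec_def[of e c d] by (subst munit_comp) (auto simp: munit_def)
  qed
  let ?A = "masc B F (simple_obj a) (simple_obj b) (simple_obj c)"
  have 3: "(munit (Leaf 0 d) ?q \<odot> ?A) \<odot> munit ?p (Leaf 0 d) = scl (F (a, b, c, d, e, f)) (mid (simple_obj d))"
    unfolding munit_comp[OF gr] using assms(1)
    by (simp add: comp_munit) (auto simp: masc_Node simple_obj_mem mem_Phi scl_def diag_def fun_eq_iff)
  have "basis_covec e c d \<odot> ten_mor B (basis_covec a b e) (mid (simple_obj c)) \<odot> ?A \<odot> munit ?p (Leaf 0 d) =
      ((basis_covec e c d \<odot> ten_mor B (basis_covec a b e) (mid (simple_obj c))) \<odot> ?A) \<odot> munit ?p (Leaf 0 d)"
    using gr by (simp add: mat_comp_assoc graded_munit)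
  then show ?thesis
    unfolding 1 2 3 .
qed

text \<open>Lets an intertwining relation act at the head of a right-nested composite whose tail is
  \<open>r\<close>.\<close>

lemma comp_step:
  assumes "x \<odot> y = scl k (x' \<odot> y')" "graded y" "graded y'" "graded r"
  shows "x \<odot> y \<odot> r = scl k (x' \<odot> y' \<odot> r)"
  by (metis assms mat_comp_assoc scl_comp)

definition is_obj :: "'b set \<Rightarrow> 'b tree set \<Rightarrow> bool" where
  "is_obj B P \<longleftrightarrow> finite P \<and> col ` P \<subseteq> B"

lemma is_obj_simple [simp]: "is_obj B (simple_obj b) \<longleftrightarrow> b \<in> B"
  by (simp add: is_obj_def simple_obj_def)

lemma is_obj_finite: "is_obj B P \<Longrightarrow> finite P"
  by (simp add: is_obj_def)

text \<open>On \<open>\<rho>\<close> only \<open>B\<close>-valuedness is required, so the setting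
  also covers the map on labels induced by an equivalence before that map is known to be an
  automorphism.\<close>

locale monoidal_functor_on_simples =
  fixes B :: "'r::ring_1 set" and F F' :: "'r phi \<Rightarrow> 'k::field"
    and T :: "'r tree set \<Rightarrow> 'r tree set"
    and TM :: "'r tree set \<Rightarrow> 'r tree set \<Rightarrow> ('r, 'k) tmat \<Rightarrow> ('r, 'k) tmat"
    and J :: "'r tree set \<Rightarrow> 'r tree set \<Rightarrow> ('r, 'k) tmat" and \<iota> :: "('r, 'k) tmat"
    and \<rho> :: "'r \<Rightarrow> 'r" and U :: "'r \<Rightarrow> ('r, 'k) tmat"
  assumes finB: "finite B"
    and lin: "linear_functor (fus_cat B F) (fus_cat B F') T TM"
    and mon: "monoidal_structure (fus_cat B F) (fus_cat B F') T TM J \<iota>"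
    and \<rho>_mem: "b \<in> B \<Longrightarrow> \<rho> b \<in> B"
    and U_iso: "b \<in> B \<Longrightarrow> is_iso (fus_cat B F') (T (simple_obj b)) (simple_obj (\<rho> b)) (U b)"
begin

abbreviation "s \<equiv> simple_obj"
abbreviation "ten \<equiv> ten_obj B"
abbreviation "ob \<equiv> is_obj B"

definition U' where
  "U' b = (SOME v. v \<in> mhom (s (\<rho> b)) (T (s b)) \<and> v \<odot> U b = mid (T (s b)) \<and> U b \<odot> v = mid (s (\<rho> b)))"

definition J' where
  "J' P Q = (SOME v. v \<in> mhom (T (ten P Q)) (ten (T P) (T Q)) \<and>
     v \<odot> J P Q = mid (ten (T P) (T Q)) \<and> J P Q \<odot> v = mid (T (ten P Q)))"

lemma ob_ten [simp]: "ob P \<Longrightarrow> ob Q \<Longrightarrow> ob (ten P Q)"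
  using col_ten_obj[of B P Q] by (simp add: is_obj_def finB)

lemma ob_T [simp]: "ob P \<Longrightarrow> ob (T P)"
  using lin by (simp add: linear_functor_def is_obj_def)

lemma TM_mid: "ob P \<Longrightarrow> TM P P (mid P) = mid (T P)"
  using lin by (simp add: linear_functor_def is_obj_def)

lemma TM_mhom: "ob P \<Longrightarrow> ob Q \<Longrightarrow> u \<in> mhom P Q \<Longrightarrow> TM P Q u \<in> mhom (T P) (T Q)"
  using lin by (simp add: linear_functor_def is_obj_def)

lemma TM_comp:
  "ob P \<Longrightarrow> ob Q \<Longrightarrow> ob R \<Longrightarrow> u \<in> mhom P Q \<Longrightarrow> v \<in> mhom Q R \<Longrightarrow>
    TM P R (v \<odot> u) = TM Q R v \<odot> TM P Q u"
  using lin by (simp add: linear_functor_def is_obj_def)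

lemma TM_scl: "ob P \<Longrightarrow> ob Q \<Longrightarrow> u \<in> mhom P Q \<Longrightarrow> TM P Q (scl k u) = scl k (TM P Q u)"
  using lin by (simp add: linear_functor_def is_obj_def)

lemma graded_TM [simp]: "ob P \<Longrightarrow> ob Q \<Longrightarrow> u \<in> mhom P Q \<Longrightarrow> graded (TM P Q u)"
  by (rule graded_mhom[OF TM_mhom]) (auto dest: ob_T simp: is_obj_finite)

lemma U_facts:
  assumes "b \<in> B"
  shows "U b \<in> mhom (T (s b)) (s (\<rho> b))" "U' b \<in> mhom (s (\<rho> b)) (T (s b))"
    "U' b \<odot> U b = mid (T (s b))" "U b \<odot> U' b = mid (s (\<rho> b))"
proof -
  have "\<exists>v. v \<in> mhom (s (\<rho> b)) (T (s b)) \<and> v \<odot> U b = mid (T (s b)) \<and> U b \<odot> v = mid (s (\<rho> b))"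
    and "U b \<in> mhom (T (s b)) (s (\<rho> b))"
    using U_iso[OF assms] by (auto simp: is_iso_def)
  from someI_ex[OF this(1)] this(2) show
    "U b \<in> mhom (T (s b)) (s (\<rho> b))" "U' b \<in> mhom (s (\<rho> b)) (T (s b))"
    "U' b \<odot> U b = mid (T (s b))" "U b \<odot> U' b = mid (s (\<rho> b))"
    by (auto simp: U'_def)
qed

lemma J_facts:
  assumes "ob P" "ob Q"
  shows "J P Q \<in> mhom (ten (T P) (T Q)) (T (ten P Q))" "J' P Q \<in> mhom (T (ten P Q)) (ten (T P) (T Q))"
    "J' P Q \<odot> J P Q = mid (ten (T P) (T Q))" "J P Q \<odot> J' P Q = mid (T (ten P Q))"
proof -
  have "is_iso (fus_cat B F') (ten (T P) (T Q)) (T (ten P Q)) (J P Q)"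
    using mon assms by (simp add: monoidal_structure_def is_obj_def)
  then have "\<exists>v. v \<in> mhom (T (ten P Q)) (ten (T P) (T Q)) \<and>
     v \<odot> J P Q = mid (ten (T P) (T Q)) \<and> J P Q \<odot> v = mid (T (ten P Q))"
    and "J P Q \<in> mhom (ten (T P) (T Q)) (T (ten P Q))"
    by (auto simp: is_iso_def)
  from someI_ex[OF this(1)] this(2) show
    "J P Q \<in> mhom (ten (T P) (T Q)) (T (ten P Q))" "J' P Q \<in> mhom (T (ten P Q)) (ten (T P) (T Q))"
    "J' P Q \<odot> J P Q = mid (ten (T P) (T Q))" "J P Q \<odot> J' P Q = mid (T (ten P Q))"
    by (auto simp: J'_def)
qed

lemma finite_ob [simp]: "ob P \<Longrightarrow> finite P"
  by (rule is_obj_finite)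

lemma graded_U [simp]: "b \<in> B \<Longrightarrow> graded (U b)" "b \<in> B \<Longrightarrow> graded (U' b)"
  by (rule graded_mhom[OF U_facts(1)]; simp add: \<rho>_mem simple_obj_def)
    (rule graded_mhom[OF U_facts(2)]; simp)

lemma graded_J [simp]:
  assumes "ob P" "ob Q"
  shows "graded (J P Q)" "graded (J' P Q)"
  using graded_mhom[OF J_facts(1)[OF assms]] graded_mhom[OF J_facts(2)[OF assms]] assms by simp_all

lemma J_natural:
  "ob P \<Longrightarrow> ob P' \<Longrightarrow> ob Q \<Longrightarrow> ob Q' \<Longrightarrow> u \<in> mhom P P' \<Longrightarrow> v \<in> mhom Q Q' \<Longrightarrow>
    J P' Q' \<odot> ten_mor B (TM P P' u) (TM Q Q' v) = TM (ten P Q) (ten P' Q') (ten_mor B u v) \<odot> J P Q"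
  using mon by (simp add: monoidal_structure_def is_obj_def)

lemma J'_natural:
  assumes ob: "ob P" "ob P'" "ob Q" "ob Q'" and u: "u \<in> mhom P P'" and v: "v \<in> mhom Q Q'"
  shows "J' P' Q' \<odot> TM (ten P Q) (ten P' Q') (ten_mor B u v) = ten_mor B (TM P P' u) (TM Q Q' v) \<odot> J' P Q"
proof -
  let ?t = "ten_mor B (TM P P' u) (TM Q Q' v)" and ?T = "TM (ten P Q) (ten P' Q') (ten_mor B u v)"
  have uv: "ten_mor B u v \<in> mhom (ten P Q) (ten P' Q')"
    by (rule ten_mor_in_mhom[OF u v])
  have gr: "graded ?t" "graded ?T"
    using ob u v uv by simp_all
  have "?T \<in> mhom (T (ten P Q)) (T (ten P' Q'))"
    using ob uv by (simp add: TM_mhom)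
  then have "J' P' Q' \<odot> ?T = J' P' Q' \<odot> ?T \<odot> J P Q \<odot> J' P Q"
    using ob by (simp add: J_facts comp_mid)
  also have "\<dots> = J' P' Q' \<odot> (?T \<odot> J P Q) \<odot> J' P Q"
    using ob gr by (simp add: mat_comp_assoc)
  also have "\<dots> = J' P' Q' \<odot> (J P' Q' \<odot> ?t) \<odot> J' P Q"
    using ob u v by (simp add: J_natural)
  also have "\<dots> = (J' P' Q' \<odot> J P' Q') \<odot> ?t \<odot> J' P Q"
    using ob gr by (simp add: mat_comp_assoc)
  also have "\<dots> = mid (ten (T P') (T Q')) \<odot> ?t \<odot> J' P Q"
    using ob by (simp add: J_facts)
  also have "?t \<odot> J' P Q \<in> mhom (T (ten P Q)) (ten (T P') (T Q'))"
    using ob u v by (intro mat_comp_in_mhom[OF ten_mor_in_mhom J_facts(2)] TM_mhom)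
  then have "mid (ten (T P') (T Q')) \<odot> ?t \<odot> J' P Q = ?t \<odot> J' P Q"
    using ob finB by (intro mid_comp) auto
  finally show ?thesis .
qed

text \<open>\<open>K a b\<close> identifies the image of a tensor product with the standard product
  of the relabelled simple objects. \<open>KL\<close> and \<open>KR\<close> do the same for the two
  bracketings of a triple product, built on \<open>J'\<close> because they start from the
  image.\<close>

definition K where "K a b = ten_mor B (U a) (U b) \<odot> J' (s a) (s b)"
definition K' where "K' a b = J (s a) (s b) \<odot> ten_mor B (U' a) (U' b)"
definition KL where "KL a b c = ten_mor B (K a b) (U c) \<odot> J' (ten (s a) (s b)) (s c)"
definition KR where "KR a b c = ten_mor B (U a) (K b c) \<odot> J' (s a) (ten (s b) (s c))"

lemma K_mhom:
  assumes "a \<in> B" "b \<in> B"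
  shows "K a b \<in> mhom (T (ten (s a) (s b))) (ten (s (\<rho> a)) (s (\<rho> b)))"
    "K' a b \<in> mhom (ten (s (\<rho> a)) (s (\<rho> b))) (T (ten (s a) (s b)))"
  unfolding K_def K'_def using assms
  by (auto intro!: mat_comp_in_mhom ten_mor_in_mhom intro: U_facts J_facts)

lemma graded_K [simp]: "a \<in> B \<Longrightarrow> b \<in> B \<Longrightarrow> graded (K a b)" "a \<in> B \<Longrightarrow> b \<in> B \<Longrightarrow> graded (K' a b)"
  by (simp_all add: K_def K'_def)

lemma K'_K:
  assumes "a \<in> B" "b \<in> B"
  shows "K' a b \<odot> K a b = mid (T (ten (s a) (s b)))"
proof -
  have "K' a b \<odot> K a b = J (s a) (s b) \<odot> (ten_mor B (U' a) (U' b) \<odot> ten_mor B (U a) (U b)) \<odot> J' (s a) (s b)"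
    using assms by (simp add: K_def K'_def mat_comp_assoc)
  also have "\<dots> = J (s a) (s b) \<odot> mid (ten (T (s a)) (T (s b))) \<odot> J' (s a) (s b)"
    using assms by (simp add: ten_mor_comp U_facts ten_mor_mid)
  also have "mid (ten (T (s a)) (T (s b))) \<odot> J' (s a) (s b) = J' (s a) (s b)"
    using assms finB by (intro mid_comp[OF J_facts(2)]) auto
  finally show ?thesis
    using assms by (simp add: J_facts)
qed

text \<open>The future gauge transformation: the coordinate of the transported image of a basis
  vector.\<close>

definition vec_scalar :: "'r \<times> 'r \<times> 'r \<Rightarrow> 'k" where
  "vec_scalar = (\<lambda>(a, b, c). (K a b \<odot> TM (s c) (ten (s a) (s b)) (basis_vec a b c) \<odot> U' c)
     (Node (Leaf 0 (\<rho> a)) (Leaf 0 (\<rho> b)) (\<rho> c)) (Leaf 0 (\<rho> c)))"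

definition covec_scalar :: "'r \<times> 'r \<times> 'r \<Rightarrow> 'k" where
  "covec_scalar = (\<lambda>(a, b, c). (U c \<odot> TM (ten (s a) (s b)) (s c) (basis_covec a b c) \<odot> K' a b)
     (Leaf 0 (\<rho> c)) (Node (Leaf 0 (\<rho> a)) (Leaf 0 (\<rho> b)) (\<rho> c)))"

section \<open>Images of basis vectors and covectors\<close>

context
  fixes a b c
  assumes \<gamma>: "(a, b, c) \<in> Gamma B"
begin

lemma \<gamma>_mem: "a \<in> B" "b \<in> B" "c \<in> B"
  using \<gamma> by (auto simp: Gamma_def)

lemma TM_basis_mhom:
  "TM (s c) (ten (s a) (s b)) (basis_vec a b c) \<in> mhom (T (s c)) (T (ten (s a) (s b)))"
  "TM (ten (s a) (s b)) (s c) (basis_covec a b c) \<in> mhom (T (ten (s a) (s b))) (T (s c))"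
  using \<gamma> \<gamma>_mem by (simp_all add: TM_mhom basis_in_mhom)

lemma vec_mhom:
  "K a b \<odot> TM (s c) (ten (s a) (s b)) (basis_vec a b c) \<odot> U' c \<in>
    mhom (s (\<rho> c)) (ten (s (\<rho> a)) (s (\<rho> b)))"
  using \<gamma>_mem by (intro mat_comp_in_mhom[OF K_mhom(1)] mat_comp_in_mhom[OF TM_basis_mhom(1)] U_facts)

text \<open>The conjugated image lies in a space spanned by one basis vector. Keeping
  \<open>U c\<close> on the right instead of its inverse on the left-hand side gives the
  intertwining form used in chains of composites.\<close>

lemma vec_image:
  "K a b \<odot> TM (s c) (ten (s a) (s b)) (basis_vec a b c) =
    scl (vec_scalar (a, b, c)) (basis_vec (\<rho> a) (\<rho> b) (\<rho> c) \<odot> U c)"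
proof -
  let ?e = "TM (s c) (ten (s a) (s b)) (basis_vec a b c)"
  have gr: "graded ?e"
    using \<gamma> \<gamma>_mem by (simp add: basis_in_mhom)
  have "K a b \<odot> ?e \<odot> U' c = scl (vec_scalar (a, b, c)) (basis_vec (\<rho> a) (\<rho> b) (\<rho> c))"
    using mhom_simple_ten[OF vec_mhom] by (simp add: vec_scalar_def)
  then have "(K a b \<odot> ?e \<odot> U' c) \<odot> U c = scl (vec_scalar (a, b, c)) (basis_vec (\<rho> a) (\<rho> b) (\<rho> c) \<odot> U c)"
    by (simp add: scl_comp)
  also have "(K a b \<odot> ?e \<odot> U' c) \<odot> U c = K a b \<odot> ?e \<odot> mid (T (s c))"
    using \<gamma>_mem gr by (simp add: mat_comp_assoc U_facts)
  finally show ?thesis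
    using comp_mid[OF TM_basis_mhom(1)] by simp
qed

lemma covec_image:
  "U c \<odot> TM (ten (s a) (s b)) (s c) (basis_covec a b c) =
    scl (covec_scalar (a, b, c)) (basis_covec (\<rho> a) (\<rho> b) (\<rho> c) \<odot> K a b)"
proof -
  let ?p = "TM (ten (s a) (s b)) (s c) (basis_covec a b c)"
  have gr: "graded ?p"
    using \<gamma> \<gamma>_mem by (simp add: basis_in_mhom)
  have "U c \<odot> ?p \<odot> K' a b \<in> mhom (ten (s (\<rho> a)) (s (\<rho> b))) (s (\<rho> c))"
    using \<gamma>_mem by (intro mat_comp_in_mhom[OF U_facts(1)] mat_comp_in_mhom[OF TM_basis_mhom(2)] K_mhom)
  then have "U c \<odot> ?p \<odot> K' a b = scl (covec_scalar (a, b, c)) (basis_covec (\<rho> a) (\<rho> b) (\<rho> c))"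
    using mhom_ten_simple by (simp add: covec_scalar_def)
  then have "(U c \<odot> ?p \<odot> K' a b) \<odot> K a b =
      scl (covec_scalar (a, b, c)) (basis_covec (\<rho> a) (\<rho> b) (\<rho> c) \<odot> K a b)"
    by (simp add: scl_comp)
  also have "(U c \<odot> ?p \<odot> K' a b) \<odot> K a b = U c \<odot> ?p \<odot> mid (T (ten (s a) (s b)))"
    using \<gamma>_mem gr by (simp add: mat_comp_assoc K'_K)
  finally show ?thesis
    using comp_mid[OF TM_basis_mhom(2)] by simp
qed

text \<open>Projection after inclusion is the identity, and functors preserve this, so the two
  scalars are reciprocal. In particular neither vanishes.\<close>

lemma covec_vec_scalar: "covec_scalar (a, b, c) * vec_scalar (a, b, c) = 1"
proof -
  let ?h = "covec_scalar (a, b, c)" and ?g = "vec_scalar (a, b, c)"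
  let ?e = "TM (s c) (ten (s a) (s b)) (basis_vec a b c)"
  let ?p = "TM (ten (s a) (s b)) (s c) (basis_covec a b c)"
  have gr: "graded ?e" "graded ?p"
    using \<gamma> \<gamma>_mem by (simp_all add: basis_in_mhom)
  have "U c = U c \<odot> TM (s c) (s c) (basis_covec a b c \<odot> basis_vec a b c)"
    using \<gamma>_mem by (simp add: covec_vec TM_mid comp_mid[OF U_facts(1)])
  also have "\<dots> = U c \<odot> ?p \<odot> ?e"
    using \<gamma> \<gamma>_mem TM_comp[of "s c" "ten (s a) (s b)" "s c"] by (simp add: basis_in_mhom)
  also have "\<dots> = scl ?h (basis_covec (\<rho> a) (\<rho> b) (\<rho> c) \<odot> K a b \<odot> ?e)"
    using \<gamma>_mem gr by (intro comp_step[OF covec_image]) simp_all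
  also have "\<dots> = scl ?h (basis_covec (\<rho> a) (\<rho> b) (\<rho> c) \<odot> scl ?g (basis_vec (\<rho> a) (\<rho> b) (\<rho> c) \<odot> U c))"
    by (simp only: vec_image)
  also have "\<dots> = scl (?h * ?g) ((basis_covec (\<rho> a) (\<rho> b) (\<rho> c) \<odot> basis_vec (\<rho> a) (\<rho> b) (\<rho> c)) \<odot> U c)"
    using \<gamma>_mem by (simp add: comp_scl scl_scl mat_comp_assoc)
  also have "\<dots> = scl (?h * ?g) (mid (s (\<rho> c)) \<odot> U c)"
    by (simp only: covec_vec)
  also have "\<dots> = scl (?h * ?g) (U c)"
    using \<gamma>_mem mid_comp[OF U_facts(1)[of c]] by (simp add: \<rho>_mem)
  finally have "U c \<odot> U' c = scl (?h * ?g) (U c \<odot> U' c)"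
    by (metis scl_comp)
  then have "scl 1 (mid (s (\<rho> c))) = scl (?h * ?g) (mid (s (\<rho> c)) :: ('r, 'k) tmat)"
    using \<gamma>_mem by (simp add: U_facts)
  then show ?thesis
    unfolding mid_simple_eq_scl_iff by simp
qed

lemma vec_scalar_nonzero: "vec_scalar (a, b, c) \<noteq> 0"
  using covec_vec_scalar by auto

text \<open>A non-zero scalar is a non-zero matrix entry, and its row index can occur in the tensor
  product only if the structure constant is non-zero.\<close>

lemma Gamma_image: "(\<rho> a, \<rho> b, \<rho> c) \<in> Gamma B"
proof -
  have "(K a b \<odot> TM (s c) (ten (s a) (s b)) (basis_vec a b c) \<odot> U' c)
      (Node (Leaf 0 (\<rho> a)) (Leaf 0 (\<rho> b)) (\<rho> c)) (Leaf 0 (\<rho> c)) \<noteq> 0"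
    using vec_scalar_nonzero by (simp add: vec_scalar_def)
  then have "Node (Leaf 0 (\<rho> a)) (Leaf 0 (\<rho> b)) (\<rho> c) \<in> ten (s (\<rho> a)) (s (\<rho> b))"
    using vec_mhom unfolding mhom_def by blast
  then show ?thesis
    using \<gamma>_mem by (simp add: Gamma_def \<rho>_mem)
qed

end

text \<open>The associativity axiom of the functor, carried to the standard models: first inverted
  with respect to the tensorator, then conjugated with the \<open>U\<close>, which pass through the
  associator by \<open>masc_natural\<close>.\<close>

lemma hexagon:
  assumes "a \<in> B" "b \<in> B" "c \<in> B"
  shows "KL a b c \<odot> TM (ten (s a) (ten (s b) (s c))) (ten (ten (s a) (s b)) (s c)) (masc B F (s a) (s b) (s c)) =
    masc B F' (s (\<rho> a)) (s (\<rho> b)) (s (\<rho> c)) \<odot> KR a b c"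
proof -
  let ?x = "s a" and ?y = "s b" and ?z = "s c"
  let ?X = "T ?x" and ?Y = "T ?y" and ?Z = "T ?z"
  let ?l = "ten (ten ?x ?y) ?z" and ?r = "ten ?x (ten ?y ?z)"
  let ?A = "TM ?r ?l (masc B F ?x ?y ?z)" and ?A' = "masc B F' ?X ?Y ?Z"
  let ?J1 = "J ?x (ten ?y ?z)" and ?J2 = "ten_mor B (mid ?X) (J ?y ?z)"
  let ?J3 = "J (ten ?x ?y) ?z" and ?J4 = "ten_mor B (J ?x ?y) (mid ?Z)"
  let ?J1' = "J' ?x (ten ?y ?z)" and ?J2' = "ten_mor B (mid ?X) (J' ?y ?z)"
  let ?J3' = "J' (ten ?x ?y) ?z" and ?J4' = "ten_mor B (J' ?x ?y) (mid ?Z)"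
  let ?U3 = "ten_mor B (ten_mor B (U a) (U b)) (U c)"
  have ob: "ob ?x" "ob ?y" "ob ?z" "ob (ten ?x ?y)" "ob (ten ?y ?z)"
    using assms by simp_all
  have gA': "graded ?A'"
    by (rule graded_mhom[OF masc_in_mhom]) (use ob finB in simp)
  have Am: "?A \<in> mhom (T ?r) (T ?l)"
    using ob by (simp add: TM_mhom masc_in_mhom)
  have gA: "graded ?A"
    by (rule graded_mhom[OF Am]) (use ob in simp)
  note gr = gA gA' ob assms
  have hex: "?A \<odot> ?J1 \<odot> ?J2 = ?J3 \<odot> ?J4 \<odot> ?A'"
    using mon ob by (simp add: monoidal_structure_def is_obj_def)
  have inv1: "?J2 \<odot> ?J2' = mid (ten ?X (T (ten ?y ?z)))" "?J4' \<odot> ?J4 = mid (ten (ten ?X ?Y) ?Z)"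
    using ob by (simp_all add: ten_mor_comp J_facts diag_comp_diag ten_mor_mid)
  have inv2: "?J1 \<odot> ?J2 \<odot> ?J2' \<odot> ?J1' = mid (T ?r)"
  proof -
    have "?J1 \<odot> ?J2 \<odot> ?J2' \<odot> ?J1' = ?J1 \<odot> (?J2 \<odot> ?J2') \<odot> ?J1'"
      using gr by (simp add: mat_comp_assoc)
    also have "\<dots> = ?J1 \<odot> ?J1'"
      using ob finB by (simp add: inv1 mid_comp[OF J_facts(2)])
    finally show ?thesis
      using ob by (simp add: J_facts)
  qed
  have inv3: "?J4' \<odot> ?J3' \<odot> ?J3 \<odot> ?J4 = mid (ten (ten ?X ?Y) ?Z)"
  proof -
    have "?J4 \<in> mhom (ten (ten ?X ?Y) ?Z) (ten (T (ten ?x ?y)) ?Z)"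
      using ob by (intro ten_mor_in_mhom J_facts diag_in_mhom)
    then have "(?J3' \<odot> ?J3) \<odot> ?J4 = ?J4"
      using ob finB by (simp add: J_facts mid_comp)
    then show ?thesis
      using gr by (simp add: mat_comp_assoc inv1)
  qed
  have J2': "?J2' \<in> mhom (ten ?X (T (ten ?y ?z))) (ten ?X (ten ?Y ?Z))"
    using ob by (intro ten_mor_in_mhom J_facts diag_in_mhom)
  have A'm: "?A' \<odot> ?J2' \<odot> ?J1' \<in> mhom (T ?r) (ten (ten ?X ?Y) ?Z)"
    by (rule mat_comp_in_mhom[OF masc_in_mhom mat_comp_in_mhom[OF J2' J_facts(2)]]) (use ob in simp_all)
  \<comment> \<open>The axiom speaks of \<open>J\<close>, whereas \<open>KL\<close> and
    \<open>KR\<close> contain \<open>J'\<close>. Inserting the identity \<open>inv2\<close> on the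
    right makes the axiom applicable, and \<open>inv3\<close> removes what is left over.\<close>
  have "?J4' \<odot> ?J3' \<odot> ?A = ?J4' \<odot> ?J3' \<odot> ?A \<odot> ?J1 \<odot> ?J2 \<odot> ?J2' \<odot> ?J1'"
    by (simp add: inv2 comp_mid[OF Am])
  also have "\<dots> = ?J4' \<odot> ?J3' \<odot> (?A \<odot> ?J1 \<odot> ?J2) \<odot> ?J2' \<odot> ?J1'"
    using gr by (simp add: mat_comp_assoc)
  also have "\<dots> = (?J4' \<odot> ?J3' \<odot> ?J3 \<odot> ?J4) \<odot> ?A' \<odot> ?J2' \<odot> ?J1'"
    unfolding hex using gr by (simp add: mat_comp_assoc)
  also have "\<dots> = ?A' \<odot> ?J2' \<odot> ?J1'"
    unfolding inv3 by (rule mid_comp[OF A'm]) (use ob finB in simp)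
  finally have main: "?J4' \<odot> ?J3' \<odot> ?A = ?A' \<odot> ?J2' \<odot> ?J1'" .
  have KL: "KL a b c = ?U3 \<odot> ?J4' \<odot> ?J3'"
  proof -
    have "?U3 \<odot> ?J4' = ten_mor B (K a b) (U c)"
      using gr by (simp add: ten_mor_comp K_def comp_mid[OF U_facts(1)])
    then show ?thesis
      using gr by (simp add: KL_def flip: mat_comp_assoc)
  qed
  have KR: "KR a b c = ten_mor B (U a) (ten_mor B (U b) (U c)) \<odot> ?J2' \<odot> ?J1'"
  proof -
    have "ten_mor B (U a) (ten_mor B (U b) (U c)) \<odot> ?J2' = ten_mor B (U a) (K b c)"
      using gr by (simp add: ten_mor_comp K_def comp_mid[OF U_facts(1)])
    then show ?thesis
      using gr by (simp add: KR_def flip: mat_comp_assoc)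
  qed
  have "KL a b c \<odot> ?A = ?U3 \<odot> ?J4' \<odot> ?J3' \<odot> ?A"
    using gr by (simp add: KL mat_comp_assoc)
  also have "\<dots> = (?U3 \<odot> ?A') \<odot> ?J2' \<odot> ?J1'"
    unfolding main using gr by (simp add: mat_comp_assoc)
  also have "?U3 \<odot> ?A' =
      masc B F' (s (\<rho> a)) (s (\<rho> b)) (s (\<rho> c)) \<odot> ten_mor B (U a) (ten_mor B (U b) (U c))"
    using assms finB by (intro masc_natural[symmetric] U_facts finite_ob) (simp_all add: \<rho>_mem)
  also have "\<dots> \<odot> ?J2' \<odot> ?J1' = masc B F' (s (\<rho> a)) (s (\<rho> b)) (s (\<rho> c)) \<odot> KR a b c"
    using gr by (simp add: KR mat_comp_assoc)
  finally show ?thesis .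
qed

text \<open>Naturality of \<open>J'\<close> splits the image of the tensor morphism into a tensor
  product of images, and \<open>covec_image\<close> then applies in the first factor.\<close>

lemma K_TM_covec:
  assumes \<gamma>: "(a, b, e) \<in> Gamma B" and c: "c \<in> B"
  shows "K e c \<odot> TM (ten (ten (s a) (s b)) (s c)) (ten (s e) (s c)) (ten_mor B (basis_covec a b e) (mid (s c))) =
    scl (covec_scalar (a, b, e)) (ten_mor B (basis_covec (\<rho> a) (\<rho> b) (\<rho> e)) (mid (s (\<rho> c))) \<odot> KL a b c)"
proof -
  note mem = \<gamma>_mem[OF \<gamma>] c
  let ?p = "TM (ten (s a) (s b)) (s e) (basis_covec a b e)"
  have gr: "graded ?p"
    using \<gamma> mem by (simp add: basis_in_mhom)
  have "K e c \<odot> TM (ten (ten (s a) (s b)) (s c)) (ten (s e) (s c)) (ten_mor B (basis_covec a b e) (mid (s c))) =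
      ten_mor B (U e) (U c) \<odot> ten_mor B ?p (TM (s c) (s c) (mid (s c))) \<odot> J' (ten (s a) (s b)) (s c)"
    using \<gamma> mem
    by (simp add: K_def mat_comp_assoc J'_natural basis_in_mhom diag_in_mhom ten_mor_in_mhom)
  also have "\<dots> = (ten_mor B (U e) (U c) \<odot> ten_mor B ?p (mid (T (s c)))) \<odot> J' (ten (s a) (s b)) (s c)"
    using mem gr by (simp add: mat_comp_assoc TM_mid)
  also have "ten_mor B (U e) (U c) \<odot> ten_mor B ?p (mid (T (s c))) =
      ten_mor B (scl (covec_scalar (a, b, e)) (basis_covec (\<rho> a) (\<rho> b) (\<rho> e) \<odot> K a b)) (mid (s (\<rho> c)) \<odot> U c)"
    using mem gr
    by (simp add: ten_mor_comp covec_image[OF \<gamma>] comp_mid[OF U_facts(1)] mid_comp[OF U_facts(1)] \<rho>_mem)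
  also have "\<dots> = scl (covec_scalar (a, b, e))
      (ten_mor B (basis_covec (\<rho> a) (\<rho> b) (\<rho> e)) (mid (s (\<rho> c))) \<odot> ten_mor B (K a b) (U c))"
    using mem by (simp add: ten_mor_scl ten_mor_comp)
  finally show ?thesis
    using mem by (simp add: scl_comp mat_comp_assoc KL_def)
qed

lemma KR_TM_vec:
  assumes \<gamma>: "(b, c, f) \<in> Gamma B" and a: "a \<in> B"
  shows "KR a b c \<odot> TM (ten (s a) (s f)) (ten (s a) (ten (s b) (s c))) (ten_mor B (mid (s a)) (basis_vec b c f)) =
    scl (vec_scalar (b, c, f)) (ten_mor B (mid (s (\<rho> a))) (basis_vec (\<rho> b) (\<rho> c) (\<rho> f)) \<odot> K a f)"
proof -
  note mem = \<gamma>_mem[OF \<gamma>] a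
  let ?e = "TM (s f) (ten (s b) (s c)) (basis_vec b c f)"
  have gr: "graded ?e"
    using \<gamma> mem by (simp add: basis_in_mhom)
  have "KR a b c \<odot> TM (ten (s a) (s f)) (ten (s a) (ten (s b) (s c))) (ten_mor B (mid (s a)) (basis_vec b c f)) =
      ten_mor B (U a) (K b c) \<odot> ten_mor B (TM (s a) (s a) (mid (s a))) ?e \<odot> J' (s a) (s f)"
    using \<gamma> mem
    by (simp add: KR_def mat_comp_assoc J'_natural basis_in_mhom diag_in_mhom ten_mor_in_mhom)
  also have "\<dots> = (ten_mor B (U a) (K b c) \<odot> ten_mor B (mid (T (s a))) ?e) \<odot> J' (s a) (s f)"
    using mem gr by (simp add: mat_comp_assoc TM_mid)
  also have "ten_mor B (U a) (K b c) \<odot> ten_mor B (mid (T (s a))) ?e =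
      ten_mor B (mid (s (\<rho> a)) \<odot> U a) (scl (vec_scalar (b, c, f)) (basis_vec (\<rho> b) (\<rho> c) (\<rho> f) \<odot> U f))"
    using mem gr
    by (simp add: ten_mor_comp vec_image[OF \<gamma>] comp_mid[OF U_facts(1)] mid_comp[OF U_facts(1)] \<rho>_mem)
  also have "\<dots> = scl (vec_scalar (b, c, f))
      (ten_mor B (mid (s (\<rho> a))) (basis_vec (\<rho> b) (\<rho> c) (\<rho> f)) \<odot> ten_mor B (U a) (U f))"
    using mem by (simp add: ten_mor_scl ten_mor_comp)
  finally show ?thesis
    using mem by (simp add: scl_comp mat_comp_assoc K_def)
qed

text \<open>The value of \<open>F\<close> is the scalar of a five-fold composite from a simple
  object to itself. Each factor, pushed through the transport maps, becomes the corresponding factor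
  for \<open>F'\<close> times a scalar.\<close>

lemma F_image:
  assumes \<phi>: "(a, b, c, d, e, f) \<in> Phi B"
  shows "F (a, b, c, d, e, f) = covec_scalar (e, c, d) * covec_scalar (a, b, e) *
    vec_scalar (b, c, f) * vec_scalar (a, f, d) * F' (\<rho> a, \<rho> b, \<rho> c, \<rho> d, \<rho> e, \<rho> f)"
proof -
  have mem: "a \<in> B" "b \<in> B" "c \<in> B" "d \<in> B" "e \<in> B" "f \<in> B"
    and \<gamma>: "(a, b, e) \<in> Gamma B" "(e, c, d) \<in> Gamma B" "(b, c, f) \<in> Gamma B" "(a, f, d) \<in> Gamma B"
    using \<phi> by (auto simp: mem_Phi Gamma_def)
  have \<phi>': "(\<rho> a, \<rho> b, \<rho> c, \<rho> d, \<rho> e, \<rho> f) \<in> Phi B"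
    using \<gamma>[THEN Gamma_image] by (auto simp: mem_Phi Gamma_def)
  let ?l = "ten (ten (s a) (s b)) (s c)" and ?r = "ten (s a) (ten (s b) (s c))"
  let ?m1 = "basis_covec e c d :: ('r, 'k) tmat" and ?m2 = "ten_mor B (basis_covec a b e) (mid (s c)) :: ('r, 'k) tmat"
  let ?m3 = "masc B F (s a) (s b) (s c)"
  let ?m4 = "ten_mor B (mid (s a)) (basis_vec b c f) :: ('r, 'k) tmat" and ?m5 = "basis_vec a f d :: ('r, 'k) tmat"
  let ?n1 = "basis_covec (\<rho> e) (\<rho> c) (\<rho> d)"
  let ?n2 = "ten_mor B (basis_covec (\<rho> a) (\<rho> b) (\<rho> e)) (mid (s (\<rho> c)))"
  let ?n3 = "masc B F' (s (\<rho> a)) (s (\<rho> b)) (s (\<rho> c))"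
  let ?n4 = "ten_mor B (mid (s (\<rho> a))) (basis_vec (\<rho> b) (\<rho> c) (\<rho> f))" and ?n5 = "basis_vec (\<rho> a) (\<rho> f) (\<rho> d)"
  have m: "?m1 \<in> mhom (ten (s e) (s c)) (s d)" "?m2 \<in> mhom ?l (ten (s e) (s c))" "?m3 \<in> mhom ?r ?l"
    "?m4 \<in> mhom (ten (s a) (s f)) ?r" "?m5 \<in> mhom (s d) (ten (s a) (s f))"
    using \<gamma> by (auto intro!: ten_mor_in_mhom masc_in_mhom diag_in_mhom basis_in_mhom)
  define M1 where "M1 = TM (ten (s e) (s c)) (s d) ?m1"
  define M2 where "M2 = TM ?l (ten (s e) (s c)) ?m2"
  define M3 where "M3 = TM ?r ?l ?m3"
  define M4 where "M4 = TM (ten (s a) (s f)) ?r ?m4"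
  define M5 where "M5 = TM (s d) (ten (s a) (s f)) ?m5"
  have gM: "graded M1" "graded M2" "graded M3" "graded M4" "graded M5"
    unfolding M1_def M2_def M3_def M4_def M5_def using mem m by simp_all
  have gn3: "graded ?n3"
    by (rule graded_mhom[OF masc_in_mhom]) (use mem finB in \<open>simp add: \<rho>_mem\<close>)
  have gK: "graded (KL a b c)" "graded (KR a b c)"
    using mem by (simp_all add: KL_def KR_def)
  note gr = gM gn3 gK mem
  have "TM (s d) (s d) (?m1 \<odot> ?m2 \<odot> ?m3 \<odot> ?m4 \<odot> ?m5) = M1 \<odot> M2 \<odot> M3 \<odot> M4 \<odot> M5"
  proof -
    have m45: "?m4 \<odot> ?m5 \<in> mhom (s d) ?r"
      by (rule mat_comp_in_mhom[OF m(4,5)])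
    have m345: "?m3 \<odot> ?m4 \<odot> ?m5 \<in> mhom (s d) ?l"
      by (rule mat_comp_in_mhom[OF m(3) m45])
    have m2345: "?m2 \<odot> ?m3 \<odot> ?m4 \<odot> ?m5 \<in> mhom (s d) (ten (s e) (s c))"
      by (rule mat_comp_in_mhom[OF m(2) m345])
    show ?thesis
      unfolding M1_def M2_def M3_def M4_def M5_def using mem m m45 m345 m2345
      by (simp add: TM_comp[of _ "ten (s e) (s c)"] TM_comp[of _ ?l] TM_comp[of _ ?r]
          TM_comp[of _ "ten (s a) (s f)"])
  qed
  also have "?m1 \<odot> ?m2 \<odot> ?m3 \<odot> ?m4 \<odot> ?m5 = scl (F (a, b, c, d, e, f)) (mid (s d))"
    by (rule masc_basis_entry[OF \<phi> finB])
  finally have TF: "scl (F (a, b, c, d, e, f)) (mid (T (s d))) = M1 \<odot> M2 \<odot> M3 \<odot> M4 \<odot> M5"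
    using mem by (simp add: TM_scl diag_in_mhom TM_mid)
  let ?k1 = "covec_scalar (e, c, d)" and ?k2 = "covec_scalar (a, b, e)"
  let ?k4 = "vec_scalar (b, c, f)" and ?k5 = "vec_scalar (a, f, d)"
  \<comment> \<open>The transport map travels from left to right, changing from \<open>U d\<close>
    to \<open>K e c\<close>, \<open>KL a b c\<close>, \<open>KR a b c\<close>, \<open>K a f\<close>
    and back to \<open>U d\<close>; the associator alone contributes no scalar.\<close>
  have "U d \<odot> M1 \<odot> M2 \<odot> M3 \<odot> M4 \<odot> M5 = scl ?k1 (?n1 \<odot> K e c \<odot> M2 \<odot> M3 \<odot> M4 \<odot> M5)"
    using covec_image[OF \<gamma>(2)] gr unfolding M1_def[symmetric] by (intro comp_step) simp_all
  also have "K e c \<odot> M2 \<odot> M3 \<odot> M4 \<odot> M5 = scl ?k2 (?n2 \<odot> KL a b c \<odot> M3 \<odot> M4 \<odot> M5)"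
    using K_TM_covec[OF \<gamma>(1) mem(3)] gr unfolding M2_def[symmetric] by (intro comp_step) simp_all
  also have "KL a b c \<odot> M3 \<odot> M4 \<odot> M5 = scl 1 (?n3 \<odot> KR a b c \<odot> M4 \<odot> M5)"
    using hexagon[OF mem(1-3)] gr unfolding M3_def[symmetric] by (intro comp_step) simp_all
  also have "KR a b c \<odot> M4 \<odot> M5 = scl ?k4 (?n4 \<odot> K a f \<odot> M5)"
    using KR_TM_vec[OF \<gamma>(3) mem(1)] gr unfolding M4_def[symmetric] by (intro comp_step) simp_all
  also have "K a f \<odot> M5 = scl ?k5 (?n5 \<odot> U d)"
    using vec_image[OF \<gamma>(4)] unfolding M5_def .
  also have "scl ?k1 (?n1 \<odot> scl ?k2 (?n2 \<odot> scl 1 (?n3 \<odot> scl ?k4 (?n4 \<odot> scl ?k5 (?n5 \<odot> U d))))) =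
      scl (?k1 * ?k2 * ?k4 * ?k5) ((?n1 \<odot> ?n2 \<odot> ?n3 \<odot> ?n4 \<odot> ?n5) \<odot> U d)"
    using gr by (simp add: comp_scl scl_scl mat_comp_assoc mult.assoc)
  also have "?n1 \<odot> ?n2 \<odot> ?n3 \<odot> ?n4 \<odot> ?n5 = scl (F' (\<rho> a, \<rho> b, \<rho> c, \<rho> d, \<rho> e, \<rho> f)) (mid (s (\<rho> d)))"
    by (rule masc_basis_entry[OF \<phi>' finB])
  finally have "U d \<odot> scl (F (a, b, c, d, e, f)) (mid (T (s d))) =
      scl (?k1 * ?k2 * ?k4 * ?k5 * F' (\<rho> a, \<rho> b, \<rho> c, \<rho> d, \<rho> e, \<rho> f)) (U d)"
    using mem mid_comp[OF U_facts(1)[of d]] by (simp add: TF scl_comp scl_scl \<rho>_mem)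
  then have "scl (F (a, b, c, d, e, f)) (U d) =
      scl (?k1 * ?k2 * ?k4 * ?k5 * F' (\<rho> a, \<rho> b, \<rho> c, \<rho> d, \<rho> e, \<rho> f)) (U d)"
    using mem by (simp add: comp_scl comp_mid[OF U_facts(1)])
  \<comment> \<open>Cancelling \<open>U d\<close> leaves multiples of the identity of a simple
    object, where scalars can be compared.\<close>
  then have "scl (F (a, b, c, d, e, f)) (U d \<odot> U' d) =
      scl (?k1 * ?k2 * ?k4 * ?k5 * F' (\<rho> a, \<rho> b, \<rho> c, \<rho> d, \<rho> e, \<rho> f)) (U d \<odot> U' d)"
    by (metis scl_comp)
  then show ?thesis
    using mem by (simp add: U_facts mid_simple_eq_scl_iff)
qed

lemma gauge_equivalent_image:
  "\<exists>g. gauge_equivalent B g F (F' \<circ> act_phi \<rho>)"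
proof -
  \<comment> \<open>The scalars are controlled on \<open>Gamma B\<close> only; 1 elsewhere keeps
    \<open>g\<close> nowhere zero.\<close>
  define g where "g \<gamma> = (if \<gamma> \<in> Gamma B then vec_scalar \<gamma> else 1)" for \<gamma>
  have g0: "g \<gamma> \<noteq> 0" for \<gamma>
    by (cases \<gamma>) (simp add: g_def vec_scalar_nonzero)
  moreover have "g (b, c, f) * g (a, f, d) * F' (\<rho> a, \<rho> b, \<rho> c, \<rho> d, \<rho> e, \<rho> f) =
      g (a, b, e) * g (e, c, d) * F (a, b, c, d, e, f)"
    if \<phi>: "(a, b, c, d, e, f) \<in> Phi B" for a b c d e f
  proof -
    have \<gamma>: "(a, b, e) \<in> Gamma B" "(e, c, d) \<in> Gamma B" "(b, c, f) \<in> Gamma B" "(a, f, d) \<in> Gamma B"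
      using \<phi> by (auto simp: mem_Phi Gamma_def)
    have "vec_scalar (a, b, e) * vec_scalar (e, c, d) * F (a, b, c, d, e, f) =
        (covec_scalar (a, b, e) * vec_scalar (a, b, e)) * (covec_scalar (e, c, d) * vec_scalar (e, c, d)) *
        (vec_scalar (b, c, f) * vec_scalar (a, f, d) * F' (\<rho> a, \<rho> b, \<rho> c, \<rho> d, \<rho> e, \<rho> f))"
      unfolding F_image[OF \<phi>] by (simp only: mult_ac)
    then show ?thesis
      using \<gamma> by (simp add: g_def covec_vec_scalar)
  qed
  ultimately show ?thesis
    by (auto simp: gauge_equivalent_def)
qed

end

section \<open>Equivalences permute the simple objects\<close>

lemma comp_0: "v \<odot> (\<lambda>_ _. 0) = (\<lambda>_ _. 0)"
  by (simp add: mat_comp_def)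

lemma mid_nonzero: "p \<in> P \<Longrightarrow> mid P \<noteq> (\<lambda>_ _. 0 :: 'k::field)"
  by (auto simp: diag_def fun_eq_iff)

locale fus_cat_equivalence =
  fixes B :: "'r::ring_1 set" and F F' :: "'r phi \<Rightarrow> 'k::field"
    and T S :: "'r tree set \<Rightarrow> 'r tree set"
    and TM SM :: "'r tree set \<Rightarrow> 'r tree set \<Rightarrow> ('r, 'k) tmat \<Rightarrow> ('r, 'k) tmat"
    and \<eta> \<epsilon> :: "'r tree set \<Rightarrow> ('r, 'k) tmat"
  assumes lin_T: "linear_functor (fus_cat B F) (fus_cat B F') T TM"
    and lin_S: "linear_functor (fus_cat B F') (fus_cat B F) S SM"
    and nat_\<eta>: "natural_iso (fus_cat B F) (fus_cat B F) (\<lambda>x. x) (\<lambda>x y u. u)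
      (\<lambda>x. S (T x)) (\<lambda>x y u. SM (T x) (T y) (TM x y u)) \<eta>"
    and nat_\<epsilon>: "natural_iso (fus_cat B F') (fus_cat B F') (\<lambda>x. T (S x))
      (\<lambda>x y u. TM (S x) (S y) (SM x y u)) (\<lambda>x. x) (\<lambda>x y u. u) \<epsilon>"
begin

abbreviation "ob \<equiv> is_obj B"

lemma T_simps:
  "ob P \<Longrightarrow> ob (T P)" "ob P \<Longrightarrow> TM P P (mid P) = mid (T P)"
  "ob P \<Longrightarrow> ob Q \<Longrightarrow> u \<in> mhom P Q \<Longrightarrow> TM P Q u \<in> mhom (T P) (T Q)"
  "ob P \<Longrightarrow> ob Q \<Longrightarrow> u \<in> mhom P Q \<Longrightarrow> TM P Q (scl k u) = scl k (TM P Q u)"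
  using lin_T by (simp_all add: linear_functor_def is_obj_def)

lemma S_simps:
  "ob P \<Longrightarrow> ob (S P)" "ob P \<Longrightarrow> SM P P (mid P) = mid (S P)"
  "ob P \<Longrightarrow> ob Q \<Longrightarrow> u \<in> mhom P Q \<Longrightarrow> SM P Q u \<in> mhom (S P) (S Q)"
  "ob P \<Longrightarrow> ob Q \<Longrightarrow> u \<in> mhom P Q \<Longrightarrow> SM P Q (scl k u) = scl k (SM P Q u)"
  "ob P \<Longrightarrow> ob Q \<Longrightarrow> ob R \<Longrightarrow> u \<in> mhom P Q \<Longrightarrow> v \<in> mhom Q R \<Longrightarrow> SM P R (v \<odot> u) = SM Q R v \<odot> SM P Q u"
  using lin_S by (simp_all add: linear_functor_def is_obj_def)

lemma \<eta>_inverse: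
  assumes "ob P"
  obtains v where "\<eta> P \<in> mhom P (S (T P))" "v \<in> mhom (S (T P)) P"
    "v \<odot> \<eta> P = mid P" "\<eta> P \<odot> v = mid (S (T P))" "graded (\<eta> P)" "graded v"
proof -
  have "is_iso (fus_cat B F) P (S (T P)) (\<eta> P)"
    using nat_\<eta> assms by (simp add: natural_iso_def is_obj_def)
  moreover have "finite P" "finite (S (T P))"
    using assms T_simps(1) S_simps(1) is_obj_finite by blast+
  ultimately show ?thesis
    using that by (auto simp: is_iso_def intro: graded_mhom)
qed

text \<open>By naturality \<open>\<eta> Q \<odot> u\<close> is determined by the image of
  \<open>u\<close>, and \<open>\<eta> Q\<close> can be cancelled on the left.\<close>

lemma TM_faithful:
  assumes ob: "ob P" "ob Q" and u: "u \<in> mhom P Q" and u': "u' \<in> mhom P Q" and eq: "TM P Q u = TM P Q u'"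
  shows "u = u'"
proof -
  obtain v where v: "v \<odot> \<eta> Q = mid Q" "graded (\<eta> Q)" "graded v"
    by (rule \<eta>_inverse[OF ob(2)])
  have "\<eta> Q \<odot> w = SM (T P) (T Q) (TM P Q w) \<odot> \<eta> P" if "w \<in> mhom P Q" for w
    using nat_\<eta> ob that by (simp add: natural_iso_def is_obj_def)
  then have "v \<odot> \<eta> Q \<odot> u = v \<odot> \<eta> Q \<odot> u'"
    using u u' eq by simp
  moreover have "v \<odot> \<eta> Q \<odot> w = w" if "w \<in> mhom P Q" for w
    using that v ob graded_mhom[OF that] is_obj_finite[of B Q]
    by (simp add: mid_comp flip: mat_comp_assoc)
  ultimately show ?thesis
    using u u' by simp
qed

lemma SM_faithful:
  assumes ob: "ob P" "ob Q" and u: "u \<in> mhom P Q" and u': "u' \<in> mhom P Q" and eq: "SM P Q u = SM P Q u'"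
  shows "u = u'"
proof -
  have iso: "is_iso (fus_cat B F') (T (S P)) P (\<epsilon> P)"
    using nat_\<epsilon> ob by (simp add: natural_iso_def is_obj_def)
  then obtain v where v: "v \<in> mhom P (T (S P))" "\<epsilon> P \<odot> v = mid P" "\<epsilon> P \<in> mhom (T (S P)) P"
    by (auto simp: is_iso_def)
  have gr: "graded v" "graded (\<epsilon> P)"
    using graded_mhom[OF v(1)] graded_mhom[OF v(3)] ob T_simps(1) S_simps(1) is_obj_finite by blast+
  have "\<epsilon> Q \<odot> TM (S P) (S Q) (SM P Q w) = w \<odot> \<epsilon> P" if "w \<in> mhom P Q" for w
    using nat_\<epsilon> ob that by (simp add: natural_iso_def is_obj_def)
  from this[OF u] this[OF u'] have "u \<odot> \<epsilon> P = u' \<odot> \<epsilon> P"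
    using eq by simp
  then have "(u \<odot> \<epsilon> P) \<odot> v = (u' \<odot> \<epsilon> P) \<odot> v"
    by simp
  then show ?thesis
    using gr v by (simp add: mat_comp_assoc comp_mid[OF u] comp_mid[OF u'])
qed

text \<open>Conjugating the image of \<open>v\<close> under \<open>S\<close> by
  \<open>\<eta>\<close> gives an endomorphism of the simple object, a matrix with one entry. Undoing
  the conjugation keeps the scalar, and faithfulness of \<open>S\<close> brings it back to
  \<open>v\<close> without an appeal to fullness of \<open>T\<close>.\<close>

lemma endo_scalar:
  fixes v :: "('r, 'k) tmat"
  assumes b: "b \<in> B" and v: "v \<in> mhom (T (simple_obj b)) (T (simple_obj b))"
  shows "\<exists>k. v = scl k (mid (T (simple_obj b)))"
proof -
  let ?s = "simple_obj b"
  have ob: "ob ?s" "ob (T ?s)" "ob (S (T ?s))"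
    using b T_simps(1) S_simps(1) by simp_all
  let ?v = "SM (T ?s) (T ?s) v" and ?Q = "S (T ?s)"
  have vm: "?v \<in> mhom ?Q ?Q"
    using ob v by (simp add: S_simps)
  have gv: "graded ?v"
    by (rule graded_mhom[OF vm]) (use ob is_obj_finite in blast)
  obtain y where y: "\<eta> ?s \<in> mhom ?s ?Q" "y \<in> mhom ?Q ?s" "y \<odot> \<eta> ?s = mid ?s" "\<eta> ?s \<odot> y = mid ?Q"
    "graded (\<eta> ?s)" "graded y"
    by (rule \<eta>_inverse[OF ob(1)])
  define w where "w = y \<odot> ?v \<odot> \<eta> ?s"
  have w: "w \<in> mhom ?s ?s"
    unfolding w_def by (intro mat_comp_in_mhom[OF y(2)] mat_comp_in_mhom[OF vm] y)
  have "w q p = scl (w (Leaf 0 b) (Leaf 0 b)) (mid ?s) q p" for q p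
  proof (cases "w q p = 0")
    case False
    then have "q = Leaf 0 b" "p = Leaf 0 b"
      using w by (auto simp: mhom_def simple_obj_mem)
    then show ?thesis
      by (simp add: scl_def diag_def simple_obj_mem)
  qed (auto simp: scl_def diag_def simple_obj_mem)
  then obtain k where k: "w = scl k (mid ?s)"
    by blast
  have "\<eta> ?s \<odot> w \<odot> y = (\<eta> ?s \<odot> y) \<odot> ?v \<odot> (\<eta> ?s \<odot> y)"
    using y(5,6) gv by (simp add: w_def mat_comp_assoc)
  also have "\<dots> = ?v"
    by (simp add: y(4) mid_comp[OF vm is_obj_finite[OF ob(3)]] comp_mid[OF vm])
  finally have "?v = \<eta> ?s \<odot> w \<odot> y" ..
  also have "\<dots> = scl k (\<eta> ?s \<odot> mid ?s \<odot> y)"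
    using y by (simp add: k scl_comp comp_scl)
  also have "mid ?s \<odot> y = y"
    by (rule mid_comp[OF y(2)]) (simp add: simple_obj_def)
  finally have "?v = SM (T ?s) (T ?s) (scl k (mid (T ?s)))"
    using ob y by (simp add: S_simps diag_in_mhom)
  then show ?thesis
    using SM_faithful[OF ob(2,2) v] by (meson diag_in_mhom scl_in_mhom)
qed

text \<open>No summand would make identity and zero have equal images, against faithfulness; two
  summands would provide a diagonal matrix unit that is not scalar.\<close>

lemma T_simple:
  assumes b: "b \<in> B"
  shows "\<exists>p. col p \<in> B \<and> T (simple_obj b) = {p}"
proof -
  let ?s = "simple_obj b"
  have ob: "ob ?s" "ob (T ?s)"
    using b T_simps(1) by simp_all
  have "T ?s \<noteq> {}"
  proof
    assume empty: "T ?s = {}"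
    have "TM ?s ?s (scl 0 (mid ?s)) = TM ?s ?s (mid ?s)"
      using ob by (simp add: T_simps diag_in_mhom) (simp add: empty scl_def diag_def)
    then have "scl 0 (mid ?s) = (mid ?s :: ('r, 'k) tmat)"
      using TM_faithful[OF ob(1,1)] by (meson diag_in_mhom scl_in_mhom)
    then have "scl 0 (mid ?s) = scl 1 (mid ?s :: ('r, 'k) tmat)"
      by simp
    then show False
      unfolding mid_simple_eq_scl_iff by simp
  qed
  then obtain p where p: "p \<in> T ?s"
    by blast
  then obtain k where k: "munit p p = scl k (mid (T ?s) :: ('r, 'k) tmat)"
    using endo_scalar[OF b munit_in_mhom] by blast
  have "q = p" if "q \<in> T ?s" for q
    using fun_cong[OF fun_cong[OF k, of p], of p] fun_cong[OF fun_cong[OF k, of q], of q] p that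
    by (auto simp: munit_def scl_def diag_def split: if_splits)
  then have "T ?s = {p}"
    using p by blast
  then show ?thesis
    using ob p by (auto simp: is_obj_def)
qed

text \<open>A substitute for fullness: \<open>w\<close> and its left inverse are carried back by
  \<open>S\<close> and \<open>\<eta>\<close>, and the resulting morphism still has a left inverse.
  It is therefore non-zero as soon as \<open>P\<close> has a summand.\<close>

lemma nonzero_preimage:
  fixes w r :: "('r, 'k) tmat"
  assumes ob: "ob P" "ob Q" and P: "P \<noteq> {}" and w: "w \<in> mhom (T P) (T Q)" and r: "r \<in> mhom (T Q) (T P)"
    and rw: "r \<odot> w = mid (T P)"
  shows "\<exists>u\<in>mhom P Q. u \<noteq> (\<lambda>_ _. 0 :: 'k)"
proof -
  have obT: "ob (T P)" "ob (T Q)" "ob (S (T P))" "ob (S (T Q))"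
    using ob T_simps(1) S_simps(1) by simp_all
  let ?w = "SM (T P) (T Q) w" and ?r = "SM (T Q) (T P) r"
  have wr: "?w \<in> mhom (S (T P)) (S (T Q))" "?r \<in> mhom (S (T Q)) (S (T P))"
    using obT w r by (simp_all add: S_simps)
  have gr: "graded ?w" "graded ?r"
    using graded_mhom[OF wr(1)] graded_mhom[OF wr(2)] obT is_obj_finite by blast+
  obtain y where y: "\<eta> P \<in> mhom P (S (T P))" "y \<in> mhom (S (T P)) P"
    "y \<odot> \<eta> P = mid P" "\<eta> P \<odot> y = mid (S (T P))" "graded (\<eta> P)" "graded y"
    by (rule \<eta>_inverse[OF ob(1)])
  obtain z where z: "\<eta> Q \<in> mhom Q (S (T Q))" "z \<in> mhom (S (T Q)) Q"
    "z \<odot> \<eta> Q = mid Q" "\<eta> Q \<odot> z = mid (S (T Q))" "graded (\<eta> Q)" "graded z"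
    by (rule \<eta>_inverse[OF ob(2)])
  let ?u = "z \<odot> ?w \<odot> \<eta> P" and ?t = "y \<odot> ?r \<odot> \<eta> Q"
  have u: "?u \<in> mhom P Q"
    by (intro mat_comp_in_mhom[OF z(2)] mat_comp_in_mhom[OF wr(1)] y)
  have "?t \<odot> ?u = y \<odot> ?r \<odot> (\<eta> Q \<odot> z) \<odot> ?w \<odot> \<eta> P"
    using y(5,6) z(5,6) gr by (simp add: mat_comp_assoc)
  also have "(\<eta> Q \<odot> z) \<odot> ?w \<odot> \<eta> P = ?w \<odot> \<eta> P"
    unfolding z(4)
    by (rule mid_comp[OF mat_comp_in_mhom[OF wr(1) y(1)]]) (use obT is_obj_finite in blast)
  also have "?r \<odot> ?w \<odot> \<eta> P = SM (T P) (T P) (r \<odot> w) \<odot> \<eta> P"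
    using y gr obT w r by (simp add: mat_comp_assoc S_simps)
  also have "\<dots> = \<eta> P"
    using obT by (simp add: rw S_simps mid_comp[OF y(1) is_obj_finite[OF obT(3)]])
  finally have tu: "?t \<odot> ?u = mid P"
    using y by simp
  have "?u \<noteq> (\<lambda>_ _. 0)"
  proof
    assume "?u = (\<lambda>_ _. 0)"
    then have "mid P = (\<lambda>_ _. 0 :: 'k)"
      unfolding tu[symmetric] by (simp only: comp_0)
    then show False
      using P mid_nonzero by blast
  qed
  with u show ?thesis by blast
qed

end

section \<open>Split embeddings and structure constants\<close>

context monoidal_functor_on_simples
begin

lemma K_K':
  assumes "a \<in> B" "b \<in> B"
  shows "K a b \<odot> K' a b = mid (ten (s (\<rho> a)) (s (\<rho> b)))"
proof -
  have "K a b \<odot> K' a b = ten_mor B (U a) (U b) \<odot> (J' (s a) (s b) \<odot> J (s a) (s b)) \<odot> ten_mor B (U' a) (U' b)"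
    using assms by (simp add: K_def K'_def mat_comp_assoc)
  also have "\<dots> = ten_mor B (U a) (U b) \<odot> mid (ten (T (s a)) (T (s b))) \<odot> ten_mor B (U' a) (U' b)"
    using assms by (simp add: J_facts)
  also have "mid (ten (T (s a)) (T (s b))) \<odot> ten_mor B (U' a) (U' b) = ten_mor B (U' a) (U' b)"
    using assms finB by (intro mid_comp[OF ten_mor_in_mhom[OF U_facts(2) U_facts(2)]]) auto
  finally show ?thesis
    using assms by (simp add: ten_mor_comp U_facts ten_mor_mid)
qed

text \<open>The inclusion and projection of the summand \<open>\<rho> c\<close>, conjugated back to
  the image of the functor. This supplies the input of \<open>nonzero_preimage\<close>, by which
  structure constants are reflected.\<close>

lemma split_image:
  assumes mem: "a \<in> B" "b \<in> B" "c \<in> B" and \<gamma>': "(\<rho> a, \<rho> b, \<rho> c) \<in> Gamma B"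
  shows "\<exists>w\<in>mhom (T (s c)) (T (ten (s a) (s b))) :: ('r, 'k) tmat set. \<exists>r\<in>mhom (T (ten (s a) (s b))) (T (s c)).
    r \<odot> w = mid (T (s c))"
proof -
  let ?e = "basis_vec (\<rho> a) (\<rho> b) (\<rho> c) :: ('r, 'k) tmat" and ?p = "basis_covec (\<rho> a) (\<rho> b) (\<rho> c) :: ('r, 'k) tmat"
  let ?w = "K' a b \<odot> ?e \<odot> U c" and ?r = "U' c \<odot> ?p \<odot> K a b"
  have eU: "?e \<odot> U c \<in> mhom (T (s c)) (ten (s (\<rho> a)) (s (\<rho> b)))"
    by (rule mat_comp_in_mhom[OF basis_in_mhom(1)[OF \<gamma>'] U_facts(1)[OF mem(3)]])
  have w: "?w \<in> mhom (T (s c)) (T (ten (s a) (s b)))"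
    by (rule mat_comp_in_mhom[OF K_mhom(2)[OF mem(1,2)] eU])
  have r: "?r \<in> mhom (T (ten (s a) (s b))) (T (s c))"
    by (rule mat_comp_in_mhom[OF U_facts(2)[OF mem(3)]
          mat_comp_in_mhom[OF basis_in_mhom(2)[OF \<gamma>'] K_mhom(1)[OF mem(1,2)]]])
  have "?r \<odot> ?w = U' c \<odot> ?p \<odot> (K a b \<odot> K' a b) \<odot> ?e \<odot> U c"
    using mem by (simp add: mat_comp_assoc)
  also have "(K a b \<odot> K' a b) \<odot> ?e \<odot> U c = ?e \<odot> U c"
    unfolding K_K'[OF mem(1,2)]
    by (rule mid_comp[OF eU]) (use mem finB in \<open>simp add: simple_obj_def\<close>)
  also have "U' c \<odot> ?p \<odot> ?e \<odot> U c = U' c \<odot> (?p \<odot> ?e) \<odot> U c"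
    using mem by (simp add: mat_comp_assoc)
  also have "(?p \<odot> ?e) \<odot> U c = U c"
    unfolding covec_vec by (rule mid_comp[OF U_facts(1)[OF mem(3)]]) (simp add: simple_obj_def)
  finally have "?r \<odot> ?w = mid (T (s c))"
    using mem by (simp add: U_facts)
  with w r show ?thesis by blast
qed

end

text \<open>The permutation is read off from the colour of the single summand of each
  \<open>T (simple_obj b)\<close>.\<close>

lemma equivalence_permutes_simples:
  fixes F F' :: "'r::ring_1 phi \<Rightarrow> 'k::field"
  assumes B: "finite B" and mf: "multiplicity_free B"
    and eqv: "equivalence_functor (fus_cat B F) (fus_cat B F') T TM"
    and mon: "monoidal_structure (fus_cat B F) (fus_cat B F') T TM J \<iota>"
  shows "\<exists>\<sigma>\<in>based_aut B. \<forall>b\<in>B. \<exists>u. is_iso (fus_cat B F') (T (simple_obj b)) (simple_obj (\<sigma> b)) u"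
proof -
  obtain S SM \<eta> \<epsilon> where S: "linear_functor (fus_cat B F) (fus_cat B F') T TM"
    "linear_functor (fus_cat B F') (fus_cat B F) S SM"
    "natural_iso (fus_cat B F) (fus_cat B F) (\<lambda>x. x) (\<lambda>x y u. u)
      (\<lambda>x. S (T x)) (\<lambda>x y u. SM (T x) (T y) (TM x y u)) \<eta>"
    "natural_iso (fus_cat B F') (fus_cat B F') (\<lambda>x. T (S x))
      (\<lambda>x y u. TM (S x) (S y) (SM x y u)) (\<lambda>x. x) (\<lambda>x y u. u) \<epsilon>"
    using eqv unfolding equivalence_functor_def by blast
  interpret E: fus_cat_equivalence B F F' T S TM SM \<eta> \<epsilon>
    by unfold_locales (fact S)+
  obtain t where t: "\<And>b. b \<in> B \<Longrightarrow> col (t b) \<in> B \<and> T (simple_obj b) = {t b}"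
    using E.T_simple by metis
  define \<sigma> where "\<sigma> b = col (t b)" for b
  define U where "U b = (munit (Leaf 0 (\<sigma> b)) (t b) :: ('r, 'k) tmat)" for b
  have U: "is_iso (fus_cat B F') (T (simple_obj b)) (simple_obj (\<sigma> b)) (U b)" if "b \<in> B" for b
    unfolding is_iso_def fus_cat_sel
  proof (intro conjI bexI[of _ "munit (t b) (Leaf 0 (\<sigma> b))"])
    show "U b \<in> mhom (T (simple_obj b)) (simple_obj (\<sigma> b))"
      "munit (t b) (Leaf 0 (\<sigma> b)) \<in> mhom (simple_obj (\<sigma> b)) (T (simple_obj b))"
      using t[OF that] by (auto simp: U_def \<sigma>_def simple_obj_mem intro!: munit_in_mhom)
    show "munit (t b) (Leaf 0 (\<sigma> b)) \<odot> U b = mid (T (simple_obj b))"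
      "U b \<odot> munit (t b) (Leaf 0 (\<sigma> b)) = mid (simple_obj (\<sigma> b))"
      using t[OF that] unfolding U_def
      by (subst comp_munit; auto simp: \<sigma>_def munit_def diag_def simple_obj_mem fun_eq_iff)+
  qed
  interpret M: monoidal_functor_on_simples B F F' T TM J \<iota> \<sigma> U
    by unfold_locales (use B S(1) mon U t in \<open>auto simp: \<sigma>_def\<close>)
  have nonempty: "simple_obj b \<noteq> {}" for b :: 'r
    by (simp add: simple_obj_def)
  \<comment> \<open>Equal colours make the images isomorphic; pulled back, the isomorphism gives a
    non-zero morphism between the simple objects, whose labels must then agree.\<close>
  have "inj_on \<sigma> B"
  proof
    fix b b' assume b: "b \<in> B" "b' \<in> B" and eq: "\<sigma> b = \<sigma> b'"
    have w: "M.U' b' \<odot> U b \<in> mhom (T (simple_obj b)) (T (simple_obj b'))"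
      using M.U_facts(2)[OF b(2)] M.U_facts(1)[OF b(1)] eq mat_comp_in_mhom by metis
    have r: "M.U' b \<odot> U b' \<in> mhom (T (simple_obj b')) (T (simple_obj b))"
      using M.U_facts(2)[OF b(1)] M.U_facts(1)[OF b(2)] eq mat_comp_in_mhom by metis
    have "(M.U' b \<odot> U b') \<odot> (M.U' b' \<odot> U b) = M.U' b \<odot> (U b' \<odot> M.U' b') \<odot> U b"
      using b by (simp add: mat_comp_assoc)
    also have "(U b' \<odot> M.U' b') \<odot> U b = U b"
      unfolding M.U_facts(4)[OF b(2)] eq[symmetric]
      by (rule mid_comp[OF M.U_facts(1)[OF b(1)]]) (simp add: simple_obj_def)
    finally have "(M.U' b \<odot> U b') \<odot> (M.U' b' \<odot> U b) = mid (T (simple_obj b))"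
      using M.U_facts(3)[OF b(1)] by simp
    then obtain u where "u \<in> mhom (simple_obj b) (simple_obj b')" "u \<noteq> (\<lambda>_ _. 0 :: 'k)"
      using E.nonzero_preimage[OF _ _ nonempty w r] b by auto
    then show "b = b'"
      by (force simp: mhom_def simple_obj_mem fun_eq_iff)
  qed
  moreover have "\<sigma> ` B \<subseteq> B"
    using t by (auto simp: \<sigma>_def)
  ultimately have "bij_betw \<sigma> B B"
    using B by (simp add: bij_betw_def endo_inj_surj)
  moreover have "Nst B (\<sigma> a) (\<sigma> b) (\<sigma> c) = Nst B a b c" if mem: "a \<in> B" "b \<in> B" "c \<in> B" for a b c
  proof -
    have \<sigma>: "\<sigma> a \<in> B" "\<sigma> b \<in> B" "\<sigma> c \<in> B"
      using mem M.\<rho>_mem by blast+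
    have "(a, b, c) \<in> Gamma B" if \<gamma>: "(\<sigma> a, \<sigma> b, \<sigma> c) \<in> Gamma B"
    proof -
      obtain w r :: "('r, 'k) tmat"
        where wr: "w \<in> mhom (T (simple_obj c)) (T (ten_obj B (simple_obj a) (simple_obj b)))"
        "r \<in> mhom (T (ten_obj B (simple_obj a) (simple_obj b))) (T (simple_obj c))"
        "r \<odot> w = mid (T (simple_obj c))"
        using M.split_image[OF mem \<gamma>] by blast
      obtain u where u: "u \<in> mhom (simple_obj c) (ten_obj B (simple_obj a) (simple_obj b))"
        "u \<noteq> (\<lambda>_ _. 0 :: 'k)"
        using E.nonzero_preimage[OF _ _ nonempty wr] mem by auto
      then obtain q p where "u q p \<noteq> 0"
        by (auto simp: fun_eq_iff)
      then have "q \<in> ten_obj B (simple_obj a) (simple_obj b)" "col q = c"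
        using u(1) by (force simp: mhom_def simple_obj_mem)+
      then show ?thesis
        using mem by (cases q) (auto simp: Gamma_def simple_obj_mem)
    qed
    \<comment> \<open>Images of basis vectors give one implication, pulled-back split embeddings the
      other. Non-vanishing determines the constants because they are 0 or 1.\<close>
    then have "Nst B (\<sigma> a) (\<sigma> b) (\<sigma> c) \<noteq> 0 \<longleftrightarrow> Nst B a b c \<noteq> 0"
      using M.Gamma_image[of a b c] mem \<sigma> by (auto simp: Gamma_def)
    moreover have "Nst B (\<sigma> a) (\<sigma> b) (\<sigma> c) \<in> {0, 1}" "Nst B a b c \<in> {0, 1}"
      using mf mem \<sigma> unfolding multiplicity_free_def by blast+
    ultimately show ?thesis by auto
  qed
  ultimately have "\<sigma> \<in> based_aut B"
    by (simp add: based_aut_def)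
  with U show ?thesis by blast
qed

section \<open>Classification by invariant monomials\<close>

lemma gauge_of_monoidally_equivalent_along:
  assumes B: "finite B" and \<rho>: "\<rho> \<in> based_aut B"
    and eqv: "monoidally_equivalent_along B simple_obj simple_obj \<rho> (fus_cat B F) (fus_cat B F')"
  shows "\<exists>g. gauge_equivalent B g F (F' \<circ> act_phi \<rho>)"
proof -
  obtain T TM J \<iota> where T: "equivalence_functor (fus_cat B F) (fus_cat B F') T TM"
    "monoidal_structure (fus_cat B F) (fus_cat B F') T TM J \<iota>"
    "\<forall>b\<in>B. \<exists>u. is_iso (fus_cat B F') (T (simple_obj b)) (simple_obj (\<rho> b)) u"
    using eqv unfolding monoidally_equivalent_along_def by blast
  obtain U where U: "\<And>b. b \<in> B \<Longrightarrow> is_iso (fus_cat B F') (T (simple_obj b)) (simple_obj (\<rho> b)) (U b)"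
    using T(3) by metis
  interpret monoidal_functor_on_simples B F F' T TM J \<iota> \<rho> U
    by unfold_locales (use B T U based_aut_mem[OF \<rho>] in \<open>auto simp: equivalence_functor_def\<close>)
  show ?thesis
    by (rule gauge_equivalent_image)
qed

lemma eval_of_gauge:
  assumes \<rho>: "\<rho> \<in> based_aut B" and g: "gauge_equivalent B g F (F' \<circ> act_phi \<rho>)" and m: "m \<in> inv_monomials B"
  shows "eval_monomial F m = eval_monomial F' (act_monomial \<rho> m)"
  using eval_gauge_equivalent[OF g m] eval_act_monomial[OF \<rho>, of m F'] m unfolding inv_monomials_iff by simp

lemma monoidally_equivalent_along_of_eval:
  fixes F F' :: "'r::ring_1 phi \<Rightarrow> 'k::alg_closed_field"
  assumes R: "unital_based_ring B star" and F: "F \<in> Xvar B star" and F': "F' \<in> Xvar B star"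
    and \<rho>: "\<rho> \<in> based_aut B" and zeros: "act_phi \<rho> ` zeros B F = zeros B F'"
    and \<B>: "\<B> \<subseteq> inv_monomials B"
    and determined: "\<forall>F1\<in>Xvar B star. \<forall>F2\<in>Xvar B star. zeros B F1 = zeros B F \<and> zeros B F2 = zeros B F \<and>
           (\<forall>m\<in>\<B>. eval_monomial (F1 :: 'r phi \<Rightarrow> 'k) m = eval_monomial (F2 :: 'r phi \<Rightarrow> 'k) m) \<longrightarrow>
           (\<forall>m\<in>inv_monomials B. eval_monomial F1 m = eval_monomial F2 m)"
    and eval: "\<forall>m\<in>\<B>. eval_monomial F m = eval_monomial F' (act_monomial \<rho> m)"
  shows "monoidally_equivalent_along B simple_obj simple_obj \<rho> (fus_cat B F) (fus_cat B F')"
proof -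
  \<comment> \<open>Restricted to \<open>Phi B\<close>, the pulled-back point belongs to
    \<open>Xvar\<close>, so the determination hypothesis can compare it with
    \<open>F\<close>.\<close>
  define G where "G = restrict (F' \<circ> act_phi \<rho>) (Phi B)"
  have G: "G \<in> Xvar B star"
    unfolding G_def by (rule pullback_in_Xvar[OF R \<rho> F'])
  have zG: "zeros B G = zeros B F"
    unfolding G_def zeros_pullback[OF \<rho>] by (rule zeros)
  have "eval_monomial F m = eval_monomial G m" if "m \<in> \<B>" for m
  proof -
    have keys: "Poly_Mapping.keys m \<subseteq> Phi B"
      using \<B> that inv_monomials_iff by blast
    have "eval_monomial F m = eval_monomial (F' \<circ> act_phi \<rho>) m"
      using eval that eval_act_monomial[OF \<rho> keys] by simp
    also have "\<dots> = eval_monomial G m"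
      by (rule eval_monomial_cong) (simp add: G_def subsetD[OF keys])
    finally show ?thesis .
  qed
  then have "eval_monomial F m = eval_monomial G m" if "m \<in> inv_monomials B" for m
    using zG that by (intro determined[rule_format, OF F G]) simp_all
  moreover have "finite B"
    using R by (simp add: unital_based_ring_def finite_int_basis_def)
  ultimately obtain g where "gauge_equivalent B g F G"
    using gauge_equivalent_exists zG by metis
  then have "gauge_equivalent B g F (F' \<circ> act_phi \<rho>)"
    by (auto simp: gauge_equivalent_def G_def)
  then show ?thesis
    by (rule monoidally_equivalent_along_gauge[OF R \<rho> F F'])
qed

text \<open>An equivalence brings its own permutation of the simple objects, which may differ from
  the given \<open>\<rho>\<close>; hence one criterion for equivalences along \<open>\<rho>\<close>
  and one that quantifies over permutations matching the zero sets.\<close>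

theorem corollary1p4:
  fixes B :: "'r::ring_1 set" and star :: "'r \<Rightarrow> 'r"
    and F F' :: "'r phi \<Rightarrow> 'k::{alg_closed_field, field_char_0}"
    and \<rho> :: "'r \<Rightarrow> 'r" and \<B> :: "('r phi \<Rightarrow>\<^sub>0 int) set"
  assumes "unital_based_ring B star" and "multiplicity_free B"
    and "F \<in> Xvar B star" and "F' \<in> Xvar B star"
    and "\<rho> \<in> based_aut B" and "act_phi \<rho> ` zeros B F = zeros B F'"
    and "finite \<B>" and "\<B> \<subseteq> inv_monomials B"
    and "\<forall>F''\<in>Xvar B star. zeros B F'' = zeros B F \<longrightarrow>
           (\<forall>m\<in>\<B>. \<exists>v. eval_monomial (F'' :: 'r phi \<Rightarrow> 'k) m = Some v \<and> v \<noteq> 0)"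
    and "\<forall>F1\<in>Xvar B star. \<forall>F2\<in>Xvar B star. zeros B F1 = zeros B F \<and> zeros B F2 = zeros B F \<and>
           (\<forall>m\<in>\<B>. eval_monomial (F1 :: 'r phi \<Rightarrow> 'k) m = eval_monomial (F2 :: 'r phi \<Rightarrow> 'k) m) \<longrightarrow>
           (\<forall>m\<in>inv_monomials B. eval_monomial F1 m = eval_monomial F2 m)"
  shows "(monoidally_equivalent_along B simple_obj simple_obj \<rho> (fus_cat B F) (fus_cat B F') \<longleftrightarrow>
            (\<forall>m\<in>\<B>. eval_monomial F m = eval_monomial F' (act_monomial \<rho> m))) \<and>
         (monoidally_equivalent (fus_cat B F) (fus_cat B F') \<longleftrightarrow>
            (\<exists>\<sigma>\<in>based_aut B. act_phi \<sigma> ` zeros B F = zeros B F' \<and>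
               (\<forall>m\<in>\<B>. eval_monomial F m = eval_monomial F' (act_monomial \<sigma> m))))"
proof -
  have B: "finite B"
    using assms(1) by (simp add: unital_based_ring_def finite_int_basis_def)
  \<comment> \<open>Proved for an arbitrary \<open>\<sigma>\<close>, to be used both for
    \<open>\<rho>\<close> and for the permutation extracted from an equivalence. For the latter the
    matching of zero sets is a consequence, since gauge factors never vanish.\<close>
  have along: "\<forall>m\<in>\<B>. eval_monomial F m = eval_monomial F' (act_monomial \<sigma> m)"
    and along_zeros: "act_phi \<sigma> ` zeros B F = zeros B F'"
    if \<sigma>: "\<sigma> \<in> based_aut B"
      and eqv: "monoidally_equivalent_along B simple_obj simple_obj \<sigma> (fus_cat B F) (fus_cat B F')" for \<sigma>
  proof -
    obtain g where g: "gauge_equivalent B g F (F' \<circ> act_phi \<sigma>)"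
      using gauge_of_monoidally_equivalent_along[OF B \<sigma> eqv] by blast
    show "\<forall>m\<in>\<B>. eval_monomial F m = eval_monomial F' (act_monomial \<sigma> m)"
      using eval_of_gauge[OF \<sigma> g] assms(8) by blast
    have "zeros B (restrict (F' \<circ> act_phi \<sigma>) (Phi B)) = zeros B F"
      using zeros_gauge_equivalent[OF g] by (auto simp: zeros_def)
    then show "act_phi \<sigma> ` zeros B F = zeros B F'"
      by (simp only: zeros_pullback[OF \<sigma>])
  qed
  note converse = monoidally_equivalent_along_of_eval[OF assms(1,3,4) _ _ assms(8,10)]
  show ?thesis
  proof (intro conjI iffI)
    show "\<forall>m\<in>\<B>. eval_monomial F m = eval_monomial F' (act_monomial \<rho> m)"
      if "monoidally_equivalent_along B simple_obj simple_obj \<rho> (fus_cat B F) (fus_cat B F')"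
      by (rule along[OF assms(5) that])
    show "monoidally_equivalent_along B simple_obj simple_obj \<rho> (fus_cat B F) (fus_cat B F')"
      if "\<forall>m\<in>\<B>. eval_monomial F m = eval_monomial F' (act_monomial \<rho> m)"
      by (rule converse[OF assms(5,6) that])
  next
    assume "monoidally_equivalent (fus_cat B F) (fus_cat B F')"
    then obtain \<sigma> where \<sigma>: "\<sigma> \<in> based_aut B"
      "monoidally_equivalent_along B simple_obj simple_obj \<sigma> (fus_cat B F) (fus_cat B F')"
      using equivalence_permutes_simples[OF B assms(2)]
      unfolding monoidally_equivalent_def monoidally_equivalent_along_def by metis
    show "\<exists>\<sigma>\<in>based_aut B. act_phi \<sigma> ` zeros B F = zeros B F' \<and>
        (\<forall>m\<in>\<B>. eval_monomial F m = eval_monomial F' (act_monomial \<sigma> m))"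
      by (intro bexI[OF _ \<sigma>(1)] conjI along_zeros[OF \<sigma>] along[OF \<sigma>])
  next
    assume "\<exists>\<sigma>\<in>based_aut B. act_phi \<sigma> ` zeros B F = zeros B F' \<and>
      (\<forall>m\<in>\<B>. eval_monomial F m = eval_monomial F' (act_monomial \<sigma> m))"
    then obtain \<sigma> where "\<sigma> \<in> based_aut B" "act_phi \<sigma> ` zeros B F = zeros B F'"
      "\<forall>m\<in>\<B>. eval_monomial F m = eval_monomial F' (act_monomial \<sigma> m)"
      by (elim bexE conjE)
    from converse[OF this] show "monoidally_equivalent (fus_cat B F) (fus_cat B F')"
      unfolding monoidally_equivalent_def monoidally_equivalent_along_def by (elim exE conjE) (intro exI conjI)
  qed
qed

end
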